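(* Let $\omega>0$ be a constant, let $\pi_0$ be a probability density on $\mathbb{R}$ satisfying conditions [C.2] and [C.3] with polynomial order $\alpha>1$, and let the true parameters $\theta^*\in\mathbb{R}^n$ have exactly $s=s^{(n)}$ nonzero entries with $s=o(n)$ (condition [C.1]). Let the global shrinkage parameter $\tau$ be assigned a prior distribution $\pi(\tau)$ (which may depend on $n$). Suppose that $\alpha\leq 1+\omega/2$, that $\pi(\tau)$ satisfies $$-\log\pi\{(s/n)^{(1+\omega/2)/(\alpha-1)}\leq \tau\leq (s/n)^{\alpha/(\alpha-1)}\}\prec s\log(n/s)$$ and $$-\log\pi\{\tau\geq(s/n)^{\alpha/(\alpha-1)}\}\succ s\log(n/s),$$ and that $\max_j|\theta^*_j|\leq (n/s)^{\omega/(5\alpha)}$. Then $$\lim_{n\to\infty} E^*\Big(\pi\big[\|\theta-\theta^*\|\geq C_1(\omega)\{s\log(n/s)\}^{1/2}\,\big|\,D_n\big]\Big)=0$$ and $$\lim_{n\to\infty} E^*\Big(\pi\big[\|\theta-\theta^*\|_1\geq s\,C_2(\omega)\{\log(n/s)\}^{1/2}\,\big|\,D_n\big]\Big)=0,$$ where $C_1(\omega)=\sqrt{2+\omega}+\sqrt{\omega}$ and $C_2(\omega)=\sqrt{2+\omega}+\sqrt{\omega^2/5}+\sqrt{\omega/5}$.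
   Context: Model: for each $n$ one observes $D_n=\{y_i\}_{i=1}^n$ with $y=\theta+\epsilon$, where $y=(y_1,\dots,y_n)^T\in\mathbb{R}^n$, $\epsilon\sim N(0,I_n)$, and $\theta=(\theta_1,\dots,\theta_n)^T\in\mathbb{R}^n$ is the unknown parameter. The true value $\theta^*=\theta^{*(n)}\in\mathbb{R}^n$ has $s=s^{(n)}\ge 1$ nonzero entries; $s$ may grow with $n$. $E^*$ denotes expectation over the data $D_n$ generated under the true parameter $\theta^*$. The asymptotics are as $n\to\infty$; $\pi_0$, $\alpha$, $\omega$ do not depend on $n$. Prior: given the global shrinkage parameter $\tau>0$, $\pi(\theta|\tau)=\prod_{i=1}^n (1/\tau)\pi_0(\theta_i/\tau)$, and $\tau\sim\pi(\tau)$. For a set of values of $\tau$, $\pi\{\cdot\}$ denotes its prior probability under $\pi(\tau)$. $\pi(\cdot|D_n)$ denotes the posterior distribution of $\theta$ given $D_n$ (with $\tau$ integrated out). Conditions: [C.1] $s=o(n)$. [C.2] The density $\pi_0(\cdot)$ is strictly decreasing on $(0,\infty)$ and increasing on $(-\infty,0)$. [C.3] The tail of $\pi_0$ is polynomially decaying with polynomial order $\alpha>1$: there exist positive constants $M$ and $K_2>K_1$ such that $K_1|\theta|^{-\alpha}\le \pi_0(\theta)\le K_2|\theta|^{-\alpha}$ for all $|\theta|>M$. Notation: $\|\cdot\|$ and $\|\cdot\|_1$ are the $L_2$ and $L_1$ norms of a vector. For positive sequences, $a_n\succ b_n$ means $\lim(a_n/b_n)=\infty$, and $a_n\prec b_n$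 means $b_n\succ a_n$. *)

theory Defs
  imports "HOL-Probability.Probability" "HOL-Library.Landau_Symbols"
begin

text \<open>
  Vectors in \<open>\<real>\<^sup>n\<close> are functions \<open>nat \<Rightarrow> real\<close> on the index set \<open>{..<n}\<close>, i.e. elements of the
  space of \<open>PiM {..<n} (\<lambda>_. lborel)\<close>.
\<close>

definition is_prob_density :: "(real \<Rightarrow> real) \<Rightarrow> bool" where
  "is_prob_density f \<longleftrightarrow>
     f \<in> borel_measurable borel \<and> (\<forall>x. 0 \<le> f x) \<and> (\<integral>\<^sup>+x. ennreal (f x) \<partial>lborel) = 1"

text \<open>Only the monotonicity on the positive half-line is required to be strict.\<close>

definition unimodal_density :: "(real \<Rightarrow> real) \<Rightarrow> bool" where
  "unimodal_density f \<longleftrightarrow> strict_antimono_on {0<..} f \<and> mono_on {..<0} f"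

definition polynomial_tail :: "real \<Rightarrow> (real \<Rightarrow> real) \<Rightarrow> bool" where
  "polynomial_tail \<alpha> f \<longleftrightarrow>
     (\<exists>M K1 K2. 0 < M \<and> 0 < K1 \<and> K1 < K2 \<and>
        (\<forall>x. M < \<bar>x\<bar> \<longrightarrow> K1 * \<bar>x\<bar> powr (-\<alpha>) \<le> f x \<and> f x \<le> K2 * \<bar>x\<bar> powr (-\<alpha>)))"

definition is_scale_prior :: "real measure \<Rightarrow> bool" where
  "is_scale_prior P \<longleftrightarrow> prob_space P \<and> sets P = sets borel \<and> (AE \<tau> in P. 0 < \<tau>)"

definition noise_law :: "nat \<Rightarrow> (nat \<Rightarrow> real) measure" where
  "noise_law n = PiM {..<n} (\<lambda>_. density lborel (\<lambda>x. ennreal (std_normal_density x)))"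

definition data_law :: "nat \<Rightarrow> (nat \<Rightarrow> real) \<Rightarrow> (nat \<Rightarrow> real) measure" where
  "data_law n \<theta> =
     distr (noise_law n) (PiM {..<n} (\<lambda>_. lborel)) (\<lambda>\<epsilon>. \<lambda>i\<in>{..<n}. \<theta> i + \<epsilon> i)"

definition likelihood :: "nat \<Rightarrow> (nat \<Rightarrow> real) \<Rightarrow> (nat \<Rightarrow> real) \<Rightarrow> real" where
  "likelihood n y \<theta> = (\<Prod>i<n. std_normal_density (y i - \<theta> i))"

definition prior_density_given :: "(real \<Rightarrow> real) \<Rightarrow> nat \<Rightarrow> real \<Rightarrow> (nat \<Rightarrow> real) \<Rightarrow> real" where
  "prior_density_given \<pi>\<^sub>0 n \<tau> \<theta> = (\<Prod>i<n. (1 / \<tau>) * \<pi>\<^sub>0 (\<theta> i / \<tau>))"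

definition prior_density ::
  "(real \<Rightarrow> real) \<Rightarrow> real measure \<Rightarrow> nat \<Rightarrow> (nat \<Rightarrow> real) \<Rightarrow> ennreal" where
  "prior_density \<pi>\<^sub>0 P n \<theta> = (\<integral>\<^sup>+\<tau>. ennreal (prior_density_given \<pi>\<^sub>0 n \<tau> \<theta>) \<partial>P)"

text \<open>
  Bayes' formula. When \<open>\<pi>\<^sub>0\<close> is a probability density and \<open>P\<close> a prior on the scale, the normalising
  constant lies strictly between \<open>0\<close> and \<open>\<infinity>\<close> for every \<open>y\<close>, since the likelihood is positive and
  bounded, so the posterior is a probability measure, defined pointwise in \<open>y\<close>.
\<close>

definition posterior ::
  "(real \<Rightarrow> real) \<Rightarrow> real measure \<Rightarrow> nat \<Rightarrow> (nat \<Rightarrow> real) \<Rightarrow> (nat \<Rightarrow> real) measure" where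
  "posterior \<pi>\<^sub>0 P n y =
     density (PiM {..<n} (\<lambda>_. lborel))
       (\<lambda>\<theta>. ennreal (likelihood n y \<theta>) * prior_density \<pi>\<^sub>0 P n \<theta> /
            (\<integral>\<^sup>+\<theta>'. ennreal (likelihood n y \<theta>') * prior_density \<pi>\<^sub>0 P n \<theta>'
               \<partial>PiM {..<n} (\<lambda>_. lborel)))"

definition l2_dist :: "nat \<Rightarrow> (nat \<Rightarrow> real) \<Rightarrow> (nat \<Rightarrow> real) \<Rightarrow> real" where
  "l2_dist n \<theta> \<theta>' = L2_set (\<lambda>i. \<theta> i - \<theta>' i) {..<n}"

definition l1_dist :: "nat \<Rightarrow> (nat \<Rightarrow> real) \<Rightarrow> (nat \<Rightarrow> real) \<Rightarrow> real" where
  "l1_dist n \<theta> \<theta>' = (\<Sum>i<n. \<bar>\<theta> i - \<theta>' i\<bar>)"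

text \<open>
  \<open>E\<^sup>* (\<pi>[\<theta> \<in> A | D\<^sub>n])\<close>, with \<open>\<theta>s\<close> the true parameter. The integrand takes values in \<open>[0, 1]\<close>; the
  nonnegative integral avoids the default value \<open>0\<close> of a non-integrable Bochner integral.
\<close>

definition expected_posterior_prob ::
  "(real \<Rightarrow> real) \<Rightarrow> real measure \<Rightarrow> nat \<Rightarrow> (nat \<Rightarrow> real) \<Rightarrow> ((nat \<Rightarrow> real) \<Rightarrow> bool) \<Rightarrow> ennreal" where
  "expected_posterior_prob \<pi>\<^sub>0 P n \<theta>s A =
     (\<integral>\<^sup>+y. emeasure (posterior \<pi>\<^sub>0 P n y) {\<theta> \<in> space (posterior \<pi>\<^sub>0 P n y). A \<theta>} \<partial>data_law n \<theta>s)"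

text \<open>\<open>-log p\<close> with \<open>-log 0 = \<infinity>\<close>, unlike the library's \<open>ln 0 = 0\<close>.\<close>

definition neg_log :: "real \<Rightarrow> ereal" where
  "neg_log p = (if p = 0 then \<infinity> else ereal (- ln p))"

text \<open>
  In \<^typ>\<open>ereal\<close> one has \<open>c / 0 = \<infinity>\<close> for \<open>c > 0\<close> and \<open>c / \<infinity> = 0\<close> for finite \<open>c\<close>, so the relation also
  behaves as expected when a term of a sequence is \<open>0\<close> (a set of prior probability 1) or \<open>\<infinity>\<close>
  (a set of prior probability 0).
\<close>

definition dominates :: "(nat \<Rightarrow> ereal) \<Rightarrow> (nat \<Rightarrow> ereal) \<Rightarrow> bool" (infix "\<succ>\<succ>" 50) where
  "a \<succ>\<succ> b \<longleftrightarrow> ((\<lambda>n. a n / b n) \<longlongrightarrow> \<infinity>) sequentially"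

abbreviation dominated_by :: "(nat \<Rightarrow> ereal) \<Rightarrow> (nat \<Rightarrow> ereal) \<Rightarrow> bool" (infix "\<prec>\<prec>" 50) where
  "a \<prec>\<prec> b \<equiv> b \<succ>\<succ> a"

definition C1 :: "real \<Rightarrow> real" where
  "C1 \<omega> = sqrt (2 + \<omega>) + sqrt \<omega>"

definition C2 :: "real \<Rightarrow> real" where
  "C2 \<omega> = sqrt (2 + \<omega>) + sqrt (\<omega>\<^sup>2 / 5) + sqrt (\<omega> / 5)"

end

theory Submission
  imports Defs
begin

text \<open>
  Write \<open>y = \<theta>\<^sup>* + e\<close>, let \<open>S\<close> be the support of \<open>\<theta>\<^sup>*\<close>, \<open>r = s / n\<close>, \<open>L = ln (n / s)\<close> and
  \<open>\<beta> = 1 + \<omega> / 2\<close>. Given the scale \<open>\<tau>\<close> the coordinates are independent, so numerator and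
  denominator of the posterior are mixtures over \<open>\<tau>\<close> of products of one-dimensional integrals
  against \<open>\<phi> (y - x)\<close> times the scaled prior density. Everything rests on bounds for these integrals
  that hold for all \<open>\<tau> \<le> 1\<close> with constants free of \<open>n\<close>.

  \<^bold>\<open>The denominator.\<close> For \<open>\<tau>\<close> in the window \<open>[r\<^bsup>\<beta>/(\<alpha>-1)\<^esup>, r\<^bsup>\<alpha>/(\<alpha>-1)\<^esup>]\<close> a null
  coordinate keeps all but a fraction \<open>O(r)\<close> of the prior mass in \<open>[-r, r]\<close> (lemma
  \<open>null_evidence_lower\<close>), which costs a factor \<open>exp (- O(s))\<close> over all \<open>n\<close> coordinates. A signal
  coordinate is paid for by the prior tail, a factor of order \<open>r\<^bsup>\<beta>\<^esup> (1 + |\<theta>\<^sub>i\<^sup>*|)\<^bsup>-\<alpha>\<^esup>\<close> (lemma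
  \<open>signal_evidence_lower\<close>). Off a noise event of probability \<open>O(1 / sqrt L)\<close> the denominator, relative
  to the noise density, is therefore at least the window probability, \<open>exp (- o(s L))\<close>, times
  \<open>exp (- \<beta> s L - o(s L))\<close> times the product of \<open>(1 + |\<theta>\<^sub>i\<^sup>*|)\<^bsup>-\<alpha>\<^esup>\<close>.

  \<^bold>\<open>The numerator\<close> is split into three parts.

  \<^item> Scales above the window. The null likelihood ratio has mean one, so this part is of the order of
    the prior probability \<open>exp (- K s L)\<close> with \<open>K\<close> arbitrarily large. The bound on the signals makes
    the loss in the denominator at most \<open>exp (O(s L))\<close>.

  \<^item> Smaller scales with a large error on \<open>S\<close>. An exponential moment \<open>exp (\<rho> / 2 * |\<theta> - \<theta>\<^sup>*|\<^sup>2)\<close>,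
    \<open>\<rho> < 1\<close>, still factorises, and each factor is, up to the
    noise, at most a constant times \<open>(1 + |\<theta>\<^sub>i\<^sup>*|)\<^bsup>-\<alpha>\<^esup>\<close> (lemma \<open>signal_moment_upper\<close>): the same signal-dependent factor as in the denominator, so it
    cancels. The event that the squared error exceeds \<open>\<beta>' s L\<close> thus gets posterior mass
    \<open>exp (- (\<rho> \<beta>' / 2 - \<beta>) s L + o(s L))\<close>, negligible as soon as \<open>\<beta>' > 2 \<beta> = 2 + \<omega>\<close>.

  \<^item> Smaller scales with a large error off \<open>S\<close>. The conditional mean of \<open>\<theta>\<^sub>i\<^sup>2 + |\<theta>\<^sub>i|\<close> given \<open>\<tau>\<close> and
    \<open>y\<^sub>i\<close> is bounded uniformly over \<open>\<tau> \<le> r\<^bsup>\<alpha>/(\<alpha>-1)\<^esup>\<close> by a function of \<open>e\<^sub>i\<close> with mean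
    \<open>O(r\<^bsup>1+d\<^esup>)\<close>, \<open>d > 0\<close> (lemma \<open>null_moment_upper\<close>). The uniformity makes the dependence of the
    posterior of \<open>\<tau>\<close> on the data harmless, and Markov's inequality leaves \<open>O(r\<^bsup>d\<^esup>)\<close>.

  Hence the error is at most \<open>sqrt (\<beta>' s L)\<close> on \<open>S\<close>, and at most \<open>s * sqrt (\<beta>' L)\<close> in \<open>L\<^sub>1\<close> norm by
  Cauchy's inequality, while the null coordinates contribute a vanishing fraction of the allowance.
  Since both \<open>C1 \<omega>\<close> and \<open>C2 \<omega>\<close> exceed \<open>sqrt (2 + \<omega>)\<close>, a \<open>\<beta>'\<close> below their squares is available.
\<close>

section \<open>Gaussian and power-law integrals\<close>

abbreviation \<phi> :: "real \<Rightarrow> real" where "\<phi> \<equiv> std_normal_density"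

lemma phi_shift: "\<phi> (x - y) = \<phi> x * exp (x * y - y\<^sup>2 / 2)"
proof -
  have "- (x - y)\<^sup>2 / 2 = - x\<^sup>2 / 2 + (x * y - y\<^sup>2 / 2)"
    by (simp add: power2_eq_square field_simps)
  then show ?thesis
    by (simp add: std_normal_density_def exp_add[symmetric])
qed

lemma phi_pos [simp]: "0 < \<phi> x" "0 \<le> \<phi> x" "\<phi> x \<noteq> 0"
  by (auto simp: std_normal_density_def)

lemma phi_le_1: "\<phi> x \<le> 1"
proof -
  have "1 \<le> sqrt (2 * pi)" using pi_gt3 by (simp add: real_le_rsqrt)
  moreover have "exp (- (x\<^sup>2 / 2)) \<le> 1" by simp
  ultimately have "exp (- (x\<^sup>2 / 2)) \<le> sqrt (2 * pi)" by (rule order_trans[rotated])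
  then show ?thesis by (simp add: std_normal_density_def divide_le_eq)
qed

lemma one_le_phi: "1 \<le> \<phi> x * exp (2 + x\<^sup>2 / 2)"
proof -
  have "(1 + 1) * (1 + 1) \<le> exp 1 * exp (1::real)"
    using exp_ge_add_one_self[of 1] by (intro mult_mono) auto
  then have "4 \<le> exp (2::real)" by (simp add: exp_add[symmetric])
  moreover have "sqrt (2 * pi) \<le> 4"
    using pi_less_4 by (intro real_le_lsqrt) auto
  ultimately have "sqrt (2 * pi) \<le> exp 2" by linarith
  moreover have "\<phi> x * exp (2 + x\<^sup>2 / 2) = exp 2 / sqrt (2 * pi)"
    by (simp add: std_normal_density_def exp_add exp_minus)
  ultimately show ?thesis by (simp add: le_divide_eq)
qed

lemma nn_integral_phi: "(\<integral>\<^sup>+x. ennreal (\<phi> x) \<partial>lborel) = 1"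
proof -
  interpret prob_space "density lborel (\<lambda>x. ennreal (\<phi> x))"
    by (rule prob_space_normal_density) simp
  show ?thesis using emeasure_space_1 by (simp add: emeasure_density)
qed

lemma nn_integral_phi_shift: "(\<integral>\<^sup>+x. ennreal (\<phi> (x - y)) \<partial>lborel) = 1"
proof -
  have "(\<integral>\<^sup>+x. ennreal (\<phi> (x - y)) \<partial>lborel) = (\<integral>\<^sup>+x. ennreal (\<phi> (y + 1 * x - y)) \<partial>lborel)"
    by (subst nn_integral_real_affine[where c=1 and t=y]) auto
  then show ?thesis by (simp add: nn_integral_phi)
qed

lemma nn_integral_powr_tail:
  assumes "1 < c" "0 < R"
  shows "(\<integral>\<^sup>+x. ennreal (\<bar>x\<bar> powr - c) * indicator {x. R < \<bar>x\<bar>} x \<partial>lborel)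
          \<le> ennreal (2 * R powr (1 - c) / (c - 1))"
proof -
  have half: "(\<integral>\<^sup>+x\<in>{R..}. ennreal (x powr - c) \<partial>lborel) = ennreal (R powr (1 - c) / (c - 1))"
  proof -
    have "((\<lambda>x. x powr (- c)) has_integral - (R powr (- c + 1)) / (- c + 1)) {R..}"
      using assms by (intro has_integral_powr_to_inf) auto
    moreover have "- (R powr (- c + 1)) / (- c + 1) = R powr (1 - c) / (c - 1)"
      by (metis minus_diff_eq minus_divide_divide uminus_add_conv_diff)
    ultimately show ?thesis
      by (intro nn_integral_has_integral_lebesgue') auto
  qed
  have "(\<integral>\<^sup>+x. ennreal (\<bar>x\<bar> powr - c) * indicator {x. R < \<bar>x\<bar>} x \<partial>lborel)
     \<le> (\<integral>\<^sup>+x. ennreal (x powr - c) * indicator {R..} x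
              + ennreal ((- x) powr - c) * indicator {R..} (- x) \<partial>lborel)"
    by (intro nn_integral_mono) (auto simp: indicator_def abs_if)
  also have "\<dots> = (\<integral>\<^sup>+x. ennreal (x powr - c) * indicator {R..} x \<partial>lborel)
              + (\<integral>\<^sup>+x. ennreal ((- x) powr - c) * indicator {R..} (- x) \<partial>lborel)"
    by (rule nn_integral_add) auto
  also have "(\<integral>\<^sup>+x. ennreal ((- x) powr - c) * indicator {R..} (- x) \<partial>lborel)
     = (\<integral>\<^sup>+x. ennreal (x powr - c) * indicator {R..} x \<partial>lborel)"
    by (subst (2) nn_integral_real_affine[where c="-1" and t=0]) auto
  also have "(\<integral>\<^sup>+x. ennreal (x powr - c) * indicator {R..} x \<partial>lborel)
     + (\<integral>\<^sup>+x. ennreal (x powr - c) * indicator {R..} x \<partial>lborel) = ennreal (2 * R powr (1 - c) / (c - 1))"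
    using assms by (simp add: half ennreal_plus[symmetric] del: ennreal_plus)
  finally show ?thesis .
qed

lemma nn_integral_phi_quadratic:
  assumes "0 \<le> a" "0 \<le> b"
  shows "(\<integral>\<^sup>+x. ennreal ((a + b * x\<^sup>2) * \<phi> x) \<partial>lborel) = ennreal (a + b)"
proof -
  have "has_bochner_integral lborel (\<lambda>x. \<phi> x * x ^ 0 * a + \<phi> x * x\<^sup>2 * b) (1 * a + 1 * b)"
    using std_normal_moment_even[of 0] std_normal_moment_even[of 1]
    by (intro has_bochner_integral_add has_bochner_integral_mult_left) auto
  moreover have "(\<lambda>x. \<phi> x * x ^ 0 * a + \<phi> x * x\<^sup>2 * b) = (\<lambda>x. (a + b * x\<^sup>2) * \<phi> x)"
    by (auto simp: algebra_simps)
  ultimately have i: "has_bochner_integral lborel (\<lambda>x. (a + b * x\<^sup>2) * \<phi> x) (a + b)" by simp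
  have "(\<integral>\<^sup>+x. ennreal ((a + b * x\<^sup>2) * \<phi> x) \<partial>lborel) = ennreal (\<integral>x. (a + b * x\<^sup>2) * \<phi> x \<partial>lborel)"
    using assms by (intro nn_integral_eq_integral integrable.intros[OF i]) auto
  then show ?thesis by (simp only: has_bochner_integral_integral_eq[OF i])
qed

lemma nn_integral_gaussian:
  assumes "0 < \<kappa>"
  shows "(\<integral>\<^sup>+x. ennreal (exp (- \<kappa> * (x - t)\<^sup>2)) \<partial>lborel) = ennreal (sqrt (pi / \<kappa>))"
proof -
  define \<sigma> where "\<sigma> = sqrt (1 / (2 * \<kappa>))"
  have \<sigma>: "0 < \<sigma>" "\<sigma>\<^sup>2 = 1 / (2 * \<kappa>)" using assms by (auto simp: \<sigma>_def)
  interpret prob_space "density lborel (\<lambda>x. ennreal (normal_density t \<sigma> x))"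
    by (rule prob_space_normal_density) (rule \<sigma>)
  have 1: "(\<integral>\<^sup>+x. ennreal (normal_density t \<sigma> x) \<partial>lborel) = 1"
    using emeasure_space_1 by (simp add: emeasure_density)
  have "exp (- \<kappa> * (x - t)\<^sup>2) = sqrt (pi / \<kappa>) * normal_density t \<sigma> x" for x
  proof -
    have "2 * pi * \<sigma>\<^sup>2 = pi / \<kappa>" "- (x - t)\<^sup>2 / (2 * \<sigma>\<^sup>2) = - \<kappa> * (x - t)\<^sup>2"
      using assms by (simp_all add: \<sigma>(2))
    then show ?thesis using assms by (simp add: normal_density_def)
  qed
  then have "(\<integral>\<^sup>+x. ennreal (exp (- \<kappa> * (x - t)\<^sup>2)) \<partial>lborel)
      = (\<integral>\<^sup>+x. ennreal (sqrt (pi / \<kappa>)) * ennreal (normal_density t \<sigma> x) \<partial>lborel)"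
    using assms by (simp add: ennreal_mult)
  also have "\<dots> = ennreal (sqrt (pi / \<kappa>))"
    by (subst nn_integral_cmult) (auto simp: 1)
  finally show ?thesis .
qed

lemma mult_le_square_add:
  fixes a b :: real
  assumes "0 < c"
  shows "a * b \<le> c * b\<^sup>2 + a\<^sup>2 / (4 * c)"
proof -
  define k where "k = a / (2 * c)"
  have k: "a = 2 * c * k" using assms by (simp add: k_def)
  have "0 \<le> c * (b - k)\<^sup>2" using assms by simp
  moreover have "a\<^sup>2 / (4 * c) = c * k\<^sup>2"
    using assms by (simp add: k power2_eq_square)
  moreover have "c * (b - k)\<^sup>2 = c * b\<^sup>2 + c * k\<^sup>2 - a * b"
    by (simp add: k power2_diff algebra_simps)
  ultimately show ?thesis by linarith
qed

text \<open>
  For \<open>p < 1\<close> a Gaussian factor survives and absorbs the linear exponent.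
\<close>

lemma gaussian_exp_moment_finite:
  assumes "p < 1"
  shows "\<exists>B>0. (\<integral>\<^sup>+y. ennreal (exp (A * \<bar>y\<bar> + p * y\<^sup>2 / 2) * \<phi> y) \<partial>lborel) \<le> ennreal B"
proof -
  define c where "c = (1 - p) / 4"
  have c: "0 < c" using assms by (simp add: c_def)
  define B where "B = exp (A\<^sup>2 / (4 * c)) * sqrt (pi / c)"
  have le: "exp (A * \<bar>y\<bar> + p * y\<^sup>2 / 2) * \<phi> y \<le> exp (A\<^sup>2 / (4 * c)) * exp (- c * (y - 0)\<^sup>2)" for y
  proof -
    have "1 / sqrt (2 * pi) \<le> 1" using phi_le_1[of 0] by (simp add: std_normal_density_def)
    then have "\<phi> y \<le> exp (- y\<^sup>2 / 2)"
      using mult_right_mono[of "1 / sqrt (2 * pi)" 1 "exp (- y\<^sup>2 / 2)"] by (simp add: std_normal_density_def)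
    then have "exp (A * \<bar>y\<bar> + p * y\<^sup>2 / 2) * \<phi> y \<le> exp (A * \<bar>y\<bar> + p * y\<^sup>2 / 2) * exp (- y\<^sup>2 / 2)"
      by (intro mult_left_mono) auto
    also have "\<dots> = exp (A * \<bar>y\<bar> - 2 * c * y\<^sup>2)"
    proof -
      have "A * \<bar>y\<bar> + p * y\<^sup>2 / 2 + - y\<^sup>2 / 2 = A * \<bar>y\<bar> - 2 * c * y\<^sup>2"
        by (simp add: c_def left_diff_distrib diff_divide_distrib)
      then show ?thesis by (metis exp_add)
    qed
    also have "\<dots> \<le> exp (A\<^sup>2 / (4 * c) - c * y\<^sup>2)"
      using mult_le_square_add[OF c, of A "\<bar>y\<bar>"] unfolding exp_le_cancel_iff power2_abs by linarith
    also have "\<dots> = exp (A\<^sup>2 / (4 * c)) * exp (- c * (y - 0)\<^sup>2)"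
      unfolding diff_0_right by (simp only: mult_minus_left exp_add[symmetric] diff_conv_add_uminus)
    finally show ?thesis .
  qed
  have "(\<integral>\<^sup>+y. ennreal (exp (A * \<bar>y\<bar> + p * y\<^sup>2 / 2) * \<phi> y) \<partial>lborel)
      \<le> (\<integral>\<^sup>+y. ennreal (exp (A\<^sup>2 / (4 * c))) * ennreal (exp (- c * (y - 0)\<^sup>2)) \<partial>lborel)"
    using le by (intro nn_integral_mono) (simp only: ennreal_mult'[symmetric] exp_ge_zero ennreal_leI)
  also have "\<dots> = ennreal B"
    unfolding B_def ennreal_mult'[OF exp_ge_zero]
    by (subst nn_integral_cmult, measurable) (simp only: nn_integral_gaussian[OF c])
  finally show ?thesis using c by (intro exI[of _ B]) (auto simp: B_def)
qed

lemma one_plus_powr_gaussian_bound: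
  fixes u :: real
  assumes "0 \<le> u" "0 < c" "0 \<le> a"
  shows "(1 + u) powr a * exp (- c * u\<^sup>2) \<le> exp (a\<^sup>2 / (4 * c))"
proof -
  have "(1 + u) powr a = exp (a * ln (1 + u))" using assms by (simp add: powr_def)
  also have "\<dots> \<le> exp (a * u)"
    using assms by (simp add: mult_left_mono ln_add_one_self_le_self)
  finally have "(1 + u) powr a * exp (- c * u\<^sup>2) \<le> exp (a * u) * exp (- c * u\<^sup>2)"
    by (intro mult_right_mono) auto
  also have "\<dots> = exp (a * u - c * u\<^sup>2)" by (simp only: exp_add[symmetric] diff_conv_add_uminus mult_minus_left)
  also have "\<dots> \<le> exp (a\<^sup>2 / (4 * c))"
    using mult_le_square_add[OF assms(2), of a u] unfolding exp_le_cancel_iff by linarith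
  finally show ?thesis .
qed

lemma square_mult_exp_le: "0 < c \<Longrightarrow> x\<^sup>2 * exp (- c * x\<^sup>2) \<le> 1 / c" for x c :: real
proof -
  assume c: "0 < c"
  have "c * x\<^sup>2 \<le> exp (c * x\<^sup>2)" using exp_ge_add_one_self[of "c * x\<^sup>2"] by linarith
  then have "c * x\<^sup>2 * exp (- (c * x\<^sup>2)) \<le> exp (c * x\<^sup>2) * exp (- (c * x\<^sup>2))"
    by (rule mult_right_mono) simp
  also have "\<dots> = 1" by (simp only: exp_add[symmetric]) simp
  finally show ?thesis using c by (simp add: field_simps)
qed

lemma square_le_exp_abs: "x\<^sup>2 \<le> 2 * exp \<bar>x\<bar>" for x :: real
  using exp_lower_Taylor_quadratic[of "\<bar>x\<bar>"] by simp

lemma phi_le_exp: "\<phi> x \<le> exp (- x\<^sup>2 / 2)"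
proof -
  have "\<phi> x = \<phi> 0 * exp (- x\<^sup>2 / 2)" by (simp add: std_normal_density_def)
  also have "\<dots> \<le> 1 * exp (- x\<^sup>2 / 2)" by (intro mult_right_mono phi_le_1) simp
  finally show ?thesis by simp
qed

lemma square_mult_phi_le: "x\<^sup>2 * \<phi> x \<le> 2"
proof -
  have "x\<^sup>2 * \<phi> x \<le> x\<^sup>2 * exp (- (1/2) * x\<^sup>2)" using phi_le_exp[of x] by (intro mult_left_mono) auto
  also have "\<dots> \<le> 1 / (1/2)" by (rule square_mult_exp_le) simp
  finally show ?thesis by simp
qed

lemma exp_le_one_minus: "0 \<le> x \<Longrightarrow> x \<le> 1 / 2 \<Longrightarrow> exp (- 2 * x) \<le> 1 - x" for x :: real
proof -
  assume x: "0 \<le> x" "x \<le> 1 / 2"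
  have "1 + 2 * x \<le> exp (2 * x)" by (rule exp_ge_add_one_self)
  then have "exp (- (2 * x)) \<le> 1 / (1 + 2 * x)"
    using x unfolding exp_minus inverse_eq_divide by (intro divide_left_mono) auto
  moreover have "1 / (1 + 2 * x) \<le> 1 - x"
  proof -
    have "0 \<le> x * (1 - 2 * x)" using x by simp
    then have "1 \<le> (1 - x) * (1 + 2 * x)" by (simp add: algebra_simps)
    then show ?thesis using x by (simp add: divide_le_eq)
  qed
  ultimately show ?thesis by simp
qed

section \<open>One coordinate: the scaled prior and its evidence\<close>

definition scaled :: "(real \<Rightarrow> real) \<Rightarrow> real \<Rightarrow> real \<Rightarrow> real" where
  "scaled f \<tau> x = (1 / \<tau>) * f (x / \<tau>)"

text \<open>
  The marginal density of one observation under the prior of scale \<open>\<tau>\<close>.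
\<close>

definition evidence :: "(real \<Rightarrow> real) \<Rightarrow> real \<Rightarrow> real \<Rightarrow> ennreal" where
  "evidence f \<tau> y = (\<integral>\<^sup>+x. ennreal (\<phi> (y - x) * scaled f \<tau> x) \<partial>lborel)"

lemma measurable_scaled [measurable]:
  assumes [measurable]: "f \<in> borel_measurable borel"
  shows "case_prod (scaled f) \<in> borel_measurable (borel \<Otimes>\<^sub>M borel)" "scaled f \<tau> \<in> borel_measurable borel"
  unfolding scaled_def by measurable

lemma measurable_evidence [measurable]:
  assumes [measurable]: "f \<in> borel_measurable borel"
  shows "case_prod (evidence f) \<in> borel_measurable (borel \<Otimes>\<^sub>M borel)" "evidence f \<tau> \<in> borel_measurable borel"
proof -
  have "(\<lambda>p. \<integral>\<^sup>+x. ennreal (\<phi> (snd p - x) * scaled f (fst p) x) \<partial>lborel)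
      \<in> borel_measurable (borel \<Otimes>\<^sub>M borel)"
    unfolding scaled_def by measurable
  then show 1: "case_prod (evidence f) \<in> borel_measurable (borel \<Otimes>\<^sub>M borel)"
    by (simp add: evidence_def case_prod_beta')
  show "evidence f \<tau> \<in> borel_measurable borel"
    unfolding evidence_def by measurable
qed

abbreviation null_moment :: "(real \<Rightarrow> real) \<Rightarrow> real \<Rightarrow> real \<Rightarrow> ennreal" where
  "null_moment f \<tau> y \<equiv> (\<integral>\<^sup>+x. ennreal (x\<^sup>2 + \<bar>x\<bar>) * ennreal (\<phi> (y - x) * scaled f \<tau> x) \<partial>lborel)"

locale power_law_prior =
  fixes f :: "real \<Rightarrow> real" and \<alpha> M K\<^sub>1 K\<^sub>2 :: real
  assumes measurable_f [measurable]: "f \<in> borel_measurable borel"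
    and f_nonneg [simp]: "\<And>x. 0 \<le> f x"
    and nn_integral_f: "(\<integral>\<^sup>+x. ennreal (f x) \<partial>lborel) = 1"
    and \<alpha>: "1 < \<alpha>" and M: "0 < M" and K1: "0 < K\<^sub>1" and K2: "0 < K\<^sub>2"
    and tail_lower: "\<And>x. M < \<bar>x\<bar> \<Longrightarrow> K\<^sub>1 * \<bar>x\<bar> powr - \<alpha> \<le> f x"
    and tail_upper: "\<And>x. M < \<bar>x\<bar> \<Longrightarrow> f x \<le> K\<^sub>2 * \<bar>x\<bar> powr - \<alpha>"
begin

lemma scaled_nonneg: "0 < \<tau> \<Longrightarrow> 0 \<le> scaled f \<tau> x"
  by (simp add: scaled_def)

lemma nn_integral_scaled:
  assumes [measurable]: "g \<in> borel_measurable borel" and "0 < \<tau>"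
  shows "(\<integral>\<^sup>+x. g x * ennreal (scaled f \<tau> x) \<partial>lborel) = (\<integral>\<^sup>+x. g (\<tau> * x) * ennreal (f x) \<partial>lborel)"
proof -
  have "(\<integral>\<^sup>+x. g x * ennreal (scaled f \<tau> x) \<partial>lborel)
      = ennreal \<tau> * (\<integral>\<^sup>+x. g (\<tau> * x) * ennreal (scaled f \<tau> (\<tau> * x)) \<partial>lborel)"
    using assms by (subst nn_integral_real_affine[where c=\<tau> and t=0]) auto
  also have "\<dots> = (\<integral>\<^sup>+x. ennreal \<tau> * (g (\<tau> * x) * ennreal (scaled f \<tau> (\<tau> * x))) \<partial>lborel)"
    by (rule nn_integral_cmult[symmetric]) measurable
  also have "\<dots> = (\<integral>\<^sup>+x. g (\<tau> * x) * ennreal (f x) \<partial>lborel)"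
  proof (rule nn_integral_cong)
    fix x
    have "ennreal \<tau> * ennreal (scaled f \<tau> (\<tau> * x)) = ennreal (f x)"
      using \<open>0 < \<tau>\<close> by (subst ennreal_mult'[symmetric]) (auto simp: scaled_def)
    then show "ennreal \<tau> * (g (\<tau> * x) * ennreal (scaled f \<tau> (\<tau> * x))) = g (\<tau> * x) * ennreal (f x)"
      by (metis mult.left_commute)
  qed
  finally show ?thesis .
qed

lemma nn_integral_scaled_1: "0 < \<tau> \<Longrightarrow> (\<integral>\<^sup>+x. ennreal (scaled f \<tau> x) \<partial>lborel) = 1"
  using nn_integral_scaled[of "\<lambda>_. 1" \<tau>] by (simp add: nn_integral_f)

text \<open>
  For \<open>\<tau> \<le> 1\<close> rescaling moves points outwards, so the tail bounds hold beyond the same threshold \<open>M\<close>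
  and the whole dependence on \<open>\<tau>\<close> is the factor \<open>\<tau>\<^bsup>\<alpha>-1\<^esup>\<close>.
\<close>

lemma scaled_tail:
  assumes "0 < \<tau>" "\<tau> \<le> 1" "M < \<bar>x\<bar>"
  shows "K\<^sub>1 * \<tau> powr (\<alpha> - 1) * \<bar>x\<bar> powr - \<alpha> \<le> scaled f \<tau> x"
    and "scaled f \<tau> x \<le> K\<^sub>2 * \<tau> powr (\<alpha> - 1) * \<bar>x\<bar> powr - \<alpha>"
proof -
  have "\<bar>x\<bar> \<le> \<bar>x\<bar> / \<tau>" using assms by (simp add: le_divide_eq mult_left_le)
  then have *: "M < \<bar>x / \<tau>\<bar>" using assms by simp
  have eq: "(1 / \<tau>) * (K * \<bar>x / \<tau>\<bar> powr - \<alpha>) = K * \<tau> powr (\<alpha> - 1) * \<bar>x\<bar> powr - \<alpha>" for K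
    using assms by (simp add: powr_divide powr_minus powr_diff divide_simps)
  show "K\<^sub>1 * \<tau> powr (\<alpha> - 1) * \<bar>x\<bar> powr - \<alpha> \<le> scaled f \<tau> x"
    unfolding scaled_def eq[symmetric] using tail_lower[OF *] assms by (intro mult_left_mono) auto
  show "scaled f \<tau> x \<le> K\<^sub>2 * \<tau> powr (\<alpha> - 1) * \<bar>x\<bar> powr - \<alpha>"
    unfolding scaled_def eq[symmetric] using tail_upper[OF *] assms by (intro mult_left_mono) auto
qed

text \<open>
  In terms of \<open>R = \<delta> / \<tau>\<close> this is \<open>P(|x| > R) = O(R\<^bsup>1-\<alpha>\<^esup>)\<close>. For \<open>R \<ge> M\<close> the tail bound is integrated;
  for \<open>R < M\<close> the right-hand side is made at least one by the summand \<open>M\<^bsup>\<alpha>-1\<^esup>\<close> of the constant.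
\<close>

lemma prior_tail_bound:
  "\<exists>K>0. \<forall>\<tau> \<delta>. 0 < \<tau> \<longrightarrow> 0 < \<delta> \<longrightarrow>
     (\<integral>\<^sup>+x. indicator {x. \<delta> < \<bar>x\<bar>} x * ennreal (scaled f \<tau> x) \<partial>lborel) \<le> ennreal (K * (\<tau> / \<delta>) powr (\<alpha> - 1))"
proof -
  define K where "K = 2 * K\<^sub>2 / (\<alpha> - 1) + M powr (\<alpha> - 1)"
  have "0 < K" using K2 M \<alpha> by (simp add: K_def add_pos_pos)
  moreover have "(\<integral>\<^sup>+x. indicator {x. \<delta> < \<bar>x\<bar>} x * ennreal (scaled f \<tau> x) \<partial>lborel)
      \<le> ennreal (K * (\<tau> / \<delta>) powr (\<alpha> - 1))" if "0 < \<tau>" "0 < \<delta>" for \<tau> \<delta>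
  proof -
    define R where "R = \<delta> / \<tau>"
    have R: "0 < R" using that by (simp add: R_def)
    have pw: "(\<tau> / \<delta>) powr (\<alpha> - 1) = R powr (1 - \<alpha>)"
      using that by (simp add: R_def powr_divide powr_diff mult.commute)
    have "(\<integral>\<^sup>+x. indicator {x. \<delta> < \<bar>x\<bar>} x * ennreal (scaled f \<tau> x) \<partial>lborel)
        = (\<integral>\<^sup>+x. indicator {x. \<delta> < \<bar>x\<bar>} (\<tau> * x) * ennreal (f x) \<partial>lborel)"
      using that by (intro nn_integral_scaled) auto
    also have "\<dots> = (\<integral>\<^sup>+x. indicator {x. R < \<bar>x\<bar>} x * ennreal (f x) \<partial>lborel)"
      using that by (intro nn_integral_cong) (auto simp: indicator_def R_def abs_mult field_simps)
    also have "\<dots> \<le> ennreal (K * R powr (1 - \<alpha>))"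
    proof (cases "M \<le> R")
      case True
      have "(\<integral>\<^sup>+x. indicator {x. R < \<bar>x\<bar>} x * ennreal (f x) \<partial>lborel)
          \<le> (\<integral>\<^sup>+x. ennreal K\<^sub>2 * (ennreal (\<bar>x\<bar> powr - \<alpha>) * indicator {x. R < \<bar>x\<bar>} x) \<partial>lborel)"
        using True tail_upper K2
        by (intro nn_integral_mono) (auto simp: indicator_def ennreal_mult[symmetric] intro!: ennreal_leI)
      also have "\<dots> = ennreal K\<^sub>2 * (\<integral>\<^sup>+x. ennreal (\<bar>x\<bar> powr - \<alpha>) * indicator {x. R < \<bar>x\<bar>} x \<partial>lborel)"
        by (rule nn_integral_cmult) measurable
      also have "\<dots> \<le> ennreal K\<^sub>2 * ennreal (2 * R powr (1 - \<alpha>) / (\<alpha> - 1))"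
        by (intro mult_left_mono nn_integral_powr_tail \<alpha> R) auto
      also have "\<dots> = ennreal (2 * K\<^sub>2 / (\<alpha> - 1) * R powr (1 - \<alpha>))"
        using K2 \<alpha> by (subst ennreal_mult'[symmetric]) (auto simp: field_simps)
      also have "\<dots> \<le> ennreal (K * R powr (1 - \<alpha>))"
        by (intro ennreal_leI mult_right_mono) (auto simp: K_def)
      finally show ?thesis .
    next
      case False
      have "(\<integral>\<^sup>+x. indicator {x. R < \<bar>x\<bar>} x * ennreal (f x) \<partial>lborel) \<le> (\<integral>\<^sup>+x. ennreal (f x) \<partial>lborel)"
        by (intro nn_integral_mono) (auto simp: indicator_def)
      also have "\<dots> = ennreal 1" by (simp add: nn_integral_f)
      also have "\<dots> \<le> ennreal (K * R powr (1 - \<alpha>))"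
      proof (rule ennreal_leI)
        have "1 = R powr (\<alpha> - 1) * R powr (1 - \<alpha>)" using R by (simp add: powr_add[symmetric])
        also have "\<dots> \<le> M powr (\<alpha> - 1) * R powr (1 - \<alpha>)"
          using False R \<alpha> by (intro mult_right_mono powr_mono2) auto
        also have "\<dots> \<le> K * R powr (1 - \<alpha>)"
          using K2 \<alpha> by (intro mult_right_mono) (auto simp: K_def)
        finally show "1 \<le> K * R powr (1 - \<alpha>)" .
      qed
      finally show ?thesis .
    qed
    finally show ?thesis by (simp add: pw)
  qed
  ultimately show ?thesis by blast
qed

text \<open>
  The integral is restricted to \<open>|x| \<le> \<delta>\<close>, where the likelihood is close to \<open>\<phi> y\<close>. The choice
  \<open>\<delta> = s / n\<close> balances the two losses: at \<open>\<tau> = \<delta>\<^bsup>\<alpha>/(\<alpha>-1)\<^esup>\<close> the lost prior mass is \<open>O(\<delta>)\<close>, and so is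
  the mean of the exponent.
\<close>

lemma null_evidence_lower:
  "\<exists>K>0. \<forall>\<tau> \<delta> y. 0 < \<tau> \<longrightarrow> 0 < \<delta> \<longrightarrow>
     ennreal (\<phi> y * exp (- \<bar>y\<bar> * \<delta> - \<delta>\<^sup>2 / 2) * (1 - K * (\<tau> / \<delta>) powr (\<alpha> - 1))) \<le> evidence f \<tau> y"
proof -
  obtain K where K: "0 < K" "\<And>\<tau> \<delta>. 0 < \<tau> \<Longrightarrow> 0 < \<delta> \<Longrightarrow>
     (\<integral>\<^sup>+x. indicator {x. \<delta> < \<bar>x\<bar>} x * ennreal (scaled f \<tau> x) \<partial>lborel) \<le> ennreal (K * (\<tau> / \<delta>) powr (\<alpha> - 1))"
    using prior_tail_bound by blast
  have "ennreal (\<phi> y * exp (- \<bar>y\<bar> * \<delta> - \<delta>\<^sup>2 / 2) * (1 - K * (\<tau> / \<delta>) powr (\<alpha> - 1))) \<le> evidence f \<tau> y"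
    if "0 < \<tau>" "0 < \<delta>" for \<tau> \<delta> y
  proof -
    define k where "k = K * (\<tau> / \<delta>) powr (\<alpha> - 1)"
    define c where "c = \<phi> y * exp (- \<bar>y\<bar> * \<delta> - \<delta>\<^sup>2 / 2)"
    have c: "0 \<le> c" by (simp add: c_def)
    have k: "0 \<le> k" using K that by (simp add: k_def)
    define q where "q = (\<integral>\<^sup>+x. indicator {x. \<delta> < \<bar>x\<bar>} x * ennreal (scaled f \<tau> x) \<partial>lborel)"
    define p where "p = (\<integral>\<^sup>+x. indicator {x. \<bar>x\<bar> \<le> \<delta>} x * ennreal (scaled f \<tau> x) \<partial>lborel)"
    have "p + q = (\<integral>\<^sup>+x. ennreal (scaled f \<tau> x) \<partial>lborel)"
      unfolding p_def q_def
      by (subst nn_integral_add[symmetric]) (auto intro!: nn_integral_cong simp: indicator_def)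
    then have pq: "p + q = 1" using nn_integral_scaled_1[OF \<open>0 < \<tau>\<close>] by simp
    have q: "q \<le> ennreal k" unfolding q_def k_def using K that by blast
    have "1 \<le> p + ennreal k" unfolding pq[symmetric] using q by (simp add: add_left_mono)
    then have p: "ennreal (1 - k) \<le> p"
      using k by (simp add: ennreal_minus[symmetric] ennreal_minus_le_iff add.commute)
    have "ennreal (c * (1 - k)) = ennreal c * ennreal (1 - k)" using c by (simp add: ennreal_mult')
    also have "\<dots> \<le> ennreal c * p" using p by (intro mult_left_mono) auto
    also have "\<dots> = (\<integral>\<^sup>+x. ennreal c * (indicator {x. \<bar>x\<bar> \<le> \<delta>} x * ennreal (scaled f \<tau> x)) \<partial>lborel)"
      unfolding p_def by (rule nn_integral_cmult[symmetric]) measurable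
    also have "\<dots> \<le> evidence f \<tau> y"
      unfolding evidence_def
    proof (intro nn_integral_mono)
      fix x
      show "ennreal c * (indicator {x. \<bar>x\<bar> \<le> \<delta>} x * ennreal (scaled f \<tau> x)) \<le> ennreal (\<phi> (y - x) * scaled f \<tau> x)"
      proof (cases "\<bar>x\<bar> \<le> \<delta>")
        case True
        have "\<bar>y * x\<bar> \<le> \<bar>y\<bar> * \<delta>" using True by (simp add: abs_mult mult_left_mono)
        moreover have "x\<^sup>2 \<le> \<delta>\<^sup>2" using True by (simp add: abs_le_square_iff[symmetric])
        ultimately have "c \<le> \<phi> (y - x)" unfolding phi_shift c_def by (intro mult_left_mono) auto
        then show ?thesis using True scaled_nonneg[OF \<open>0 < \<tau>\<close>, of x] c
          by (simp add: ennreal_mult'[symmetric] ennreal_leI mult_right_mono)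
      qed (simp add: scaled_nonneg)
    qed
    finally show ?thesis by (simp add: c_def k_def)
  qed
  with K(1) show ?thesis by blast
qed

text \<open>
  The previous lemma for a fixed \<open>\<delta>\<close> so large that at most half of the prior mass is lost whenever
  \<open>\<tau> \<le> 1\<close>.
\<close>

lemma evidence_ge_phi:
  "\<exists>A>0. \<forall>\<tau> y. 0 < \<tau> \<longrightarrow> \<tau> \<le> 1 \<longrightarrow> ennreal (\<phi> y) \<le> ennreal (exp (A * (1 + \<bar>y\<bar>))) * evidence f \<tau> y"
proof -
  obtain K where K: "0 < K" "\<And>\<tau> \<delta> y. 0 < \<tau> \<Longrightarrow> 0 < \<delta> \<Longrightarrow>
     ennreal (\<phi> y * exp (- \<bar>y\<bar> * \<delta> - \<delta>\<^sup>2 / 2) * (1 - K * (\<tau> / \<delta>) powr (\<alpha> - 1))) \<le> evidence f \<tau> y"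
    using null_evidence_lower by blast
  define \<delta> where "\<delta> = (2 * K) powr (1 / (\<alpha> - 1))"
  have \<delta>: "0 < \<delta>" "\<delta> powr (\<alpha> - 1) = 2 * K" using K \<alpha> by (auto simp: \<delta>_def powr_powr)
  define A where "A = \<delta> + \<delta>\<^sup>2 / 2 + 1"
  have A: "0 < A" using \<delta> by (simp add: A_def add_pos_nonneg)
  have "ennreal (\<phi> y) \<le> ennreal (exp (A * (1 + \<bar>y\<bar>))) * evidence f \<tau> y" if t: "0 < \<tau>" "\<tau> \<le> 1" for \<tau> y
  proof -
    have "K * (\<tau> / \<delta>) powr (\<alpha> - 1) = \<tau> powr (\<alpha> - 1) / 2"
      using t \<delta> K by (simp add: powr_divide)
    also have "\<dots> \<le> 1 / 2" using t \<alpha> powr_mono2[of "\<alpha> - 1" \<tau> 1] by simp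
    finally have k: "1 / 2 \<le> 1 - K * (\<tau> / \<delta>) powr (\<alpha> - 1)" by simp
    have "exp (-1) \<le> (1 / 2 :: real)" using exp_ge_add_one_self[of 1] by (simp add: exp_minus divide_simps)
    then have k: "exp (-1) \<le> 1 - K * (\<tau> / \<delta>) powr (\<alpha> - 1)" using k by linarith
    have "exp (- A * (1 + \<bar>y\<bar>)) \<le> exp (- \<bar>y\<bar> * \<delta> - \<delta>\<^sup>2 / 2 + (-1))"
    proof (subst exp_le_cancel_iff)
      have "0 \<le> \<delta> + \<bar>y\<bar> * (\<delta>\<^sup>2 / 2) + \<bar>y\<bar>" using \<delta> by simp
      moreover have "A * (1 + \<bar>y\<bar>) = \<bar>y\<bar> * \<delta> + \<delta>\<^sup>2 / 2 + 1 + (\<delta> + \<bar>y\<bar> * (\<delta>\<^sup>2 / 2) + \<bar>y\<bar>)"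
        by (simp add: A_def algebra_simps)
      ultimately show "- A * (1 + \<bar>y\<bar>) \<le> - \<bar>y\<bar> * \<delta> - \<delta>\<^sup>2 / 2 + (-1)" by simp
    qed
    also have "\<dots> = exp (- \<bar>y\<bar> * \<delta> - \<delta>\<^sup>2 / 2) * exp (-1)" by (rule exp_add)
    also have "\<dots> \<le> exp (- \<bar>y\<bar> * \<delta> - \<delta>\<^sup>2 / 2) * (1 - K * (\<tau> / \<delta>) powr (\<alpha> - 1))"
      by (intro mult_left_mono k) auto
    finally have "\<phi> y * exp (- A * (1 + \<bar>y\<bar>)) \<le> \<phi> y * exp (- \<bar>y\<bar> * \<delta> - \<delta>\<^sup>2 / 2) * (1 - K * (\<tau> / \<delta>) powr (\<alpha> - 1))"
      by (simp add: mult.assoc)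
    then have "ennreal (\<phi> y * exp (- A * (1 + \<bar>y\<bar>))) \<le> evidence f \<tau> y"
      using K(2)[OF t(1) \<delta>(1), of y] by (meson ennreal_leI order_trans)
    then have "ennreal (exp (A * (1 + \<bar>y\<bar>))) * ennreal (\<phi> y * exp (- A * (1 + \<bar>y\<bar>)))
         \<le> ennreal (exp (A * (1 + \<bar>y\<bar>))) * evidence f \<tau> y" by (intro mult_left_mono) auto
    moreover have "exp (A * (1 + \<bar>y\<bar>)) * (\<phi> y * exp (- A * (1 + \<bar>y\<bar>))) = \<phi> y"
      by (simp add: exp_minus)
    ultimately show ?thesis by (simp only: ennreal_mult'[symmetric] exp_ge_zero)
  qed
  with A show ?thesis by blast
qed

text \<open>
  The integral is restricted to a unit interval close to \<open>t\<close> but further from the origin than \<open>t\<close> by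
  more than \<open>M\<close>, so that the lower tail bound applies even when \<open>t\<close> is near zero.
\<close>

lemma signal_evidence_lower:
  "\<exists>A>0. \<forall>\<tau> t e. 0 < \<tau> \<longrightarrow> \<tau> \<le> 1 \<longrightarrow>
     ennreal (\<phi> e * exp (- A * (1 + \<bar>e\<bar>)) * \<tau> powr (\<alpha> - 1) * (1 + \<bar>t\<bar>) powr - \<alpha>) \<le> evidence f \<tau> (t + e)"
proof -
  define c where "c = K\<^sub>1 * (M + 2) powr - \<alpha> * exp (- (M + 2)\<^sup>2 / 2)"
  have c: "0 < c" using K1 M by (simp add: c_def)
  define A where "A = M + 2 + \<bar>ln c\<bar>"
  have A: "0 < A" using M by (simp add: A_def)
  have "ennreal (\<phi> e * exp (- A * (1 + \<bar>e\<bar>)) * \<tau> powr (\<alpha> - 1) * (1 + \<bar>t\<bar>) powr - \<alpha>) \<le> evidence f \<tau> (t + e)"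
    if t: "0 < \<tau>" "\<tau> \<le> 1" for \<tau> t e
  proof -
    \<comment> \<open>The side away from the origin; the sign of \<open>t\<close> decides which.\<close>
    define I where "I = (if 0 \<le> t then {t + (M + 1) .. t + (M + 2)} else {t - (M + 2) .. t - (M + 1)})"
    have I: "emeasure lborel I = 1" "I \<in> sets lborel" by (auto simp: I_def)
    define v where "v = \<phi> e * exp (- A * (1 + \<bar>e\<bar>)) * \<tau> powr (\<alpha> - 1) * (1 + \<bar>t\<bar>) powr - \<alpha>"
    have "ennreal v = (\<integral>\<^sup>+x. ennreal v * indicator I x \<partial>lborel)"
      using I by (simp add: nn_integral_cmult)
    also have "\<dots> \<le> evidence f \<tau> (t + e)"
      unfolding evidence_def
    proof (intro nn_integral_mono)
      fix x
      show "ennreal v * indicator I x \<le> ennreal (\<phi> (t + e - x) * scaled f \<tau> x)"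
      proof (cases "x \<in> I")
        case True
        define d where "d = x - t"
        have d: "\<bar>d\<bar> \<le> M + 2" "\<bar>x\<bar> = \<bar>t\<bar> + \<bar>d\<bar>" "M + 1 \<le> \<bar>d\<bar>"
          using True M by (auto simp: I_def d_def split: if_splits)
        have "\<bar>t\<bar> + (M + 2) \<le> (M + 2) * (1 + \<bar>t\<bar>)" using M by (simp add: algebra_simps)
        then have x: "M < \<bar>x\<bar>" "\<bar>x\<bar> \<le> (M + 2) * (1 + \<bar>t\<bar>)" using d by auto
        have "K\<^sub>1 * \<tau> powr (\<alpha> - 1) * ((M + 2) * (1 + \<bar>t\<bar>)) powr - \<alpha> \<le> K\<^sub>1 * \<tau> powr (\<alpha> - 1) * \<bar>x\<bar> powr - \<alpha>"
          using x M K1 \<alpha> t by (intro mult_left_mono powr_mono2') auto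
        also have "\<dots> \<le> scaled f \<tau> x" by (rule scaled_tail(1)[OF t x(1)])
        finally have 1: "K\<^sub>1 * \<tau> powr (\<alpha> - 1) * ((M + 2) powr - \<alpha> * (1 + \<bar>t\<bar>) powr - \<alpha>) \<le> scaled f \<tau> x"
          using M by (subst powr_mult[symmetric]) auto
        have "\<bar>e * d\<bar> \<le> \<bar>e\<bar> * (M + 2)" using d by (simp add: abs_mult mult_left_mono)
        have "d\<^sup>2 \<le> (M + 2)\<^sup>2" using d M by (simp add: abs_le_square_iff[symmetric])
        have "\<phi> e * exp (- (M + 2) * \<bar>e\<bar> - (M + 2)\<^sup>2 / 2) \<le> \<phi> (e - d)"
          unfolding phi_shift
        proof (intro mult_left_mono)
          have "- (M + 2) * \<bar>e\<bar> = - (\<bar>e\<bar> * (M + 2))" by (simp add: algebra_simps)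
          then show "exp (- (M + 2) * \<bar>e\<bar> - (M + 2)\<^sup>2 / 2) \<le> exp (e * d - d\<^sup>2 / 2)"
            using \<open>\<bar>e * d\<bar> \<le> \<bar>e\<bar> * (M + 2)\<close> \<open>d\<^sup>2 \<le> (M + 2)\<^sup>2\<close> unfolding exp_le_cancel_iff by linarith
        qed simp
        then have 2: "\<phi> e * (exp (- (M + 2) * \<bar>e\<bar>) * exp (- (M + 2)\<^sup>2 / 2)) \<le> \<phi> (t + e - x)"
          unfolding exp_add[symmetric] d_def by (simp add: diff_diff_eq2 add.commute)
        have "exp (- A * (1 + \<bar>e\<bar>)) \<le> exp (ln c + - (M + 2) * \<bar>e\<bar>)"
        proof (subst exp_le_cancel_iff)
          have "(M + 2) * \<bar>e\<bar> \<le> A * \<bar>e\<bar>" by (intro mult_right_mono) (auto simp: A_def)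
          moreover have "- A \<le> ln c" using M by (auto simp: A_def)
          ultimately show "- A * (1 + \<bar>e\<bar>) \<le> ln c + - (M + 2) * \<bar>e\<bar>" by (simp add: algebra_simps)
        qed
        also have "\<dots> = c * exp (- (M + 2) * \<bar>e\<bar>)" using c by (simp only: exp_add exp_ln)
        finally have "v \<le> \<phi> e * (c * exp (- (M + 2) * \<bar>e\<bar>)) * \<tau> powr (\<alpha> - 1) * (1 + \<bar>t\<bar>) powr - \<alpha>"
          unfolding v_def by (intro mult_right_mono mult_left_mono) auto
        also have "\<dots> = (\<phi> e * (exp (- (M + 2) * \<bar>e\<bar>) * exp (- (M + 2)\<^sup>2 / 2)))
             * (K\<^sub>1 * \<tau> powr (\<alpha> - 1) * ((M + 2) powr - \<alpha> * (1 + \<bar>t\<bar>) powr - \<alpha>))"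
          by (simp add: c_def)
        also have "\<dots> \<le> \<phi> (t + e - x) * scaled f \<tau> x"
          using 1 2 K1 by (intro mult_mono) auto
        finally show ?thesis using True by (simp add: ennreal_leI)
      qed simp
    qed
    finally show ?thesis by (simp add: v_def)
  qed
  with A show ?thesis by blast
qed

text \<open>
  A power law smoothed by a Gaussian keeps its order of decay: for \<open>|x| \<le> |t| / 2\<close> the Gaussian
  factor is at most \<open>exp (- \<kappa> t\<^sup>2 / 4)\<close>, smaller than any negative power of \<open>|t|\<close>, and for \<open>|x| > |t| / 2\<close> the
  prior density is at most of order \<open>|t|\<^bsup>-\<alpha>\<^esup>\<close> and the Gaussian is integrated.
\<close>

lemma gaussian_smoothed_prior_upper:
  assumes \<kappa>: "0 < \<kappa>"
  shows "\<exists>C>0. \<forall>\<tau> t. 0 < \<tau> \<longrightarrow> \<tau> \<le> 1 \<longrightarrow>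
     (\<integral>\<^sup>+x. ennreal (exp (- \<kappa> * (x - t)\<^sup>2)) * ennreal (scaled f \<tau> x) \<partial>lborel) \<le> ennreal (C * (1 + \<bar>t\<bar>) powr - \<alpha>)"
proof -
  define C\<^sub>1 where "C\<^sub>1 = (1 + 2 * M) powr \<alpha>"
  define C\<^sub>2 where "C\<^sub>2 = exp (\<alpha>\<^sup>2 / (4 * (\<kappa> / 4)))"
  define C\<^sub>3 where "C\<^sub>3 = K\<^sub>2 * (2 * (1 + 1 / (2 * M))) powr \<alpha> * sqrt (pi / \<kappa>)"
  define C where "C = C\<^sub>1 + C\<^sub>2 + C\<^sub>3"
  have "2 + 1 / M \<noteq> 0" using M by (simp add: add_pos_pos less_imp_neq[symmetric])
  then have pos: "0 < C\<^sub>1" "0 < C\<^sub>2" "0 < C\<^sub>3" using M K2 \<kappa> by (auto simp: C\<^sub>1_def C\<^sub>2_def C\<^sub>3_def)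
  have "(\<integral>\<^sup>+x. ennreal (exp (- \<kappa> * (x - t)\<^sup>2)) * ennreal (scaled f \<tau> x) \<partial>lborel) \<le> ennreal (C * (1 + \<bar>t\<bar>) powr - \<alpha>)"
    if tau: "0 < \<tau>" "\<tau> \<le> 1" for \<tau> t
  proof (cases "\<bar>t\<bar> \<le> 2 * M")
    case True
    have "(\<integral>\<^sup>+x. ennreal (exp (- \<kappa> * (x - t)\<^sup>2)) * ennreal (scaled f \<tau> x) \<partial>lborel)
       \<le> (\<integral>\<^sup>+x. 1 * ennreal (scaled f \<tau> x) \<partial>lborel)"
      using \<kappa> by (intro nn_integral_mono mult_right_mono) auto
    also have "\<dots> = ennreal 1" using nn_integral_scaled_1[OF tau(1)] by simp
    also have "\<dots> \<le> ennreal (C * (1 + \<bar>t\<bar>) powr - \<alpha>)"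
    proof (rule ennreal_leI)
      have "1 = (1 + \<bar>t\<bar>) powr \<alpha> * (1 + \<bar>t\<bar>) powr - \<alpha>" by (simp add: powr_add[symmetric])
      also have "\<dots> \<le> C\<^sub>1 * (1 + \<bar>t\<bar>) powr - \<alpha>"
        unfolding C\<^sub>1_def using True \<alpha> by (intro mult_right_mono powr_mono2) auto
      also have "\<dots> \<le> C * (1 + \<bar>t\<bar>) powr - \<alpha>"
        unfolding C_def using pos by (intro mult_right_mono) auto
      finally show "1 \<le> C * (1 + \<bar>t\<bar>) powr - \<alpha>" .
    qed
    finally show ?thesis .
  next
    case False
    define c1 where "c1 = exp (- (\<kappa> / 4) * \<bar>t\<bar>\<^sup>2)"
    define c2 where "c2 = K\<^sub>2 * (\<bar>t\<bar> / 2) powr - \<alpha>"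
    have c: "0 \<le> c1" "0 \<le> c2" using K2 by (auto simp: c1_def c2_def)
    have "(\<integral>\<^sup>+x. ennreal (exp (- \<kappa> * (x - t)\<^sup>2)) * ennreal (scaled f \<tau> x) \<partial>lborel)
       \<le> (\<integral>\<^sup>+x. ennreal c1 * ennreal (scaled f \<tau> x) + ennreal c2 * ennreal (exp (- \<kappa> * (x - t)\<^sup>2)) \<partial>lborel)"
    proof (intro nn_integral_mono)
      fix x
      have sc: "0 \<le> scaled f \<tau> x" using tau by (simp add: scaled_nonneg)
      have "exp (- \<kappa> * (x - t)\<^sup>2) * scaled f \<tau> x \<le> c1 * scaled f \<tau> x + c2 * exp (- \<kappa> * (x - t)\<^sup>2)"
      proof (cases "\<bar>x\<bar> \<le> \<bar>t\<bar> / 2")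
        case True
        then have "\<bar>t\<bar> / 2 \<le> \<bar>x - t\<bar>" by linarith
        then have "(\<bar>t\<bar> / 2)\<^sup>2 \<le> (x - t)\<^sup>2" using abs_le_square_iff[of "\<bar>t\<bar> / 2" "x - t"] by simp
        then have "\<kappa> * (\<bar>t\<bar> / 2)\<^sup>2 \<le> \<kappa> * (x - t)\<^sup>2" using \<kappa> by simp
        then have "exp (- \<kappa> * (x - t)\<^sup>2) \<le> c1" unfolding c1_def by (simp add: power_divide)
        then have "exp (- \<kappa> * (x - t)\<^sup>2) * scaled f \<tau> x \<le> c1 * scaled f \<tau> x"
          using sc by (rule mult_right_mono)
        then show ?thesis using c by (simp add: add_increasing2)
      next
        case F: False
        have x: "M < \<bar>x\<bar>" using False F by linarith
        have "scaled f \<tau> x \<le> K\<^sub>2 * \<tau> powr (\<alpha> - 1) * \<bar>x\<bar> powr - \<alpha>" by (rule scaled_tail(2)[OF tau x])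
        also have "\<dots> \<le> K\<^sub>2 * 1 * (\<bar>t\<bar> / 2) powr - \<alpha>"
          using K2 tau \<alpha> F False M powr_mono2[of "\<alpha> - 1" \<tau> 1]
          by (intro mult_mono powr_mono2') auto
        finally have "scaled f \<tau> x \<le> c2" by (simp add: c2_def)
        then have "exp (- \<kappa> * (x - t)\<^sup>2) * scaled f \<tau> x \<le> c2 * exp (- \<kappa> * (x - t)\<^sup>2)"
          by (simp add: mult.commute mult_right_mono)
        then show ?thesis using c sc by (simp add: add_increasing)
      qed
      then show "ennreal (exp (- \<kappa> * (x - t)\<^sup>2)) * ennreal (scaled f \<tau> x)
         \<le> ennreal c1 * ennreal (scaled f \<tau> x) + ennreal c2 * ennreal (exp (- \<kappa> * (x - t)\<^sup>2))"
        using c sc by (simp add: ennreal_mult'[symmetric] ennreal_plus[symmetric] ennreal_leI del: ennreal_plus)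
    qed
    also have "\<dots> = (\<integral>\<^sup>+x. ennreal c1 * ennreal (scaled f \<tau> x) \<partial>lborel)
        + (\<integral>\<^sup>+x. ennreal c2 * ennreal (exp (- \<kappa> * (x - t)\<^sup>2)) \<partial>lborel)"
      by (rule nn_integral_add) measurable
    also have "(\<integral>\<^sup>+x. ennreal c1 * ennreal (scaled f \<tau> x) \<partial>lborel) = ennreal c1"
      by (subst nn_integral_cmult, measurable) (simp add: nn_integral_scaled_1 tau)
    also have "(\<integral>\<^sup>+x. ennreal c2 * ennreal (exp (- \<kappa> * (x - t)\<^sup>2)) \<partial>lborel) = ennreal (c2 * sqrt (pi / \<kappa>))"
      by (subst nn_integral_cmult, measurable) (simp only: nn_integral_gaussian[OF \<kappa>] ennreal_mult'[OF c(2)])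
    also have "ennreal c1 + ennreal (c2 * sqrt (pi / \<kappa>)) = ennreal (c1 + c2 * sqrt (pi / \<kappa>))"
      using c \<kappa> by simp
    also have "\<dots> \<le> ennreal (C * (1 + \<bar>t\<bar>) powr - \<alpha>)"
    proof (rule ennreal_leI)
      have e: "(1 + \<bar>t\<bar>) powr \<alpha> * (1 + \<bar>t\<bar>) powr - \<alpha> = 1" by (simp add: powr_add[symmetric])
      have "(1 + \<bar>t\<bar>) powr \<alpha> * c1 \<le> C\<^sub>2"
        unfolding c1_def C\<^sub>2_def using \<kappa> \<alpha> by (intro one_plus_powr_gaussian_bound) auto
      moreover have "(1 + \<bar>t\<bar>) powr \<alpha> * (c2 * sqrt (pi / \<kappa>)) \<le> C\<^sub>3"
      proof -
        have "1 + \<bar>t\<bar> \<le> (2 * (1 + 1 / (2 * M))) * (\<bar>t\<bar> / 2)"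
          using False M by (simp add: field_simps)
        then have "(1 + \<bar>t\<bar>) powr \<alpha> \<le> ((2 * (1 + 1 / (2 * M))) * (\<bar>t\<bar> / 2)) powr \<alpha>"
          using \<alpha> by (intro powr_mono2) auto
        also have "\<dots> = (2 * (1 + 1 / (2 * M))) powr \<alpha> * (\<bar>t\<bar> / 2) powr \<alpha>"
          by (rule powr_mult)
        finally have "(1 + \<bar>t\<bar>) powr \<alpha> * (c2 * sqrt (pi / \<kappa>))
            \<le> ((2 * (1 + 1 / (2 * M))) powr \<alpha> * (\<bar>t\<bar> / 2) powr \<alpha>) * (c2 * sqrt (pi / \<kappa>))"
          using c \<kappa> by (intro mult_right_mono) auto
        also have "\<dots> = C\<^sub>3 * ((\<bar>t\<bar> / 2) powr \<alpha> * (\<bar>t\<bar> / 2) powr - \<alpha>)"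
          by (simp only: C\<^sub>3_def c2_def mult_ac)
        also have "(\<bar>t\<bar> / 2) powr \<alpha> * (\<bar>t\<bar> / 2) powr - \<alpha> = 1"
          using False M by (simp add: powr_add[symmetric])
        finally show ?thesis by simp
      qed
      ultimately have "(1 + \<bar>t\<bar>) powr \<alpha> * (c1 + c2 * sqrt (pi / \<kappa>)) \<le> C"
        unfolding C_def distrib_left using pos by linarith
      then have "(1 + \<bar>t\<bar>) powr \<alpha> * (c1 + c2 * sqrt (pi / \<kappa>)) * (1 + \<bar>t\<bar>) powr - \<alpha> \<le> C * (1 + \<bar>t\<bar>) powr - \<alpha>"
        by (rule mult_right_mono) simp
      moreover have "(1 + \<bar>t\<bar>) powr \<alpha> * (c1 + c2 * sqrt (pi / \<kappa>)) * (1 + \<bar>t\<bar>) powr - \<alpha> = c1 + c2 * sqrt (pi / \<kappa>)"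
        using e by (metis mult.assoc mult.commute mult.right_neutral)
      ultimately show "c1 + c2 * sqrt (pi / \<kappa>) \<le> C * (1 + \<bar>t\<bar>) powr - \<alpha>" by simp
    qed
    finally show ?thesis .
  qed
  moreover have "0 < C" using pos by (simp add: C_def)
  ultimately show ?thesis by blast
qed

text \<open>
  Since \<open>\<rho> < 1\<close>, completing the square in \<open>\<rho> / 2 * d\<^sup>2 - (e - d)\<^sup>2 / 2\<close>, \<open>d = x - t\<close>, leaves a Gaussian factor
  in \<open>d\<close> at the price of a factor exponential in \<open>e\<^sup>2\<close>. The bound carries the same factor
  \<open>(1 + |t|)\<^bsup>-\<alpha>\<^esup>\<close> as \<open>signal_evidence_lower\<close>, but no positive power of \<open>\<tau>\<close>: for \<open>t\<close> near zero the prior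
  mass at the origin counts.
\<close>

lemma signal_moment_upper:
  assumes "0 < \<rho>" "\<rho> < 1"
  shows "\<exists>A>0. \<forall>\<tau> t e. 0 < \<tau> \<longrightarrow> \<tau> \<le> 1 \<longrightarrow>
     (\<integral>\<^sup>+x. ennreal (exp (\<rho> / 2 * (x - t)\<^sup>2)) * ennreal (\<phi> (t + e - x) * scaled f \<tau> x) \<partial>lborel)
       \<le> ennreal (\<phi> e * exp (A * (1 + e\<^sup>2)) * (1 + \<bar>t\<bar>) powr - \<alpha>)"
proof -
  define \<kappa> where "\<kappa> = (1 - \<rho>) / 4"
  have \<kappa>: "0 < \<kappa>" using assms by (simp add: \<kappa>_def)
  obtain C where C: "0 < C" "\<And>\<tau> t. 0 < \<tau> \<Longrightarrow> \<tau> \<le> 1 \<Longrightarrow>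
     (\<integral>\<^sup>+x. ennreal (exp (- \<kappa> * (x - t)\<^sup>2)) * ennreal (scaled f \<tau> x) \<partial>lborel) \<le> ennreal (C * (1 + \<bar>t\<bar>) powr - \<alpha>)"
    using gaussian_smoothed_prior_upper[OF \<kappa>] by blast
  define A where "A = 1 / (4 * \<kappa>) + \<bar>ln C\<bar>"
  have A: "0 < A" using \<kappa> by (simp add: A_def add_pos_nonneg)
  have "(\<integral>\<^sup>+x. ennreal (exp (\<rho> / 2 * (x - t)\<^sup>2)) * ennreal (\<phi> (t + e - x) * scaled f \<tau> x) \<partial>lborel)
       \<le> ennreal (\<phi> e * exp (A * (1 + e\<^sup>2)) * (1 + \<bar>t\<bar>) powr - \<alpha>)" if tau: "0 < \<tau>" "\<tau> \<le> 1" for \<tau> t e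
  proof -
    define c where "c = \<phi> e * exp (e\<^sup>2 / (4 * \<kappa>))"
    have c: "0 \<le> c" by (simp add: c_def)
    have "(\<integral>\<^sup>+x. ennreal (exp (\<rho> / 2 * (x - t)\<^sup>2)) * ennreal (\<phi> (t + e - x) * scaled f \<tau> x) \<partial>lborel)
        \<le> (\<integral>\<^sup>+x. ennreal c * (ennreal (exp (- \<kappa> * (x - t)\<^sup>2)) * ennreal (scaled f \<tau> x)) \<partial>lborel)"
    proof (intro nn_integral_mono)
      fix x
      define d where "d = x - t"
      have sc: "0 \<le> scaled f \<tau> x" using tau by (simp add: scaled_nonneg)
      have "\<phi> (t + e - x) = \<phi> (e - d)" by (simp add: d_def algebra_simps)
      then have "exp (\<rho> / 2 * d\<^sup>2) * \<phi> (t + e - x) = \<phi> e * exp (\<rho> / 2 * d\<^sup>2 + (e * d - d\<^sup>2 / 2))"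
        unfolding exp_add by (simp add: phi_shift)
      also have "\<dots> \<le> \<phi> e * exp (e\<^sup>2 / (4 * \<kappa>) + - \<kappa> * d\<^sup>2)"
      proof (intro mult_left_mono, subst exp_le_cancel_iff)
        have "\<rho> / 2 * d\<^sup>2 - d\<^sup>2 / 2 = - 2 * \<kappa> * d\<^sup>2"
          by (simp add: \<kappa>_def left_diff_distrib diff_divide_distrib)
        then show "\<rho> / 2 * d\<^sup>2 + (e * d - d\<^sup>2 / 2) \<le> e\<^sup>2 / (4 * \<kappa>) + - \<kappa> * d\<^sup>2"
          using mult_le_square_add[OF \<kappa>, of e d] by linarith
      qed simp
      also have "\<dots> = c * exp (- \<kappa> * d\<^sup>2)" by (simp only: c_def exp_add mult_ac)
      finally have "exp (\<rho> / 2 * d\<^sup>2) * \<phi> (t + e - x) * scaled f \<tau> x \<le> c * exp (- \<kappa> * d\<^sup>2) * scaled f \<tau> x"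
        using sc by (rule mult_right_mono)
      then show "ennreal (exp (\<rho> / 2 * (x - t)\<^sup>2)) * ennreal (\<phi> (t + e - x) * scaled f \<tau> x)
         \<le> ennreal c * (ennreal (exp (- \<kappa> * (x - t)\<^sup>2)) * ennreal (scaled f \<tau> x))"
        using c sc by (simp only: ennreal_mult'[symmetric] exp_ge_zero d_def mult.assoc ennreal_leI)
    qed
    also have "\<dots> = ennreal c * (\<integral>\<^sup>+x. ennreal (exp (- \<kappa> * (x - t)\<^sup>2)) * ennreal (scaled f \<tau> x) \<partial>lborel)"
      by (rule nn_integral_cmult) measurable
    also have "\<dots> \<le> ennreal c * ennreal (C * (1 + \<bar>t\<bar>) powr - \<alpha>)"
      by (intro mult_left_mono C tau) auto
    also have "\<dots> = ennreal (c * C * (1 + \<bar>t\<bar>) powr - \<alpha>)"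
      using c by (simp only: ennreal_mult'[symmetric] mult.assoc)
    also have "\<dots> \<le> ennreal (\<phi> e * exp (A * (1 + e\<^sup>2)) * (1 + \<bar>t\<bar>) powr - \<alpha>)"
    proof (intro ennreal_leI mult_right_mono)
      have "c * C = \<phi> e * exp (e\<^sup>2 / (4 * \<kappa>) + ln C)" using C(1) by (simp only: c_def exp_add exp_ln mult.assoc)
      also have "\<dots> \<le> \<phi> e * exp (A * (1 + e\<^sup>2))"
      proof (intro mult_left_mono, subst exp_le_cancel_iff)
        have "A * (1 + e\<^sup>2) = e\<^sup>2 / (4 * \<kappa>) + \<bar>ln C\<bar> + 1 / (4 * \<kappa>) + \<bar>ln C\<bar> * e\<^sup>2"
          by (simp add: A_def distrib_left distrib_right add_divide_distrib)
        moreover have "0 \<le> 1 / (4 * \<kappa>)" "0 \<le> \<bar>ln C\<bar> * e\<^sup>2" using \<kappa> by auto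
        ultimately show "e\<^sup>2 / (4 * \<kappa>) + ln C \<le> A * (1 + e\<^sup>2)" by linarith
      qed simp
      finally show "c * C \<le> \<phi> e * exp (A * (1 + e\<^sup>2))" .
    qed simp
    finally show ?thesis .
  qed
  with A show ?thesis by blast
qed

lemma prior_abs_moment_finite:
  assumes "0 < b" "b < \<alpha> - 1"
  shows "\<exists>E>0. (\<integral>\<^sup>+x. ennreal (\<bar>x\<bar> powr b) * ennreal (f x) \<partial>lborel) \<le> ennreal E"
proof -
  define E where "E = M powr b + K\<^sub>2 * (2 * M powr (1 - (\<alpha> - b)) / (\<alpha> - b - 1))"
  have "(\<integral>\<^sup>+x. ennreal (\<bar>x\<bar> powr b) * ennreal (f x) \<partial>lborel)
     \<le> (\<integral>\<^sup>+x. ennreal (M powr b) * ennreal (f x)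
            + ennreal K\<^sub>2 * (ennreal (\<bar>x\<bar> powr - (\<alpha> - b)) * indicator {x. M < \<bar>x\<bar>} x) \<partial>lborel)"
  proof (intro nn_integral_mono)
    fix x
    show "ennreal (\<bar>x\<bar> powr b) * ennreal (f x) \<le> ennreal (M powr b) * ennreal (f x)
            + ennreal K\<^sub>2 * (ennreal (\<bar>x\<bar> powr - (\<alpha> - b)) * indicator {x. M < \<bar>x\<bar>} x)"
    proof (cases "M < \<bar>x\<bar>")
      case True
      have "\<bar>x\<bar> powr b * f x \<le> \<bar>x\<bar> powr b * (K\<^sub>2 * \<bar>x\<bar> powr - \<alpha>)"
        by (intro mult_left_mono tail_upper True) auto
      also have "\<dots> = K\<^sub>2 * \<bar>x\<bar> powr - (\<alpha> - b)"
        by (simp add: powr_add[symmetric])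
      finally have "ennreal (\<bar>x\<bar> powr b) * ennreal (f x) \<le> ennreal K\<^sub>2 * ennreal (\<bar>x\<bar> powr - (\<alpha> - b))"
        using K2 by (simp add: ennreal_mult'[symmetric] ennreal_leI)
      then show ?thesis using True by (simp add: add_increasing)
    next
      case False
      then have "\<bar>x\<bar> powr b \<le> M powr b" using assms by (intro powr_mono2) auto
      then show ?thesis using False by (simp add: mult_right_mono ennreal_leI)
    qed
  qed
  also have "\<dots> = (\<integral>\<^sup>+x. ennreal (M powr b) * ennreal (f x) \<partial>lborel)
            + (\<integral>\<^sup>+x. ennreal K\<^sub>2 * (ennreal (\<bar>x\<bar> powr - (\<alpha> - b)) * indicator {x. M < \<bar>x\<bar>} x) \<partial>lborel)"
    by (rule nn_integral_add) measurable
  also have "(\<integral>\<^sup>+x. ennreal (M powr b) * ennreal (f x) \<partial>lborel) = ennreal (M powr b)"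
    by (subst nn_integral_cmult, measurable) (simp add: nn_integral_f)
  also have "(\<integral>\<^sup>+x. ennreal K\<^sub>2 * (ennreal (\<bar>x\<bar> powr - (\<alpha> - b)) * indicator {x. M < \<bar>x\<bar>} x) \<partial>lborel)
     = ennreal K\<^sub>2 * (\<integral>\<^sup>+x. ennreal (\<bar>x\<bar> powr - (\<alpha> - b)) * indicator {x. M < \<bar>x\<bar>} x \<partial>lborel)"
    by (rule nn_integral_cmult) measurable
  also have "ennreal (M powr b) + \<dots> \<le> ennreal (M powr b) + ennreal K\<^sub>2 * ennreal (2 * M powr (1 - (\<alpha> - b)) / (\<alpha> - b - 1))"
    using assms by (intro add_left_mono mult_left_mono nn_integral_powr_tail M) auto
  also have "\<dots> = ennreal E"
    using K2 assms by (simp add: E_def ennreal_mult'[symmetric] ennreal_plus[symmetric] del: ennreal_plus)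
  finally have "(\<integral>\<^sup>+x. ennreal (\<bar>x\<bar> powr b) * ennreal (f x) \<partial>lborel) \<le> ennreal E" .
  moreover have "0 < E" unfolding E_def using M K2 assms by (intro add_pos_nonneg) auto
  ultimately show ?thesis by blast
qed

text \<open>
  For \<open>|x| > 4 |y|\<close> the likelihood ratio is at most \<open>exp (- x\<^sup>2 / 4)\<close>, which beats \<open>x\<^sup>2 + |x|\<close>; otherwise \<open>x\<close> is
  controlled by \<open>y\<close>. This bound does not decay with \<open>\<tau>\<close>.
\<close>

lemma null_moment_le_evidence:
  "\<exists>A C. 0 < A \<and> 0 < C \<and> (\<forall>\<tau> y. 0 < \<tau> \<longrightarrow> \<tau> \<le> 1 \<longrightarrow>
     null_moment f \<tau> y
       \<le> ennreal (C * exp (A * \<bar>y\<bar>)) * evidence f \<tau> y)"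
proof -
  obtain A where A: "0 < A" "\<And>\<tau> y. 0 < \<tau> \<Longrightarrow> \<tau> \<le> 1 \<Longrightarrow>
      ennreal (\<phi> y) \<le> ennreal (exp (A * (1 + \<bar>y\<bar>))) * evidence f \<tau> y"
    using evidence_ge_phi by blast
  define C where "C = 36 + 9 * exp A"
  have "null_moment f \<tau> y
       \<le> ennreal (C * exp ((A + 1) * \<bar>y\<bar>)) * evidence f \<tau> y" if tau: "0 < \<tau>" "\<tau> \<le> 1" for \<tau> y
  proof -
    have "null_moment f \<tau> y
       \<le> (\<integral>\<^sup>+x. ennreal (16 * y\<^sup>2 + 4 * \<bar>y\<bar>) * ennreal (\<phi> (y - x) * scaled f \<tau> x)
            + ennreal (9 * \<phi> y) * ennreal (scaled f \<tau> x) \<partial>lborel)"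
    proof (intro nn_integral_mono)
      fix x
      have sc: "0 \<le> scaled f \<tau> x" using tau by (simp add: scaled_nonneg)
      have "(x\<^sup>2 + \<bar>x\<bar>) * \<phi> (y - x) \<le> (16 * y\<^sup>2 + 4 * \<bar>y\<bar>) * \<phi> (y - x) + 9 * \<phi> y"
      proof (cases "\<bar>x\<bar> \<le> 4 * \<bar>y\<bar>")
        case True
        then have "x\<^sup>2 \<le> (4 * y)\<^sup>2" by (subst abs_le_square_iff[symmetric]) (simp add: abs_mult)
        then have "x\<^sup>2 + \<bar>x\<bar> \<le> 16 * y\<^sup>2 + 4 * \<bar>y\<bar>" using True by (simp add: power_mult_distrib)
        then have "(x\<^sup>2 + \<bar>x\<bar>) * \<phi> (y - x) \<le> (16 * y\<^sup>2 + 4 * \<bar>y\<bar>) * \<phi> (y - x)" by (rule mult_right_mono) simp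
        then show ?thesis by (rule add_increasing2[rotated]) simp
      next
        case False
        have "y * x \<le> \<bar>y\<bar> * \<bar>x\<bar>" by (metis abs_ge_self abs_mult)
        also have "\<dots> \<le> \<bar>x\<bar> / 4 * \<bar>x\<bar>" using False by (intro mult_right_mono) auto
        also have "\<dots> = x\<^sup>2 / 4" by (simp add: power2_eq_square)
        finally have "y * x - x\<^sup>2 / 2 \<le> - (1/4) * x\<^sup>2" by simp
        then have ph: "\<phi> (y - x) \<le> \<phi> y * exp (- (1/4) * x\<^sup>2)" unfolding phi_shift by (intro mult_left_mono) auto
        have "\<bar>x\<bar> \<le> 1 + x\<^sup>2"
        proof (cases "\<bar>x\<bar> \<le> 1")
          case F: False
          then have "\<bar>x\<bar> * 1 \<le> \<bar>x\<bar> * \<bar>x\<bar>" by (intro mult_left_mono) auto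
          then show ?thesis by (simp add: power2_eq_square)
        qed (simp add: add_increasing2)
        then have "(x\<^sup>2 + \<bar>x\<bar>) * exp (- (1/4) * x\<^sup>2) \<le> (1 + 2 * x\<^sup>2) * exp (- (1/4) * x\<^sup>2)"
          by (intro mult_right_mono) auto
        also have "\<dots> = exp (- (1/4) * x\<^sup>2) + 2 * (x\<^sup>2 * exp (- (1/4) * x\<^sup>2))" by (simp add: algebra_simps)
        also have "\<dots> \<le> 1 + 2 * (1 / (1/4))"
          by (intro add_mono mult_left_mono square_mult_exp_le) auto
        finally have h: "(x\<^sup>2 + \<bar>x\<bar>) * exp (- (1/4) * x\<^sup>2) \<le> 9" by simp
        have "(x\<^sup>2 + \<bar>x\<bar>) * \<phi> (y - x) \<le> (x\<^sup>2 + \<bar>x\<bar>) * (\<phi> y * exp (- (1/4) * x\<^sup>2))"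
          by (intro mult_left_mono ph) auto
        also have "\<dots> = ((x\<^sup>2 + \<bar>x\<bar>) * exp (- (1/4) * x\<^sup>2)) * \<phi> y" by (simp only: mult_ac)
        also have "\<dots> \<le> 9 * \<phi> y" by (intro mult_right_mono h) simp
        finally show ?thesis by (rule add_increasing[rotated]) simp
      qed
      then have "(x\<^sup>2 + \<bar>x\<bar>) * \<phi> (y - x) * scaled f \<tau> x \<le> ((16 * y\<^sup>2 + 4 * \<bar>y\<bar>) * \<phi> (y - x) + 9 * \<phi> y) * scaled f \<tau> x"
        using sc by (rule mult_right_mono)
      then have le: "(x\<^sup>2 + \<bar>x\<bar>) * (\<phi> (y - x) * scaled f \<tau> x)
          \<le> (16 * y\<^sup>2 + 4 * \<bar>y\<bar>) * (\<phi> (y - x) * scaled f \<tau> x) + 9 * \<phi> y * scaled f \<tau> x"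
        by (simp only: distrib_right mult.assoc)
      show "ennreal (x\<^sup>2 + \<bar>x\<bar>) * ennreal (\<phi> (y - x) * scaled f \<tau> x)
        \<le> ennreal (16 * y\<^sup>2 + 4 * \<bar>y\<bar>) * ennreal (\<phi> (y - x) * scaled f \<tau> x)
            + ennreal (9 * \<phi> y) * ennreal (scaled f \<tau> x)"
        using ennreal_leI[OF le] sc by (simp add: ennreal_mult' ennreal_mult'' mult.assoc)
    qed
    also have "\<dots> = (\<integral>\<^sup>+x. ennreal (16 * y\<^sup>2 + 4 * \<bar>y\<bar>) * ennreal (\<phi> (y - x) * scaled f \<tau> x) \<partial>lborel)
            + (\<integral>\<^sup>+x. ennreal (9 * \<phi> y) * ennreal (scaled f \<tau> x) \<partial>lborel)"
      by (rule nn_integral_add) measurable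
    also have "(\<integral>\<^sup>+x. ennreal (16 * y\<^sup>2 + 4 * \<bar>y\<bar>) * ennreal (\<phi> (y - x) * scaled f \<tau> x) \<partial>lborel)
         = ennreal (16 * y\<^sup>2 + 4 * \<bar>y\<bar>) * evidence f \<tau> y"
      unfolding evidence_def by (rule nn_integral_cmult) measurable
    also have "(\<integral>\<^sup>+x. ennreal (9 * \<phi> y) * ennreal (scaled f \<tau> x) \<partial>lborel) = ennreal (9 * \<phi> y)"
      by (subst nn_integral_cmult, measurable) (simp add: nn_integral_scaled_1 tau)
    also have "ennreal (9 * \<phi> y) = ennreal 9 * ennreal (\<phi> y)" by (rule ennreal_mult) auto
    also have "ennreal (16 * y\<^sup>2 + 4 * \<bar>y\<bar>) * evidence f \<tau> y + ennreal 9 * ennreal (\<phi> y)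
       \<le> ennreal (36 * exp \<bar>y\<bar>) * evidence f \<tau> y + ennreal 9 * (ennreal (exp (A * (1 + \<bar>y\<bar>))) * evidence f \<tau> y)"
    proof (intro add_mono mult_right_mono mult_left_mono ennreal_leI A tau)
      have "\<bar>y\<bar> \<le> exp \<bar>y\<bar>" using exp_ge_add_one_self[of "\<bar>y\<bar>"] by linarith
      then show "16 * y\<^sup>2 + 4 * \<bar>y\<bar> \<le> 36 * exp \<bar>y\<bar>" using square_le_exp_abs[of y] by linarith
    qed auto
    also have "\<dots> = ennreal (36 * exp \<bar>y\<bar> + 9 * exp (A * (1 + \<bar>y\<bar>))) * evidence f \<tau> y"
      by (simp add: ennreal_mult'' distrib_right mult.assoc)
    also have "\<dots> \<le> ennreal (C * exp ((A + 1) * \<bar>y\<bar>)) * evidence f \<tau> y"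
    proof (intro mult_right_mono ennreal_leI)
      have "exp \<bar>y\<bar> \<le> exp ((A + 1) * \<bar>y\<bar>)" using A(1) by (simp add: distrib_right)
      moreover have "exp (A * (1 + \<bar>y\<bar>)) \<le> exp A * exp ((A + 1) * \<bar>y\<bar>)"
        unfolding exp_add[symmetric] exp_le_cancel_iff by (simp add: algebra_simps)
      ultimately show "36 * exp \<bar>y\<bar> + 9 * exp (A * (1 + \<bar>y\<bar>)) \<le> C * exp ((A + 1) * \<bar>y\<bar>)"
        unfolding C_def distrib_right[of 36] mult.assoc by (intro add_mono mult_left_mono) auto
    qed auto
    finally show ?thesis .
  qed
  moreover have "0 < C" by (simp add: C_def add_pos_pos)
  ultimately show ?thesis using A(1) by (intro exI[of _ "A + 1"] exI[of _ C]) auto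
qed

text \<open>
  The integrand is dominated by the fractional power \<open>|x|\<^bsup>b\<^esup>\<close>, whose prior moment is a multiple of
  \<open>\<tau>\<^bsup>b\<^esup>\<close>. Returning to the evidence costs \<open>exp (y\<^sup>2 / 2)\<close>, which is not integrable against the noise
  density.
\<close>

lemma null_moment_le_scale:
  assumes b: "0 < b" "b \<le> 1" "b < \<alpha> - 1"
  shows "\<exists>A C. 0 < A \<and> 0 < C \<and> (\<forall>\<tau> y. 0 < \<tau> \<longrightarrow> \<tau> \<le> 1 \<longrightarrow>
     null_moment f \<tau> y
       \<le> ennreal (C * exp (A * \<bar>y\<bar>) * (\<tau> powr b * exp (y\<^sup>2 / 2))) * evidence f \<tau> y)"
proof -
  obtain A where A: "0 < A" "\<And>\<tau> y. 0 < \<tau> \<Longrightarrow> \<tau> \<le> 1 \<Longrightarrow>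
      ennreal (\<phi> y) \<le> ennreal (exp (A * (1 + \<bar>y\<bar>))) * evidence f \<tau> y"
    using evidence_ge_phi by blast
  obtain E where E: "0 < E" "(\<integral>\<^sup>+x. ennreal (\<bar>x\<bar> powr b) * ennreal (f x) \<partial>lborel) \<le> ennreal E"
    using prior_abs_moment_finite[OF b(1,3)] by blast
  define C where "C = 24 * E * exp (2 + A)"
  have "null_moment f \<tau> y
       \<le> ennreal (C * exp ((A + 1) * \<bar>y\<bar>) * (\<tau> powr b * exp (y\<^sup>2 / 2))) * evidence f \<tau> y"
    if tau: "0 < \<tau>" "\<tau> \<le> 1" for \<tau> y
  proof -
    have "null_moment f \<tau> y
       \<le> (\<integral>\<^sup>+x. ennreal (8 * (1 + y\<^sup>2)) * (ennreal (\<bar>x\<bar> powr b) * ennreal (scaled f \<tau> x)) \<partial>lborel)"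
    proof (intro nn_integral_mono)
      fix x
      have sc: "0 \<le> scaled f \<tau> x" using tau by (simp add: scaled_nonneg)
      have "(x\<^sup>2 + \<bar>x\<bar>) * \<phi> (y - x) \<le> 8 * (1 + y\<^sup>2) * \<bar>x\<bar> powr b"
      proof (cases "\<bar>x\<bar> \<le> 1")
        case True
        have "x\<^sup>2 \<le> \<bar>x\<bar>" using True mult_left_mono[of "\<bar>x\<bar>" 1 "\<bar>x\<bar>"] by (simp add: power2_eq_square)
        moreover have "\<bar>x\<bar> \<le> \<bar>x\<bar> powr b"
          using True b powr_mono'[of b 1 "\<bar>x\<bar>"] by (cases "x = 0") auto
        ultimately have "(x\<^sup>2 + \<bar>x\<bar>) * \<phi> (y - x) \<le> (2 * \<bar>x\<bar> powr b) * 1"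
          by (intro mult_mono phi_le_1) auto
        also have "\<dots> \<le> 8 * (1 + y\<^sup>2) * \<bar>x\<bar> powr b" by (simp add: mult_right_mono)
        finally show ?thesis .
      next
        case False
        have "\<bar>x\<bar> \<le> x\<^sup>2" using False mult_left_mono[of 1 "\<bar>x\<bar>" "\<bar>x\<bar>"] by (simp add: power2_eq_square)
        moreover have "x\<^sup>2 \<le> 2 * y\<^sup>2 + 2 * (y - x)\<^sup>2"
        proof -
          have "0 \<le> (2 * y - x)\<^sup>2" by simp
          then show ?thesis by (simp add: power2_eq_square algebra_simps)
        qed
        ultimately have "(x\<^sup>2 + \<bar>x\<bar>) * \<phi> (y - x) \<le> (4 * y\<^sup>2 + 4 * (y - x)\<^sup>2) * \<phi> (y - x)"
          by (intro mult_right_mono) auto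
        also have "\<dots> = 4 * y\<^sup>2 * \<phi> (y - x) + 4 * ((y - x)\<^sup>2 * \<phi> (y - x))" by (simp add: distrib_right)
        also have "\<dots> \<le> 4 * y\<^sup>2 * 1 + 4 * 2"
          by (intro add_mono mult_left_mono phi_le_1 square_mult_phi_le) auto
        also have "\<dots> \<le> 8 * (1 + y\<^sup>2) * 1" by simp
        also have "\<dots> \<le> 8 * (1 + y\<^sup>2) * \<bar>x\<bar> powr b"
          using False b by (intro mult_left_mono ge_one_powr_ge_zero) auto
        finally show ?thesis .
      qed
      then have "(x\<^sup>2 + \<bar>x\<bar>) * \<phi> (y - x) * scaled f \<tau> x \<le> 8 * (1 + y\<^sup>2) * \<bar>x\<bar> powr b * scaled f \<tau> x"
        using sc by (rule mult_right_mono)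
      then have le: "(x\<^sup>2 + \<bar>x\<bar>) * (\<phi> (y - x) * scaled f \<tau> x) \<le> 8 * (1 + y\<^sup>2) * (\<bar>x\<bar> powr b * scaled f \<tau> x)"
        by (simp only: mult.assoc)
      have n: "0 \<le> x\<^sup>2 + \<bar>x\<bar>" "0 \<le> 8 * (1 + y\<^sup>2)" by auto
      show "ennreal (x\<^sup>2 + \<bar>x\<bar>) * ennreal (\<phi> (y - x) * scaled f \<tau> x)
        \<le> ennreal (8 * (1 + y\<^sup>2)) * (ennreal (\<bar>x\<bar> powr b) * ennreal (scaled f \<tau> x))"
        using ennreal_leI[OF le] by (simp only: ennreal_mult'[OF n(1)] ennreal_mult'[OF n(2)] ennreal_mult'[OF powr_ge_zero])
    qed
    also have "\<dots> = ennreal (8 * (1 + y\<^sup>2)) * (\<integral>\<^sup>+x. ennreal (\<bar>\<tau> * x\<bar> powr b) * ennreal (f x) \<partial>lborel)"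
      by (subst nn_integral_cmult, measurable) (subst nn_integral_scaled, use tau in auto)
    also have "(\<integral>\<^sup>+x. ennreal (\<bar>\<tau> * x\<bar> powr b) * ennreal (f x) \<partial>lborel)
        = (\<integral>\<^sup>+x. ennreal (\<tau> powr b) * (ennreal (\<bar>x\<bar> powr b) * ennreal (f x)) \<partial>lborel)"
      using tau by (intro nn_integral_cong) (simp add: abs_mult powr_mult ennreal_mult' mult.assoc)
    also have "\<dots> = ennreal (\<tau> powr b) * (\<integral>\<^sup>+x. ennreal (\<bar>x\<bar> powr b) * ennreal (f x) \<partial>lborel)"
      by (rule nn_integral_cmult) measurable
    also have "ennreal (8 * (1 + y\<^sup>2)) * \<dots> \<le> ennreal (8 * (1 + y\<^sup>2)) * (ennreal (\<tau> powr b) * ennreal E)"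
      by (intro mult_left_mono E) auto
    also have "\<dots> = ennreal (8 * (1 + y\<^sup>2) * (\<tau> powr b * E)) * 1"
      using E by (simp add: ennreal_mult')
    also have "\<dots> \<le> ennreal (8 * (1 + y\<^sup>2) * (\<tau> powr b * E)) * (ennreal (exp (2 + y\<^sup>2 / 2)) * (ennreal (exp (A * (1 + \<bar>y\<bar>))) * evidence f \<tau> y))"
    proof (intro mult_left_mono)
      have "1 \<le> ennreal (\<phi> y * exp (2 + y\<^sup>2 / 2))"
        using ennreal_leI[OF one_le_phi[of y]] by simp
      also have "\<dots> = ennreal (exp (2 + y\<^sup>2 / 2)) * ennreal (\<phi> y)"
        by (subst mult.commute) (rule ennreal_mult', simp)
      also have "\<dots> \<le> ennreal (exp (2 + y\<^sup>2 / 2)) * (ennreal (exp (A * (1 + \<bar>y\<bar>))) * evidence f \<tau> y)"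
        by (intro mult_left_mono A tau) auto
      finally show "1 \<le> ennreal (exp (2 + y\<^sup>2 / 2)) * (ennreal (exp (A * (1 + \<bar>y\<bar>))) * evidence f \<tau> y)" .
    qed auto
    also have "\<dots> = ennreal (8 * (1 + y\<^sup>2) * (\<tau> powr b * E) * (exp (2 + y\<^sup>2 / 2) * exp (A * (1 + \<bar>y\<bar>)))) * evidence f \<tau> y"
    proof -
      have "0 \<le> 8 * (1 + y\<^sup>2) * (\<tau> powr b * E)" using E by simp
      from ennreal_mult'[OF this, of "exp (2 + y\<^sup>2 / 2) * exp (A * (1 + \<bar>y\<bar>))"]
      show ?thesis by (simp only: ennreal_mult'[OF exp_ge_zero] mult.assoc)
    qed
    also have "\<dots> \<le> ennreal (C * exp ((A + 1) * \<bar>y\<bar>) * (\<tau> powr b * exp (y\<^sup>2 / 2))) * evidence f \<tau> y"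
    proof (intro mult_right_mono ennreal_leI)
      have "1 \<le> exp \<bar>y\<bar>" by simp
      then have "8 * (1 + y\<^sup>2) \<le> 24 * exp \<bar>y\<bar>" using square_le_exp_abs[of y] unfolding distrib_left by linarith
      then have "8 * (1 + y\<^sup>2) * (\<tau> powr b * E) * (exp (2 + y\<^sup>2 / 2) * exp (A * (1 + \<bar>y\<bar>)))
         \<le> 24 * exp \<bar>y\<bar> * (\<tau> powr b * E) * (exp (2 + y\<^sup>2 / 2) * exp (A * (1 + \<bar>y\<bar>)))"
        using E by (intro mult_right_mono) auto
      also have "\<dots> = 24 * \<tau> powr b * E * (exp \<bar>y\<bar> * (exp (2 + y\<^sup>2 / 2) * exp (A * (1 + \<bar>y\<bar>))))" by (simp only: mult_ac)
      also have "exp \<bar>y\<bar> * (exp (2 + y\<^sup>2 / 2) * exp (A * (1 + \<bar>y\<bar>))) = exp (2 + A) * (exp ((A + 1) * \<bar>y\<bar>) * exp (y\<^sup>2 / 2))"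
        unfolding exp_add[symmetric] by (simp add: algebra_simps)
      finally show "8 * (1 + y\<^sup>2) * (\<tau> powr b * E) * (exp (2 + y\<^sup>2 / 2) * exp (A * (1 + \<bar>y\<bar>)))
         \<le> C * exp ((A + 1) * \<bar>y\<bar>) * (\<tau> powr b * exp (y\<^sup>2 / 2))"
        by (simp only: C_def mult_ac)
    qed auto
    finally show ?thesis .
  qed
  moreover have "0 < C" using E by (simp add: C_def)
  ultimately show ?thesis using A(1) by (intro exI[of _ "A + 1"] exI[of _ C]) auto
qed

text \<open>
  Interpolation between the two preceding bounds, \<open>min 1 z \<le> z\<^bsup>p\<^esup>\<close> for \<open>z = \<tau>\<^bsup>b\<^esup> exp (y\<^sup>2 / 2)\<close>, keeps a power
  \<open>\<tau>\<^bsup>q\<^esup>\<close>, \<open>q = p b\<close>, and makes the factor in \<open>y\<close> integrable against the noise. At the top of the window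
  \<open>\<tau>\<^bsup>q\<^esup> = r\<^bsup>q \<alpha>/(\<alpha>-1)\<^esup>\<close>, and \<open>n\<close> such terms are \<open>o(s)\<close> when \<open>q > (\<alpha> - 1) / \<alpha>\<close>. This leaves room for
  \<open>q < b\<close> because \<open>(\<alpha> - 1) / \<alpha> < min 1 (\<alpha> - 1)\<close>.
\<close>

lemma null_moment_upper:
  "\<exists>A C p q. 0 < A \<and> 0 < C \<and> p < 1 \<and> 0 < q \<and> 1 < q * (\<alpha> / (\<alpha> - 1)) \<and> (\<forall>\<tau> y. 0 < \<tau> \<longrightarrow> \<tau> \<le> 1 \<longrightarrow>
     null_moment f \<tau> y
       \<le> ennreal (C * \<tau> powr q * exp (A * \<bar>y\<bar> + p * y\<^sup>2 / 2)) * evidence f \<tau> y)"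
proof -
  define l where "l = (\<alpha> - 1) / \<alpha>"
  have l: "0 < l" "l < 1" "l < \<alpha> - 1"
    using \<alpha> divide_strict_left_mono[of 1 \<alpha> "\<alpha> - 1"] by (auto simp: l_def)
  obtain b where b: "l < b" "b < min 1 (\<alpha> - 1)" using dense[of l "min 1 (\<alpha> - 1)"] l by auto
  obtain q where q: "l < q" "q < b" using dense[of l b] b by auto
  define p where "p = q / b"
  have p: "0 < p" "p < 1" using q l by (auto simp: p_def)
  obtain A\<^sub>1 C\<^sub>1 where 1: "0 < A\<^sub>1" "0 < C\<^sub>1" "\<And>\<tau> y. 0 < \<tau> \<Longrightarrow> \<tau> \<le> 1 \<Longrightarrow>
     null_moment f \<tau> y
       \<le> ennreal (C\<^sub>1 * exp (A\<^sub>1 * \<bar>y\<bar>)) * evidence f \<tau> y" using null_moment_le_evidence by blast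
  have b': "0 < b" "b \<le> 1" "b < \<alpha> - 1" using b l by auto
  obtain A\<^sub>2 C\<^sub>2 where 2: "0 < A\<^sub>2" "0 < C\<^sub>2" "\<And>\<tau> y. 0 < \<tau> \<Longrightarrow> \<tau> \<le> 1 \<Longrightarrow>
     null_moment f \<tau> y
       \<le> ennreal (C\<^sub>2 * exp (A\<^sub>2 * \<bar>y\<bar>) * (\<tau> powr b * exp (y\<^sup>2 / 2))) * evidence f \<tau> y"
    using null_moment_le_scale[OF b'] by blast
  define A where "A = max A\<^sub>1 A\<^sub>2"
  define C where "C = max C\<^sub>1 C\<^sub>2"
  have AC: "0 < A" "0 < C" using 1 2 by (auto simp: A_def C_def)
  have "null_moment f \<tau> y
       \<le> ennreal (C * \<tau> powr q * exp (A * \<bar>y\<bar> + p * y\<^sup>2 / 2)) * evidence f \<tau> y"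
    if tau: "0 < \<tau>" "\<tau> \<le> 1" for \<tau> y
  proof -
    define z where "z = \<tau> powr b * exp (y\<^sup>2 / 2)"
    have z: "0 < z" using tau by (simp add: z_def)
    have zp: "z powr p = \<tau> powr q * exp (p * y\<^sup>2 / 2)"
      using b'(1) tau by (simp add: z_def powr_mult powr_powr p_def exp_powr_real mult.commute)
    have eq: "C * \<tau> powr q * exp (A * \<bar>y\<bar> + p * y\<^sup>2 / 2) = C * exp (A * \<bar>y\<bar>) * z powr p"
      by (simp only: zp exp_add mult_ac)
    have e: "exp (A\<^sub>1 * \<bar>y\<bar>) \<le> exp (A * \<bar>y\<bar>)" "exp (A\<^sub>2 * \<bar>y\<bar>) \<le> exp (A * \<bar>y\<bar>)"
      by (auto simp: A_def mult_right_mono)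
    show ?thesis
    proof (cases "1 \<le> z")
      case True
      have "C\<^sub>1 * exp (A\<^sub>1 * \<bar>y\<bar>) * 1 \<le> C * exp (A * \<bar>y\<bar>) * z powr p"
        using e True p 1 by (intro mult_mono ge_one_powr_ge_zero) (auto simp: C_def)
      then have "ennreal (C\<^sub>1 * exp (A\<^sub>1 * \<bar>y\<bar>)) * evidence f \<tau> y \<le> ennreal (C * exp (A * \<bar>y\<bar>) * z powr p) * evidence f \<tau> y"
        by (intro mult_right_mono ennreal_leI) auto
      with 1(3)[OF tau, of y] show ?thesis unfolding eq by (rule order_trans)
    next
      case False
      have "z \<le> z powr p" using False z p powr_mono'[of p 1 z] by simp
      then have "C\<^sub>2 * exp (A\<^sub>2 * \<bar>y\<bar>) * z \<le> C * exp (A * \<bar>y\<bar>) * z powr p"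
        using e z p 2 by (intro mult_mono) (auto simp: C_def)
      then have "ennreal (C\<^sub>2 * exp (A\<^sub>2 * \<bar>y\<bar>) * z) * evidence f \<tau> y \<le> ennreal (C * exp (A * \<bar>y\<bar>) * z powr p) * evidence f \<tau> y"
        by (intro mult_right_mono ennreal_leI) auto
      with 2(3)[OF tau, of y] show ?thesis unfolding eq z_def[symmetric] by (rule order_trans)
    qed
  qed
  moreover have "1 < q * (\<alpha> / (\<alpha> - 1))" using q(1) \<alpha> by (simp add: l_def field_simps)
  moreover have "0 < q" using q l by linarith
  ultimately show ?thesis using AC p(2) by blast
qed

end

section \<open>The posterior as a ratio of mixtures of product integrals\<close>

abbreviation leb :: "nat \<Rightarrow> (nat \<Rightarrow> real) measure" where
  "leb n \<equiv> PiM {..<n} (\<lambda>_. lborel)"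

interpretation lborel_product: product_sigma_finite "\<lambda>_::nat. lborel :: real measure"
  by standard

lemma sigma_finite_leb: "sigma_finite_measure (leb n)"
  by (rule lborel_product.sigma_finite) simp

lemma measurable_coordinate_sum:
  fixes g :: "nat \<Rightarrow> real \<Rightarrow> real"
  assumes "I \<subseteq> {..<n}" and [measurable]: "\<And>i. g i \<in> borel_measurable borel"
  shows "(\<lambda>x. \<Sum>i\<in>I. g i (x i)) \<in> borel_measurable (leb n)"
proof (intro borel_measurable_sum)
  fix i assume "i \<in> I"
  then have "i \<in> {..<n}" using assms(1) by auto
  then show "(\<lambda>x. g i (x i)) \<in> borel_measurable (leb n)" by measurable
qed

text \<open>
  The unnormalised posterior integral of a weight \<open>g\<close> given the scale \<open>\<tau>\<close>.
\<close>

definition weighted_evidence ::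
  "(real \<Rightarrow> real) \<Rightarrow> nat \<Rightarrow> real \<Rightarrow> (nat \<Rightarrow> real) \<Rightarrow> ((nat \<Rightarrow> real) \<Rightarrow> ennreal) \<Rightarrow> ennreal" where
  "weighted_evidence f n \<tau> y g =
     (\<integral>\<^sup>+x. g x * (\<Prod>i<n. ennreal (\<phi> (y i - x i) * scaled f \<tau> (x i))) \<partial>leb n)"

lemma weighted_evidence_prod:
  assumes [measurable]: "f \<in> borel_measurable borel" "\<And>i. i < n \<Longrightarrow> g i \<in> borel_measurable borel"
  shows "weighted_evidence f n \<tau> y (\<lambda>x. \<Prod>i<n. g i (x i))
    = (\<Prod>i<n. \<integral>\<^sup>+x. g i x * ennreal (\<phi> (y i - x) * scaled f \<tau> x) \<partial>lborel)"
proof -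
  have "weighted_evidence f n \<tau> y (\<lambda>x. \<Prod>i<n. g i (x i))
    = (\<integral>\<^sup>+x. (\<Prod>i<n. g i (x i) * ennreal (\<phi> (y i - x i) * scaled f \<tau> (x i))) \<partial>leb n)"
    by (simp add: weighted_evidence_def prod.distrib)
  also have "\<dots> = (\<Prod>i<n. \<integral>\<^sup>+x. g i x * ennreal (\<phi> (y i - x) * scaled f \<tau> x) \<partial>lborel)"
    by (subst lborel_product.product_nn_integral_prod) auto
  finally show ?thesis .
qed

lemma weighted_evidence_1:
  assumes "f \<in> borel_measurable borel"
  shows "weighted_evidence f n \<tau> y (\<lambda>_. 1) = (\<Prod>i<n. evidence f \<tau> (y i))"
  using weighted_evidence_prod[OF assms, of n "\<lambda>_ _. 1" \<tau> y] by (simp add: evidence_def)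

lemma weighted_evidence_single:
  assumes [measurable]: "f \<in> borel_measurable borel" "h \<in> borel_measurable borel" and j: "j < n"
  shows "weighted_evidence f n \<tau> y (\<lambda>x. h (x j))
    = (\<integral>\<^sup>+x. h x * ennreal (\<phi> (y j - x) * scaled f \<tau> x) \<partial>lborel) * (\<Prod>i\<in>{..<n} - {j}. evidence f \<tau> (y i))"
proof -
  have "(\<lambda>x. h (x j)) = (\<lambda>x. \<Prod>i<n. (if i = j then h else (\<lambda>_. 1)) (x i))"
  proof
    fix x :: "nat \<Rightarrow> real"
    have "(\<Prod>i<n. (if i = j then h else (\<lambda>_. 1)) (x i)) = (\<Prod>i<n. if i = j then h (x i) else 1)"
      by (intro prod.cong) auto
    then show "h (x j) = (\<Prod>i<n. (if i = j then h else (\<lambda>_. 1)) (x i))" using j by simp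
  qed
  then have "weighted_evidence f n \<tau> y (\<lambda>x. h (x j))
    = (\<Prod>i<n. \<integral>\<^sup>+x. (if i = j then h else (\<lambda>_. 1)) x * ennreal (\<phi> (y i - x) * scaled f \<tau> x) \<partial>lborel)"
    by (simp only:) (rule weighted_evidence_prod, auto)
  also have "\<dots> = (\<integral>\<^sup>+x. h x * ennreal (\<phi> (y j - x) * scaled f \<tau> x) \<partial>lborel)
     * (\<Prod>i\<in>{..<n} - {j}. \<integral>\<^sup>+x. (if i = j then h else (\<lambda>_. 1)) x * ennreal (\<phi> (y i - x) * scaled f \<tau> x) \<partial>lborel)"
    using j by (subst prod.remove[of _ j]) auto
  also have "(\<Prod>i\<in>{..<n} - {j}. \<integral>\<^sup>+x. (if i = j then h else (\<lambda>_. 1)) x * ennreal (\<phi> (y i - x) * scaled f \<tau> x) \<partial>lborel)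
     = (\<Prod>i\<in>{..<n} - {j}. evidence f \<tau> (y i))"
    by (intro prod.cong) (auto simp: evidence_def)
  finally show ?thesis .
qed

lemma weighted_evidence_mono:
  assumes "\<And>x. x \<in> space (leb n) \<Longrightarrow> g x \<le> h x"
  shows "weighted_evidence f n \<tau> y g \<le> weighted_evidence f n \<tau> y h"
  unfolding weighted_evidence_def by (intro nn_integral_mono mult_right_mono assms) auto

lemma weighted_evidence_cmult:
  assumes [measurable]: "f \<in> borel_measurable borel" "g \<in> borel_measurable (leb n)"
  shows "weighted_evidence f n \<tau> y (\<lambda>x. c * g x) = c * weighted_evidence f n \<tau> y g"
  unfolding weighted_evidence_def mult.assoc by (rule nn_integral_cmult) measurable

lemma weighted_evidence_add:
  assumes [measurable]: "f \<in> borel_measurable borel" "g \<in> borel_measurable (leb n)" "h \<in> borel_measurable (leb n)"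
  shows "weighted_evidence f n \<tau> y (\<lambda>x. g x + h x) = weighted_evidence f n \<tau> y g + weighted_evidence f n \<tau> y h"
  unfolding weighted_evidence_def distrib_right by (rule nn_integral_add) measurable

lemma weighted_evidence_sum:
  assumes [measurable]: "f \<in> borel_measurable borel" "\<And>i. i \<in> I \<Longrightarrow> g i \<in> borel_measurable (leb n)"
  shows "weighted_evidence f n \<tau> y (\<lambda>x. \<Sum>i\<in>I. g i x) = (\<Sum>i\<in>I. weighted_evidence f n \<tau> y (g i))"
  unfolding weighted_evidence_def sum_distrib_right by (rule nn_integral_sum) measurable

lemma measurable_weighted_evidence:
  assumes [measurable]: "f \<in> borel_measurable borel" "g \<in> borel_measurable (leb n)"
  shows "(\<lambda>(y, \<tau>). weighted_evidence f n \<tau> y g) \<in> borel_measurable (leb n \<Otimes>\<^sub>M borel)"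
proof -
  interpret sigma_finite_measure "leb n" by (rule sigma_finite_leb)
  have "(\<lambda>z. \<integral>\<^sup>+x. g x * (\<Prod>i<n. ennreal (\<phi> (fst z i - x i) * scaled f (snd z) (x i))) \<partial>leb n)
    \<in> borel_measurable (leb n \<Otimes>\<^sub>M borel)"
    unfolding scaled_def by measurable
  then show ?thesis by (simp add: weighted_evidence_def case_prod_beta')
qed

lemma nn_integral_likelihood_prior:
  assumes P: "is_scale_prior P"
    and [measurable]: "f \<in> borel_measurable borel" "g \<in> borel_measurable (leb n)"
    and f: "\<And>x. 0 \<le> f x"
  shows "(\<integral>\<^sup>+\<theta>. g \<theta> * (ennreal (likelihood n y \<theta>) * prior_density f P n \<theta>) \<partial>leb n)
     = (\<integral>\<^sup>+\<tau>. weighted_evidence f n \<tau> y g \<partial>P)"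
proof -
  interpret prob_space P using P by (simp add: is_scale_prior_def)
  have [measurable_cong]: "sets P = sets borel" using P by (simp add: is_scale_prior_def)
  interpret L: sigma_finite_measure "leb n" by (rule sigma_finite_leb)
  interpret pair_sigma_finite "leb n" P ..
  have "(\<integral>\<^sup>+\<theta>. g \<theta> * (ennreal (likelihood n y \<theta>) * prior_density f P n \<theta>) \<partial>leb n)
     = (\<integral>\<^sup>+\<theta>. \<integral>\<^sup>+\<tau>. g \<theta> * (ennreal (likelihood n y \<theta>) * ennreal (prior_density_given f n \<tau> \<theta>)) \<partial>P \<partial>leb n)"
  proof (rule nn_integral_cong)
    fix \<theta> assume \<theta>: "\<theta> \<in> space (leb n)"
    have [measurable]: "(\<lambda>\<tau>. ennreal (prior_density_given f n \<tau> \<theta>)) \<in> borel_measurable P"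
      unfolding prior_density_given_def by measurable
    show "g \<theta> * (ennreal (likelihood n y \<theta>) * prior_density f P n \<theta>)
      = (\<integral>\<^sup>+\<tau>. g \<theta> * (ennreal (likelihood n y \<theta>) * ennreal (prior_density_given f n \<tau> \<theta>)) \<partial>P)"
      by (simp add: prior_density_def nn_integral_cmult)
  qed
  also have "\<dots> = (\<integral>\<^sup>+\<tau>. \<integral>\<^sup>+\<theta>. g \<theta> * (ennreal (likelihood n y \<theta>) * ennreal (prior_density_given f n \<tau> \<theta>)) \<partial>leb n \<partial>P)"
    unfolding prior_density_given_def likelihood_def by (rule Fubini'[symmetric]) measurable
  also have "\<dots> = (\<integral>\<^sup>+\<tau>. weighted_evidence f n \<tau> y g \<partial>P)"
  proof (rule nn_integral_cong_AE)
    \<comment> \<open>For \<open>\<tau> < 0\<close> the conversion to \<open>ennreal\<close> would not commute with the product of negative factors.\<close>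
    have "AE \<tau> in P. 0 < \<tau>" using P by (simp add: is_scale_prior_def)
    then show "AE \<tau> in P. (\<integral>\<^sup>+\<theta>. g \<theta> * (ennreal (likelihood n y \<theta>) * ennreal (prior_density_given f n \<tau> \<theta>)) \<partial>leb n)
        = weighted_evidence f n \<tau> y g"
    proof eventually_elim
      fix \<tau> :: real assume \<tau>: "0 < \<tau>"
      have "ennreal (likelihood n y \<theta>) * ennreal (prior_density_given f n \<tau> \<theta>)
         = (\<Prod>i<n. ennreal (\<phi> (y i - \<theta> i) * scaled f \<tau> (\<theta> i)))" for \<theta>
      proof -
        have "(\<Prod>i<n. ennreal (\<phi> (y i - \<theta> i) * scaled f \<tau> (\<theta> i))) = ennreal (\<Prod>i<n. \<phi> (y i - \<theta> i) * scaled f \<tau> (\<theta> i))"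
          using \<tau> f by (intro prod_ennreal) (simp add: scaled_def)
        also have "(\<Prod>i<n. \<phi> (y i - \<theta> i) * scaled f \<tau> (\<theta> i)) = likelihood n y \<theta> * prior_density_given f n \<tau> \<theta>"
          by (simp only: likelihood_def prior_density_given_def scaled_def prod.distrib)
        finally show ?thesis by (simp add: ennreal_mult' likelihood_def prod_nonneg)
      qed
      then show "(\<integral>\<^sup>+\<theta>. g \<theta> * (ennreal (likelihood n y \<theta>) * ennreal (prior_density_given f n \<tau> \<theta>)) \<partial>leb n)
        = weighted_evidence f n \<tau> y g"
        by (simp add: weighted_evidence_def)
    qed
  qed
  finally show ?thesis .
qed

lemma emeasure_posterior:
  assumes P: "is_scale_prior P"
    and [measurable]: "f \<in> borel_measurable borel" "B \<in> sets (leb n)"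
    and f: "\<And>x. 0 \<le> f x"
  shows "emeasure (posterior f P n y) B
     = (\<integral>\<^sup>+\<tau>. weighted_evidence f n \<tau> y (indicator B) \<partial>P) / (\<integral>\<^sup>+\<tau>. weighted_evidence f n \<tau> y (\<lambda>_. 1) \<partial>P)"
proof -
  interpret prob_space P using P by (simp add: is_scale_prior_def)
  have [measurable_cong]: "sets P = sets borel" using P by (simp add: is_scale_prior_def)
  define Z where "Z = (\<integral>\<^sup>+\<theta>. ennreal (likelihood n y \<theta>) * prior_density f P n \<theta> \<partial>leb n)"
  have Z: "Z = (\<integral>\<^sup>+\<tau>. weighted_evidence f n \<tau> y (\<lambda>_. 1) \<partial>P)"
    using nn_integral_likelihood_prior[OF P assms(2) _ f, of "\<lambda>_. 1" n y] by (simp add: Z_def)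
  have [measurable]: "likelihood n y \<in> borel_measurable (leb n)"
    unfolding likelihood_def by measurable
  have [measurable]: "prior_density f P n \<in> borel_measurable (leb n)"
    unfolding prior_density_def prior_density_given_def by measurable
  have "emeasure (posterior f P n y) B
      = (\<integral>\<^sup>+\<theta>. ennreal (likelihood n y \<theta>) * prior_density f P n \<theta> / Z * indicator B \<theta> \<partial>leb n)"
    unfolding posterior_def Z_def[symmetric] by (rule emeasure_density) measurable
  also have "\<dots> = (\<integral>\<^sup>+\<theta>. indicator B \<theta> * (ennreal (likelihood n y \<theta>) * prior_density f P n \<theta>) / Z \<partial>leb n)"
    by (intro nn_integral_cong) (simp add: divide_ennreal_def mult_ac)
  also have "\<dots> = (\<integral>\<^sup>+\<theta>. indicator B \<theta> * (ennreal (likelihood n y \<theta>) * prior_density f P n \<theta>) \<partial>leb n) / Z"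
    by (rule nn_integral_divide) measurable
  also have "\<dots> = (\<integral>\<^sup>+\<tau>. weighted_evidence f n \<tau> y (indicator B) \<partial>P) / Z"
    by (subst nn_integral_likelihood_prior[OF P assms(2) _ f]) auto
  finally show ?thesis by (simp add: Z)
qed

lemma expected_posterior_prob_eq:
  assumes P: "is_scale_prior P"
    and [measurable]: "f \<in> borel_measurable borel" "{x \<in> space (leb n). A x} \<in> sets (leb n)"
    and f: "\<And>x. 0 \<le> f x"
  shows "expected_posterior_prob f P n t A
     = (\<integral>\<^sup>+e. (\<integral>\<^sup>+\<tau>. weighted_evidence f n \<tau> (\<lambda>i. t i + e i) (indicator {x \<in> space (leb n). A x}) \<partial>P)
            / (\<integral>\<^sup>+\<tau>. weighted_evidence f n \<tau> (\<lambda>i. t i + e i) (\<lambda>_. 1) \<partial>P) \<partial>noise_law n)"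
proof -
  interpret prob_space P using P by (simp add: is_scale_prior_def)
  have [measurable_cong]: "sets P = sets borel" using P by (simp add: is_scale_prior_def)
  define B where "B = {x \<in> space (leb n). A x}"
  have B [measurable]: "B \<in> sets (leb n)" unfolding B_def by measurable
  have sp: "space (posterior f P n y) = space (leb n)" for y by (simp add: posterior_def)
  have [measurable_cong]: "sets (noise_law n) = sets (leb n)"
    unfolding noise_law_def by (intro sets_PiM_cong) auto
  define F where "F y = (\<integral>\<^sup>+\<tau>. weighted_evidence f n \<tau> y (indicator B) \<partial>P) / (\<integral>\<^sup>+\<tau>. weighted_evidence f n \<tau> y (\<lambda>_. 1) \<partial>P)" for y
  have [measurable]: "(\<lambda>y. \<integral>\<^sup>+\<tau>. weighted_evidence f n \<tau> y g \<partial>P) \<in> borel_measurable (leb n)"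
    if "g \<in> borel_measurable (leb n)" for g
  proof -
    have [measurable]: "(\<lambda>(y, \<tau>). weighted_evidence f n \<tau> y g) \<in> borel_measurable (leb n \<Otimes>\<^sub>M borel)"
      using measurable_weighted_evidence[OF assms(2) that] .
    show ?thesis by measurable
  qed
  have [measurable]: "F \<in> borel_measurable (leb n)"
    unfolding F_def by measurable
  have "expected_posterior_prob f P n t A = (\<integral>\<^sup>+y. F y \<partial>data_law n t)"
    unfolding expected_posterior_prob_def sp B_def[symmetric] F_def emeasure_posterior[OF P assms(2) B f] ..
  also have "\<dots> = (\<integral>\<^sup>+e. F (\<lambda>i\<in>{..<n}. t i + e i) \<partial>noise_law n)"
    unfolding data_law_def by (rule nn_integral_distr) measurable
  also have "\<dots> = (\<integral>\<^sup>+e. F (\<lambda>i. t i + e i) \<partial>noise_law n)"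
    by (intro nn_integral_cong) (simp add: F_def weighted_evidence_def)
  finally show ?thesis by (simp add: F_def B_def)
qed

section \<open>The noise\<close>

text \<open>
  The likelihood ratio, on the coordinates outside \<open>S\<close>, between the prior predictive law given \<open>\<tau>\<close> and
  pure noise. The factor is one on \<open>S\<close>, so that the product can run over all coordinates.
\<close>

definition null_ratio :: "(real \<Rightarrow> real) \<Rightarrow> nat \<Rightarrow> nat set \<Rightarrow> real \<Rightarrow> (nat \<Rightarrow> real) \<Rightarrow> ennreal" where
  "null_ratio f n S \<tau> e = (\<Prod>i<n. if i \<in> S then 1 else evidence f \<tau> (e i) / ennreal (\<phi> (e i)))"

lemma prod_if_split:
  fixes S :: "nat set"
  assumes "S \<subseteq> {..<n}"
  shows "(\<Prod>i<n. if i \<in> S then a i else b i) = (\<Prod>i\<in>S. a i) * (\<Prod>i\<in>{..<n} - S. b i)"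
proof -
  have "(\<Prod>i<n. if i \<in> S then a i else b i)
     = (\<Prod>i\<in>{..<n} - S. if i \<in> S then a i else b i) * (\<Prod>i\<in>S. if i \<in> S then a i else b i)"
    using assms by (intro prod.subset_diff) auto
  then show ?thesis by (simp add: mult.commute)
qed

lemma evidence_eq_ratio: "evidence f \<tau> y = ennreal (\<phi> y) * (evidence f \<tau> y / ennreal (\<phi> y))"
  by (simp add: ennreal_times_divide ennreal_mult_divide_eq mult.commute)

lemma nn_integral_noise_prod:
  assumes [measurable]: "\<And>i. i < n \<Longrightarrow> g i \<in> borel_measurable borel"
  shows "(\<integral>\<^sup>+e. (\<Prod>i<n. g i (e i)) \<partial>noise_law n) = (\<Prod>i<n. \<integral>\<^sup>+x. ennreal (\<phi> x) * g i x \<partial>lborel)"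
proof -
  interpret N: prob_space "density lborel (\<lambda>x. ennreal (\<phi> x))"
    by (rule prob_space_normal_density) simp
  interpret product_sigma_finite "\<lambda>_::nat. density lborel (\<lambda>x. ennreal (\<phi> x))" ..
  have "(\<integral>\<^sup>+e. (\<Prod>i<n. g i (e i)) \<partial>noise_law n) = (\<Prod>i<n. \<integral>\<^sup>+x. g i x \<partial>density lborel (\<lambda>x. ennreal (\<phi> x)))"
    unfolding noise_law_def by (rule product_nn_integral_prod) auto
  then show ?thesis by (simp add: nn_integral_density)
qed

lemma nn_integral_noise_single:
  assumes [measurable]: "g \<in> borel_measurable borel" and j: "j < n"
  shows "(\<integral>\<^sup>+e. g (e j) \<partial>noise_law n) = (\<integral>\<^sup>+x. ennreal (\<phi> x) * g x \<partial>lborel)"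
proof -
  have "(\<integral>\<^sup>+e. g (e j) \<partial>noise_law n) = (\<integral>\<^sup>+e. (\<Prod>i<n. (if i = j then g else (\<lambda>_. 1)) (e i)) \<partial>noise_law n)"
  proof (intro nn_integral_cong)
    fix e :: "nat \<Rightarrow> real"
    have "(\<Prod>i<n. (if i = j then g else (\<lambda>_. 1)) (e i)) = (\<Prod>i<n. if i = j then g (e i) else 1)"
      by (intro prod.cong) auto
    then show "g (e j) = (\<Prod>i<n. (if i = j then g else (\<lambda>_. 1)) (e i))" using j by simp
  qed
  also have "\<dots> = (\<Prod>i<n. \<integral>\<^sup>+x. ennreal (\<phi> x) * (if i = j then g else (\<lambda>_. 1)) x \<partial>lborel)"
    by (rule nn_integral_noise_prod) auto
  also have "\<dots> = (\<Prod>i<n. if i = j then \<integral>\<^sup>+x. ennreal (\<phi> x) * g x \<partial>lborel else 1)"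
    by (intro prod.cong) (auto simp: nn_integral_phi)
  also have "\<dots> = (\<integral>\<^sup>+x. ennreal (\<phi> x) * g x \<partial>lborel)" using j by simp
  finally show ?thesis .
qed

lemma sets_noise_law [measurable_cong]: "sets (noise_law n) = sets (leb n)"
  unfolding noise_law_def by (intro sets_PiM_cong) auto

lemma prob_space_noise: "prob_space (noise_law n)"
  unfolding noise_law_def by (intro prob_space_PiM prob_space_normal_density) simp

text \<open>
  The statistic that controls every noise-dependent exponent in the bounds below. The weight \<open>s / n\<close> of
  the first sum is the \<open>\<delta>\<close> of \<open>null_evidence_lower\<close>.
\<close>

definition noise_size :: "nat \<Rightarrow> nat set \<Rightarrow> (nat \<Rightarrow> real) \<Rightarrow> real" where
  "noise_size n S e = (real (card S) / real n) * (\<Sum>i<n. \<bar>e i\<bar>) + (\<Sum>i\<in>S. (e i)\<^sup>2 + \<bar>e i\<bar>)"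

lemma measurable_noise_size:
  assumes "S \<subseteq> {..<n}"
  shows "noise_size n S \<in> borel_measurable (leb n)"
proof -
  have [measurable]: "(\<lambda>e. \<Sum>i\<in>S. (e i)\<^sup>2 + \<bar>e i\<bar>) \<in> borel_measurable (leb n)"
    using assms by (rule measurable_coordinate_sum) measurable
  show ?thesis unfolding noise_size_def by measurable
qed

lemma nn_integral_noise_sum:
  fixes g :: "real \<Rightarrow> real"
  assumes I: "I \<subseteq> {..<n}" and [measurable]: "g \<in> borel_measurable borel" and g: "\<And>x. 0 \<le> g x"
  shows "(\<integral>\<^sup>+e. ennreal (\<Sum>i\<in>I. g (e i)) \<partial>noise_law n) = of_nat (card I) * (\<integral>\<^sup>+x. ennreal (g x * \<phi> x) \<partial>lborel)"
proof -
  have "(\<integral>\<^sup>+e. ennreal (\<Sum>i\<in>I. g (e i)) \<partial>noise_law n) = (\<integral>\<^sup>+e. (\<Sum>i\<in>I. ennreal (g (e i))) \<partial>noise_law n)"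
    using g by (intro nn_integral_cong) (simp add: sum_ennreal)
  also have "\<dots> = (\<Sum>i\<in>I. \<integral>\<^sup>+e. ennreal (g (e i)) \<partial>noise_law n)"
  proof (rule nn_integral_sum)
    fix i assume "i \<in> I"
    then have "i \<in> {..<n}" using I by auto
    then show "(\<lambda>e. ennreal (g (e i))) \<in> borel_measurable (noise_law n)" by measurable
  qed
  also have "\<dots> = (\<Sum>i\<in>I. \<integral>\<^sup>+x. ennreal (g x * \<phi> x) \<partial>lborel)"
  proof (rule sum.cong)
    fix i assume "i \<in> I"
    then have "i < n" using I by auto
    then show "(\<integral>\<^sup>+e. ennreal (g (e i)) \<partial>noise_law n) = (\<integral>\<^sup>+x. ennreal (g x * \<phi> x) \<partial>lborel)"
      using g nn_integral_noise_single[of "\<lambda>x. ennreal (g x)" i n]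
      by (simp add: ennreal_mult'' mult.commute)
  qed simp
  finally show ?thesis by simp
qed

lemma nn_integral_noise_size:
  assumes S: "S \<subseteq> {..<n}" and n: "0 < n"
  shows "(\<integral>\<^sup>+e. ennreal (noise_size n S e) \<partial>noise_law n) \<le> ennreal (3 * real (card S))"
proof -
  define r where "r = real (card S) / real n"
  have r: "0 \<le> r" "r * real n = real (card S)" using n by (simp_all add: r_def)
  have abs_le: "\<bar>x\<bar> \<le> 1 / 2 + 1 / 2 * x\<^sup>2" for x :: real
  proof -
    have "0 \<le> (\<bar>x\<bar> - 1)\<^sup>2" by simp
    then show ?thesis by (simp add: power2_diff)
  qed
  have "(\<integral>\<^sup>+e. ennreal (noise_size n S e) \<partial>noise_law n)
      = (\<integral>\<^sup>+e. ennreal (\<Sum>i<n. r * \<bar>e i\<bar>) + ennreal (\<Sum>i\<in>S. (e i)\<^sup>2 + \<bar>e i\<bar>) \<partial>noise_law n)"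
    unfolding noise_size_def r_def[symmetric] sum_distrib_left using r
    by (intro nn_integral_cong ennreal_plus sum_nonneg) auto
  also have "\<dots> = (\<integral>\<^sup>+e. ennreal (\<Sum>i<n. r * \<bar>e i\<bar>) \<partial>noise_law n)
      + (\<integral>\<^sup>+e. ennreal (\<Sum>i\<in>S. (e i)\<^sup>2 + \<bar>e i\<bar>) \<partial>noise_law n)"
  proof (rule nn_integral_add)
    have [measurable]: "(\<lambda>e. \<Sum>i\<in>S. (e i)\<^sup>2 + \<bar>e i\<bar>) \<in> borel_measurable (leb n)"
      using S by (rule measurable_coordinate_sum) measurable
    show "(\<lambda>e. ennreal (\<Sum>i\<in>S. (e i)\<^sup>2 + \<bar>e i\<bar>)) \<in> borel_measurable (noise_law n)" by measurable
    show "(\<lambda>e. ennreal (\<Sum>i<n. r * \<bar>e i\<bar>)) \<in> borel_measurable (noise_law n)" by measurable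
  qed
  also have "(\<integral>\<^sup>+e. ennreal (\<Sum>i<n. r * \<bar>e i\<bar>) \<partial>noise_law n)
      = of_nat n * (\<integral>\<^sup>+x. ennreal (r * \<bar>x\<bar> * \<phi> x) \<partial>lborel)"
    using r nn_integral_noise_sum[of "{..<n}" n "\<lambda>x. r * \<bar>x\<bar>"] by simp
  also have "(\<integral>\<^sup>+e. ennreal (\<Sum>i\<in>S. (e i)\<^sup>2 + \<bar>e i\<bar>) \<partial>noise_law n)
      = of_nat (card S) * (\<integral>\<^sup>+x. ennreal ((x\<^sup>2 + \<bar>x\<bar>) * \<phi> x) \<partial>lborel)"
    using nn_integral_noise_sum[OF S, of "\<lambda>x. x\<^sup>2 + \<bar>x\<bar>"] by simp
  also have "of_nat n * (\<integral>\<^sup>+x. ennreal (r * \<bar>x\<bar> * \<phi> x) \<partial>lborel)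
       + of_nat (card S) * (\<integral>\<^sup>+x. ennreal ((x\<^sup>2 + \<bar>x\<bar>) * \<phi> x) \<partial>lborel)
     \<le> of_nat n * (\<integral>\<^sup>+x. ennreal ((r / 2 + r / 2 * x\<^sup>2) * \<phi> x) \<partial>lborel)
       + of_nat (card S) * (\<integral>\<^sup>+x. ennreal ((1 / 2 + 3 / 2 * x\<^sup>2) * \<phi> x) \<partial>lborel)"
  proof -
    have "r * \<bar>x\<bar> \<le> r / 2 + r / 2 * x\<^sup>2" for x :: real
      using mult_left_mono[OF abs_le r(1), of x] by (simp add: distrib_left)
    moreover have "x\<^sup>2 + \<bar>x\<bar> \<le> 1 / 2 + 3 / 2 * x\<^sup>2" for x :: real using abs_le[of x] by simp
    ultimately show ?thesis
      by (intro add_mono[OF mult_left_mono mult_left_mono] nn_integral_mono ennreal_leI mult_right_mono) auto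
  qed
  also have "\<dots> = ennreal (real n) * ennreal r + ennreal (real (card S)) * ennreal 2"
  proof -
    have "(\<integral>\<^sup>+x. ennreal ((r / 2 + r / 2 * x\<^sup>2) * \<phi> x) \<partial>lborel) = ennreal r"
      using r by (subst nn_integral_phi_quadratic) auto
    moreover have "(\<integral>\<^sup>+x. ennreal ((1 / 2 + 3 / 2 * x\<^sup>2) * \<phi> x) \<partial>lborel) = ennreal 2"
      by (subst nn_integral_phi_quadratic) auto
    ultimately show ?thesis by (simp only: ennreal_of_nat_eq_real_of_nat)
  qed
  also have "\<dots> = ennreal (real n * r + real (card S) * 2)"
    using r(1) by (simp add: ennreal_mult)
  also have "real n * r + real (card S) * 2 = 3 * real (card S)" using r(2) by (simp add: mult.commute)
  finally show ?thesis .
qed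

lemma noise_size_tail:
  assumes S: "S \<subseteq> {..<n}" and n: "0 < n" and m: "0 < m"
  shows "(\<integral>\<^sup>+e. indicator {e. m < noise_size n S e} e \<partial>noise_law n) \<le> ennreal (3 * real (card S) / m)"
proof -
  note [measurable] = measurable_noise_size[OF S]
  have "(\<integral>\<^sup>+e. indicator {e. m < noise_size n S e} e \<partial>noise_law n)
     \<le> (\<integral>\<^sup>+e. ennreal (1 / m) * ennreal (noise_size n S e) \<partial>noise_law n)"
  proof (intro nn_integral_mono)
    fix e
    show "indicator {e. m < noise_size n S e} e \<le> ennreal (1 / m) * ennreal (noise_size n S e)"
    proof (cases "m < noise_size n S e")
      case True
      then have "1 \<le> 1 / m * noise_size n S e" using m by (simp add: field_simps)
      from ennreal_leI[OF this] have "1 \<le> ennreal (1 / m * noise_size n S e)" by simp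
      also have "\<dots> = ennreal (1 / m) * ennreal (noise_size n S e)" using m by (intro ennreal_mult') simp
      finally show ?thesis using True by simp
    qed simp
  qed
  also have "\<dots> = ennreal (1 / m) * (\<integral>\<^sup>+e. ennreal (noise_size n S e) \<partial>noise_law n)"
    by (rule nn_integral_cmult) measurable
  also have "\<dots> \<le> ennreal (1 / m) * ennreal (3 * real (card S))"
    by (intro mult_left_mono nn_integral_noise_size S n) simp
  also have "\<dots> = ennreal (3 * real (card S) / m)"
    using m by (simp add: ennreal_mult'[symmetric])
  finally show ?thesis .
qed

context power_law_prior
begin

lemma nn_integral_evidence: "0 < \<tau> \<Longrightarrow> (\<integral>\<^sup>+y. evidence f \<tau> y \<partial>lborel) = 1"
proof -
  assume \<tau>: "0 < \<tau>"
  have "(\<integral>\<^sup>+y. evidence f \<tau> y \<partial>lborel) = (\<integral>\<^sup>+x. \<integral>\<^sup>+y. ennreal (\<phi> (y - x) * scaled f \<tau> x) \<partial>lborel \<partial>lborel)"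
    unfolding evidence_def by (rule lborel_pair.Fubini') measurable
  also have "\<dots> = (\<integral>\<^sup>+x. \<integral>\<^sup>+y. ennreal (\<phi> (y - x)) * ennreal (scaled f \<tau> x) \<partial>lborel \<partial>lborel)"
    by (simp add: ennreal_mult')
  also have "\<dots> = (\<integral>\<^sup>+x. ennreal (scaled f \<tau> x) \<partial>lborel)"
    by (simp add: nn_integral_multc nn_integral_phi_shift)
  also have "\<dots> = 1" by (rule nn_integral_scaled_1[OF \<tau>])
  finally show ?thesis .
qed

lemma evidence_le_1: "0 < \<tau> \<Longrightarrow> evidence f \<tau> y \<le> 1"
proof -
  assume \<tau>: "0 < \<tau>"
  have "evidence f \<tau> y \<le> (\<integral>\<^sup>+x. ennreal (scaled f \<tau> x) \<partial>lborel)"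
    unfolding evidence_def
    using phi_le_1 scaled_nonneg[OF \<tau>]
    by (intro nn_integral_mono ennreal_leI) (simp add: mult_left_le_one_le)
  then show ?thesis by (simp add: nn_integral_scaled_1[OF \<tau>])
qed

lemma measurable_null_ratio [measurable]:
  "(\<lambda>(e, \<tau>). null_ratio f n S \<tau> e) \<in> borel_measurable (leb n \<Otimes>\<^sub>M borel)"
proof -
  have [measurable]: "(\<lambda>z. evidence f (snd z) (fst z i)) \<in> borel_measurable (leb n \<Otimes>\<^sub>M borel)" if "i < n" for i
    using that measurable_compose[OF _ measurable_evidence(1)[OF measurable_f],
      of "\<lambda>z. (snd z, fst z i)" "leb n \<Otimes>\<^sub>M borel"] by simp
  have "(\<lambda>z. null_ratio f n S (snd z) (fst z)) \<in> borel_measurable (leb n \<Otimes>\<^sub>M borel)"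
    unfolding null_ratio_def by measurable
  then show ?thesis by (simp add: case_prod_beta')
qed

lemma nn_integral_null_ratio:
  assumes \<tau>: "0 < \<tau>"
  shows "(\<integral>\<^sup>+e. null_ratio f n S \<tau> e \<partial>noise_law n) = 1"
proof -
  have "(\<integral>\<^sup>+e. null_ratio f n S \<tau> e \<partial>noise_law n)
    = (\<integral>\<^sup>+e. (\<Prod>i<n. (\<lambda>x. if i \<in> S then 1 else evidence f \<tau> x / ennreal (\<phi> x)) (e i)) \<partial>noise_law n)"
    by (simp add: null_ratio_def)
  also have "\<dots> = (\<Prod>i<n. \<integral>\<^sup>+x. ennreal (\<phi> x) * (if i \<in> S then 1 else evidence f \<tau> x / ennreal (\<phi> x)) \<partial>lborel)"
    by (rule nn_integral_noise_prod) measurable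
  also have "\<dots> = (\<Prod>i<n. 1)"
  proof (intro prod.cong refl)
    fix i
    show "(\<integral>\<^sup>+x. ennreal (\<phi> x) * (if i \<in> S then 1 else evidence f \<tau> x / ennreal (\<phi> x)) \<partial>lborel) = 1"
      using nn_integral_evidence[OF \<tau>]
      by (cases "i \<in> S") (simp_all add: nn_integral_phi evidence_eq_ratio[symmetric])
  qed
  finally show ?thesis by simp
qed

end

section \<open>Bounds for a fixed sample size\<close>

text \<open>
  The one-dimensional bounds with their constants fixed as parameters, so that every estimate for the
  sparse model below is visibly uniform in \<open>n\<close>, in the signal and in the scale prior.
\<close>

locale power_law_estimates = power_law_prior +
  fixes K A\<^sub>1 A\<^sub>2 \<rho> C D p q B :: real
  assumes constants_pos: "0 < K" "0 < A\<^sub>1" "0 < A\<^sub>2" "0 < \<rho>" "0 < C" "0 < q" "0 < B"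
    and null_lower: "\<And>\<tau> \<delta> y. 0 < \<tau> \<Longrightarrow> 0 < \<delta> \<Longrightarrow>
      ennreal (\<phi> y * exp (- \<bar>y\<bar> * \<delta> - \<delta>\<^sup>2 / 2) * (1 - K * (\<tau> / \<delta>) powr (\<alpha> - 1))) \<le> evidence f \<tau> y"
    and signal_lower: "\<And>\<tau> u e. 0 < \<tau> \<Longrightarrow> \<tau> \<le> 1 \<Longrightarrow>
      ennreal (\<phi> e * exp (- A\<^sub>1 * (1 + \<bar>e\<bar>)) * \<tau> powr (\<alpha> - 1) * (1 + \<bar>u\<bar>) powr - \<alpha>) \<le> evidence f \<tau> (u + e)"
    and signal_upper: "\<And>\<tau> u e. 0 < \<tau> \<Longrightarrow> \<tau> \<le> 1 \<Longrightarrow>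
      (\<integral>\<^sup>+x. ennreal (exp (\<rho> / 2 * (x - u)\<^sup>2)) * ennreal (\<phi> (u + e - x) * scaled f \<tau> x) \<partial>lborel)
        \<le> ennreal (\<phi> e * exp (A\<^sub>2 * (1 + e\<^sup>2)) * (1 + \<bar>u\<bar>) powr - \<alpha>)"
    and null_upper: "\<And>\<tau> y. 0 < \<tau> \<Longrightarrow> \<tau> \<le> 1 \<Longrightarrow>
      null_moment f \<tau> y
        \<le> ennreal (C * \<tau> powr q * exp (D * \<bar>y\<bar> + p * y\<^sup>2 / 2)) * evidence f \<tau> y"
    and gaussian_moment: "(\<integral>\<^sup>+y. ennreal (exp (D * \<bar>y\<bar> + p * y\<^sup>2 / 2) * \<phi> y) \<partial>lborel) \<le> ennreal B"

text \<open>
  The parameter \<open>m\<close> is a budget for \<open>noise_size\<close>: the bounds hold when the noise stays below \<open>m\<close>. It is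
  later taken to be \<open>s * sqrt (ln (n / s))\<close>, large against \<open>s\<close> and small against \<open>s * ln (n / s)\<close>.
\<close>

locale sparse_experiment = power_law_estimates +
  fixes n :: nat and t :: "nat \<Rightarrow> real" and S :: "nat set" and r m :: real
  assumes S_eq: "S = {j. j < n \<and> t j \<noteq> 0}" and S_nonempty: "S \<noteq> {}"
    and r_eq: "r = real (card S) / real n" and r_small: "K * r \<le> 1 / 2"
    and card_le_m: "real (card S) \<le> m"
begin

lemma S_subset: "S \<subseteq> {..<n}" and finite_S [simp]: "finite S"
  by (auto simp: S_eq)

lemma t_null: "i < n \<Longrightarrow> i \<notin> S \<Longrightarrow> t i = 0"
  by (auto simp: S_eq)

lemma n_pos: "0 < n" using S_nonempty by (auto simp: S_eq)

lemma card_pos: "0 < real (card S)" using S_nonempty by (simp add: card_gt_0_iff)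

lemma m_pos: "0 < m" using card_pos card_le_m by linarith

lemma r_pos: "0 < r" using card_pos n_pos by (simp add: r_eq)

lemma r_le_1: "r \<le> 1"
proof -
  have "card S \<le> n" using card_mono[OF _ S_subset] by simp
  then show ?thesis using n_pos by (simp add: r_eq)
qed

lemma r_n: "r * real n = real (card S)" using n_pos by (simp add: r_eq)

definition top_scale :: real where "top_scale = r powr (\<alpha> / (\<alpha> - 1))"

lemma top_scale: "0 < top_scale" "top_scale \<le> 1" "(top_scale / r) powr (\<alpha> - 1) = r"
proof -
  show "0 < top_scale" using r_pos by (simp add: top_scale_def)
  show "top_scale \<le> 1" using r_pos r_le_1 \<alpha> by (simp add: top_scale_def powr_le1)
  have "top_scale / r = r powr (\<alpha> / (\<alpha> - 1) - 1)" using r_pos by (simp add: top_scale_def powr_diff)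
  also have "\<alpha> / (\<alpha> - 1) - 1 = 1 / (\<alpha> - 1)" using \<alpha> by (simp add: field_simps)
  finally show "(top_scale / r) powr (\<alpha> - 1) = r" using \<alpha> r_pos by (simp add: powr_powr)
qed

definition signal_penalty :: real where "signal_penalty = (\<Prod>i\<in>S. (1 + \<bar>t i\<bar>) powr - \<alpha>)"

lemma signal_penalty_pos: "0 < signal_penalty"
proof -
  have "1 + \<bar>t i\<bar> \<noteq> 0" for i using abs_ge_zero[of "t i"] by linarith
  then show ?thesis unfolding signal_penalty_def by (intro prod_pos) simp
qed

definition gauss_density :: "(nat \<Rightarrow> real) \<Rightarrow> real" where "gauss_density e = (\<Prod>i<n. \<phi> (e i))"

lemma gauss_density_pos: "0 < gauss_density e"
  unfolding gauss_density_def by (intro prod_pos) simp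

lemma noise_size_bounds:
  assumes "noise_size n S e \<le> m"
  shows "(\<Sum>i\<in>S. \<bar>e i\<bar>) \<le> m" "(\<Sum>i\<in>S. (e i)\<^sup>2) \<le> m" "r * (\<Sum>i\<in>{..<n} - S. \<bar>e i\<bar>) \<le> m"
proof -
  have "noise_size n S e = r * (\<Sum>i<n. \<bar>e i\<bar>) + ((\<Sum>i\<in>S. (e i)\<^sup>2) + (\<Sum>i\<in>S. \<bar>e i\<bar>))"
    by (simp add: noise_size_def r_eq sum.distrib)
  moreover have "0 \<le> r * (\<Sum>i<n. \<bar>e i\<bar>)" "0 \<le> (\<Sum>i\<in>S. (e i)\<^sup>2)" "0 \<le> (\<Sum>i\<in>S. \<bar>e i\<bar>)"
    using r_pos by (auto intro!: mult_nonneg_nonneg sum_nonneg)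
  moreover have "r * (\<Sum>i\<in>{..<n} - S. \<bar>e i\<bar>) \<le> r * (\<Sum>i<n. \<bar>e i\<bar>)"
    using r_pos by (intro mult_left_mono sum_mono2) auto
  ultimately show "(\<Sum>i\<in>S. \<bar>e i\<bar>) \<le> m" "(\<Sum>i\<in>S. (e i)\<^sup>2) \<le> m" "r * (\<Sum>i\<in>{..<n} - S. \<bar>e i\<bar>) \<le> m"
    using assms by linarith+
qed

lemma coordinate_evidence_lower:
  assumes i: "i < n" and tau: "r powr (\<beta> / (\<alpha> - 1)) \<le> \<tau>" "\<tau> \<le> top_scale"
  shows "ennreal (\<phi> (e i) * (if i \<in> S then exp (- A\<^sub>1 * (1 + \<bar>e i\<bar>)) * r powr \<beta> * (1 + \<bar>t i\<bar>) powr - \<alpha>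
            else exp (- (r * \<bar>e i\<bar> + (1 + 2 * K) * r)))) \<le> evidence f \<tau> (t i + e i)"
proof -
  have "0 < r powr (\<beta> / (\<alpha> - 1))" using r_pos by simp
  then have \<tau>: "0 < \<tau>" "\<tau> \<le> 1" using tau top_scale(2) by linarith+
  show ?thesis
  proof (cases "i \<in> S")
    case True
    have "r powr \<beta> = (r powr (\<beta> / (\<alpha> - 1))) powr (\<alpha> - 1)" using \<alpha> by (simp add: powr_powr)
    also have "\<dots> \<le> \<tau> powr (\<alpha> - 1)" using tau \<alpha> by (intro powr_mono2) auto
    finally have "\<phi> (e i) * exp (- A\<^sub>1 * (1 + \<bar>e i\<bar>)) * r powr \<beta> * (1 + \<bar>t i\<bar>) powr - \<alpha>
       \<le> \<phi> (e i) * exp (- A\<^sub>1 * (1 + \<bar>e i\<bar>)) * \<tau> powr (\<alpha> - 1) * (1 + \<bar>t i\<bar>) powr - \<alpha>"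
      by (intro mult_right_mono mult_left_mono) auto
    from ennreal_leI[OF this] signal_lower[OF \<tau>, of "e i" "t i"]
    have "ennreal (\<phi> (e i) * exp (- A\<^sub>1 * (1 + \<bar>e i\<bar>)) * r powr \<beta> * (1 + \<bar>t i\<bar>) powr - \<alpha>) \<le> evidence f \<tau> (t i + e i)"
      by (rule order_trans)
    then show ?thesis using True by (simp only: if_True mult.assoc)
  next
    case False
    have "K * (\<tau> / r) powr (\<alpha> - 1) \<le> K * (top_scale / r) powr (\<alpha> - 1)"
      using tau \<tau> r_pos \<alpha> constants_pos by (intro mult_left_mono powr_mono2 divide_right_mono) auto
    also have "\<dots> = K * r" by (simp add: top_scale(3))
    finally have "1 - K * r \<le> 1 - K * (\<tau> / r) powr (\<alpha> - 1)" by simp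
    moreover have "exp (- 2 * (K * r)) \<le> 1 - K * r"
      using r_pos r_small constants_pos by (intro exp_le_one_minus) auto
    ultimately have k: "exp (- 2 * (K * r)) \<le> 1 - K * (\<tau> / r) powr (\<alpha> - 1)" by linarith
    have "r\<^sup>2 / 2 \<le> r" using r_pos r_le_1 mult_left_mono[of r 1 r] by (simp add: power2_eq_square)
    then have "- (r * \<bar>e i\<bar> + (1 + 2 * K) * r) \<le> (- \<bar>e i\<bar> * r - r\<^sup>2 / 2) + - 2 * (K * r)"
      by (simp add: algebra_simps)
    then have "exp (- (r * \<bar>e i\<bar> + (1 + 2 * K) * r)) \<le> exp (- \<bar>e i\<bar> * r - r\<^sup>2 / 2) * exp (- 2 * (K * r))"
      by (simp only: exp_add[symmetric] exp_le_cancel_iff)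
    also have "\<dots> \<le> exp (- \<bar>e i\<bar> * r - r\<^sup>2 / 2) * (1 - K * (\<tau> / r) powr (\<alpha> - 1))"
      by (intro mult_left_mono k) simp
    finally have "\<phi> (e i) * exp (- (r * \<bar>e i\<bar> + (1 + 2 * K) * r))
       \<le> \<phi> (e i) * exp (- \<bar>e i\<bar> * r - r\<^sup>2 / 2) * (1 - K * (\<tau> / r) powr (\<alpha> - 1))"
      unfolding mult.assoc by (rule mult_left_mono) simp
    from order_trans[OF ennreal_leI[OF this] null_lower[OF \<tau>(1) r_pos]]
    show ?thesis using False i by (simp add: t_null)
  qed
qed

text \<open>
  The product of the coordinatewise bounds. Besides the noise term \<open>r |e i|\<close>, which the budget covers, each null
  coordinate loses \<open>(1 + 2 K) r\<close> in the exponent, hence \<open>O(s)\<close> in total because \<open>r n = s\<close>.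
\<close>

lemma joint_evidence_lower:
  assumes tau: "r powr (\<beta> / (\<alpha> - 1)) \<le> \<tau>" "\<tau> \<le> top_scale" and e: "noise_size n S e \<le> m"
  shows "ennreal (exp (- (2 * A\<^sub>1 + 2 + 2 * K) * m) * r powr (\<beta> * real (card S)) * signal_penalty * gauss_density e)
    \<le> (\<Prod>i<n. evidence f \<tau> (t i + e i))"
proof -
  define a where "a i = exp (- A\<^sub>1 * (1 + \<bar>e i\<bar>))" for i
  define b where "b i = exp (- (r * \<bar>e i\<bar> + (1 + 2 * K) * r))" for i
  have eq: "(\<Prod>i<n. \<phi> (e i) * (if i \<in> S then a i * r powr \<beta> * (1 + \<bar>t i\<bar>) powr - \<alpha> else b i))
     = (\<Prod>i\<in>S. a i) * (\<Prod>i\<in>{..<n} - S. b i) * r powr (\<beta> * real (card S)) * signal_penalty * gauss_density e"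
    unfolding prod.distrib prod_if_split[OF S_subset] gauss_density_def signal_penalty_def
    using r_pos by (simp add: powr_powr[symmetric] powr_realpow)
  have "(\<Prod>i\<in>S. a i) * (\<Prod>i\<in>{..<n} - S. b i)
     = exp ((\<Sum>i\<in>S. - A\<^sub>1 * (1 + \<bar>e i\<bar>)) + (\<Sum>i\<in>{..<n} - S. - (r * \<bar>e i\<bar> + (1 + 2 * K) * r)))"
    by (simp only: a_def b_def exp_add exp_sum[OF finite_S] exp_sum[OF finite_Diff[OF finite_lessThan]])
  moreover have "- (2 * A\<^sub>1 + 2 + 2 * K) * m
      \<le> (\<Sum>i\<in>S. - A\<^sub>1 * (1 + \<bar>e i\<bar>)) + (\<Sum>i\<in>{..<n} - S. - (r * \<bar>e i\<bar> + (1 + 2 * K) * r))"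
  proof -
    have "(\<Sum>i\<in>S. - A\<^sub>1 * (1 + \<bar>e i\<bar>)) = - A\<^sub>1 * (real (card S) + (\<Sum>i\<in>S. \<bar>e i\<bar>))"
      by (simp only: sum_distrib_left[symmetric] sum.distrib) simp
    moreover have "A\<^sub>1 * (real (card S) + (\<Sum>i\<in>S. \<bar>e i\<bar>)) \<le> A\<^sub>1 * (m + m)"
      using constants_pos card_le_m noise_size_bounds(1)[OF e] by (intro mult_left_mono add_mono) auto
    moreover have "(\<Sum>i\<in>{..<n} - S. - (r * \<bar>e i\<bar> + (1 + 2 * K) * r))
        = - (r * (\<Sum>i\<in>{..<n} - S. \<bar>e i\<bar>) + (1 + 2 * K) * (r * real (card ({..<n} - S))))"
      by (simp only: sum_negf sum.distrib sum_distrib_left[symmetric]) (simp add: algebra_simps)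
    moreover have "(1 + 2 * K) * (r * real (card ({..<n} - S))) \<le> (1 + 2 * K) * m"
    proof (intro mult_left_mono)
      have "card ({..<n} - S) \<le> n" using card_mono[of "{..<n}" "{..<n} - S"] by auto
      then have "r * real (card ({..<n} - S)) \<le> r * real n" using r_pos by (intro mult_left_mono) auto
      then show "r * real (card ({..<n} - S)) \<le> m" using r_n card_le_m by linarith
    qed (use constants_pos in auto)
    moreover have "(2 * A\<^sub>1 + 2 + 2 * K) * m = A\<^sub>1 * (m + m) + (m + (1 + 2 * K) * m)"
      by (simp add: algebra_simps)
    ultimately show ?thesis using noise_size_bounds(3)[OF e] by linarith
  qed
  ultimately have ab: "exp (- (2 * A\<^sub>1 + 2 + 2 * K) * m) \<le> (\<Prod>i\<in>S. a i) * (\<Prod>i\<in>{..<n} - S. b i)"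
    by simp
  have "exp (- (2 * A\<^sub>1 + 2 + 2 * K) * m) * r powr (\<beta> * real (card S)) * signal_penalty * gauss_density e
     \<le> (\<Prod>i\<in>S. a i) * (\<Prod>i\<in>{..<n} - S. b i) * r powr (\<beta> * real (card S)) * signal_penalty * gauss_density e"
    using signal_penalty_pos gauss_density_pos[of e] by (intro mult_right_mono ab) auto
  also have "\<dots> = (\<Prod>i<n. \<phi> (e i) * (if i \<in> S then a i * r powr \<beta> * (1 + \<bar>t i\<bar>) powr - \<alpha> else b i))"
    by (rule eq[symmetric])
  finally have "ennreal (exp (- (2 * A\<^sub>1 + 2 + 2 * K) * m) * r powr (\<beta> * real (card S)) * signal_penalty * gauss_density e)
     \<le> ennreal (\<Prod>i<n. \<phi> (e i) * (if i \<in> S then a i * r powr \<beta> * (1 + \<bar>t i\<bar>) powr - \<alpha> else b i))"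
    by (rule ennreal_leI)
  also have "\<dots> = (\<Prod>i<n. ennreal (\<phi> (e i) * (if i \<in> S then a i * r powr \<beta> * (1 + \<bar>t i\<bar>) powr - \<alpha> else b i)))"
    by (rule prod_ennreal[symmetric]) (auto simp: a_def b_def)
  also have "\<dots> \<le> (\<Prod>i<n. evidence f \<tau> (t i + e i))"
    unfolding a_def b_def using tau by (intro prod_mono_ennreal coordinate_evidence_lower) auto
  finally show ?thesis .
qed

lemma prod_le_null_ratio:
  assumes "\<And>i. i < n \<Longrightarrow> i \<in> S \<Longrightarrow> v i \<le> ennreal (\<phi> (e i) * c i)"
    and "\<And>i. i < n \<Longrightarrow> i \<notin> S \<Longrightarrow> v i \<le> evidence f \<tau> (e i)"
    and c: "\<And>i. 0 \<le> c i"
  shows "(\<Prod>i<n. v i) \<le> ennreal ((\<Prod>i\<in>S. c i) * gauss_density e) * null_ratio f n S \<tau> e"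
proof -
  have "(\<Prod>i<n. v i) \<le> (\<Prod>i<n. ennreal (\<phi> (e i)) * (if i \<in> S then ennreal (c i) else 1)
      * (if i \<in> S then 1 else evidence f \<tau> (e i) / ennreal (\<phi> (e i))))"
  proof (intro prod_mono_ennreal)
    fix i assume "i \<in> {..<n}"
    then show "v i \<le> ennreal (\<phi> (e i)) * (if i \<in> S then ennreal (c i) else 1)
      * (if i \<in> S then 1 else evidence f \<tau> (e i) / ennreal (\<phi> (e i)))"
      using assms(1,2)[of i] by (cases "i \<in> S") (simp_all add: ennreal_mult' evidence_eq_ratio[symmetric])
  qed
  also have "\<dots> = (\<Prod>i<n. ennreal (\<phi> (e i))) * (\<Prod>i<n. if i \<in> S then ennreal (c i) else 1) * null_ratio f n S \<tau> e"
    by (simp only: prod.distrib null_ratio_def)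
  also have "(\<Prod>i<n. if i \<in> S then ennreal (c i) else 1) = ennreal (\<Prod>i\<in>S. c i)"
    unfolding prod_if_split[OF S_subset] using c by (simp add: prod_ennreal)
  also have "(\<Prod>i<n. ennreal (\<phi> (e i))) = ennreal (gauss_density e)"
    unfolding gauss_density_def by (rule prod_ennreal) simp
  also have "ennreal (gauss_density e) * ennreal (\<Prod>i\<in>S. c i) = ennreal ((\<Prod>i\<in>S. c i) * gauss_density e)"
    using gauss_density_pos[of e] by (simp add: ennreal_mult'' mult.commute)
  finally show ?thesis .
qed

text \<open>
  On the support the evidence is bounded by one, hence by \<open>\<phi> (e i)\<close> up to a factor within the noise
  budget. This crude bound serves the scales above the window.
\<close>

lemma total_evidence_upper:
  assumes \<tau>: "0 < \<tau>" and e: "noise_size n S e \<le> m"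
  shows "(\<Prod>i<n. evidence f \<tau> (t i + e i)) \<le> ennreal (exp (3 * m) * gauss_density e) * null_ratio f n S \<tau> e"
proof -
  have "(\<Prod>i<n. evidence f \<tau> (t i + e i))
     \<le> ennreal ((\<Prod>i\<in>S. exp (2 + (e i)\<^sup>2 / 2)) * gauss_density e) * null_ratio f n S \<tau> e"
  proof (rule prod_le_null_ratio)
    fix i
    show "evidence f \<tau> (t i + e i) \<le> ennreal (\<phi> (e i) * exp (2 + (e i)\<^sup>2 / 2))"
      using order_trans[OF evidence_le_1[OF \<tau>]] ennreal_leI[OF one_le_phi[of "e i"]] by (simp only: ennreal_1)
  qed (auto simp: t_null)
  also have "\<dots> \<le> ennreal (exp (3 * m) * gauss_density e) * null_ratio f n S \<tau> e"
  proof (intro mult_right_mono ennreal_leI)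
    have "(\<Prod>i\<in>S. exp (2 + (e i)\<^sup>2 / 2)) = exp (2 * real (card S) + (\<Sum>i\<in>S. (e i)\<^sup>2) / 2)"
      by (simp add: exp_sum[symmetric] sum.distrib sum_divide_distrib)
    also have "\<dots> \<le> exp (3 * m)"
      using noise_size_bounds(2)[OF e] card_le_m m_pos unfolding exp_le_cancel_iff by linarith
    finally show "(\<Prod>i\<in>S. exp (2 + (e i)\<^sup>2 / 2)) \<le> exp (3 * m)" .
  qed (use gauss_density_pos[of e] in auto)
  finally show ?thesis .
qed

text \<open>
  Chernoff's inequality: the indicator of the event is at most \<open>exp (\<rho> / 2 * (error - b))\<close>, a product over
  coordinates, to which \<open>signal_upper\<close> applies factor by factor.
\<close>

lemma signal_error_upper:
  assumes \<tau>: "0 < \<tau>" "\<tau> \<le> 1" and e: "noise_size n S e \<le> m"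
  shows "weighted_evidence f n \<tau> (\<lambda>i. t i + e i) (indicator {x \<in> space (leb n). b \<le> (\<Sum>i\<in>S. (x i - t i)\<^sup>2)})
    \<le> ennreal (exp (2 * A\<^sub>2 * m - \<rho> / 2 * b) * signal_penalty * gauss_density e) * null_ratio f n S \<tau> e"
proof -
  define g where "g i x = (if i \<in> S then ennreal (exp (\<rho> / 2 * (x - t i)\<^sup>2)) else 1)" for i x
  have [measurable]: "g i \<in> borel_measurable borel" for i unfolding g_def by measurable
  define c where "c i = exp (A\<^sub>2 * (1 + (e i)\<^sup>2)) * (1 + \<bar>t i\<bar>) powr - \<alpha>" for i
  have "weighted_evidence f n \<tau> (\<lambda>i. t i + e i) (indicator {x \<in> space (leb n). b \<le> (\<Sum>i\<in>S. (x i - t i)\<^sup>2)})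
    \<le> weighted_evidence f n \<tau> (\<lambda>i. t i + e i) (\<lambda>x. ennreal (exp (- (\<rho> / 2 * b))) * (\<Prod>i<n. g i (x i)))"
  proof (intro weighted_evidence_mono)
    fix x :: "nat \<Rightarrow> real"
    have g: "(\<Prod>i<n. g i (x i)) = ennreal (exp (\<rho> / 2 * (\<Sum>i\<in>S. (x i - t i)\<^sup>2)))"
      unfolding g_def prod_if_split[OF S_subset]
      by (simp add: prod_ennreal exp_sum[symmetric] sum_distrib_left sum_divide_distrib)
    show "indicator {x \<in> space (leb n). b \<le> (\<Sum>i\<in>S. (x i - t i)\<^sup>2)} x \<le> ennreal (exp (- (\<rho> / 2 * b))) * (\<Prod>i<n. g i (x i))"
    proof (cases "b \<le> (\<Sum>i\<in>S. (x i - t i)\<^sup>2)")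
      case True
      then have "\<rho> / 2 * b \<le> \<rho> / 2 * (\<Sum>i\<in>S. (x i - t i)\<^sup>2)" using constants_pos by (intro mult_left_mono) auto
      then have "1 \<le> exp (- (\<rho> / 2 * b) + \<rho> / 2 * (\<Sum>i\<in>S. (x i - t i)\<^sup>2))" unfolding one_le_exp_iff by linarith
      then have "ennreal 1 \<le> ennreal (exp (- (\<rho> / 2 * b)) * exp (\<rho> / 2 * (\<Sum>i\<in>S. (x i - t i)\<^sup>2)))"
        unfolding exp_add by (rule ennreal_leI)
      also have "\<dots> = ennreal (exp (- (\<rho> / 2 * b))) * (\<Prod>i<n. g i (x i))"
        unfolding g by (rule ennreal_mult') simp
      finally show ?thesis by (auto simp: indicator_def)
    qed simp
  qed
  also have "\<dots> = ennreal (exp (- (\<rho> / 2 * b)))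
      * (\<Prod>i<n. \<integral>\<^sup>+x. g i x * ennreal (\<phi> (t i + e i - x) * scaled f \<tau> x) \<partial>lborel)"
    by (subst weighted_evidence_cmult, measurable) (subst weighted_evidence_prod, auto)
  also have "\<dots> \<le> ennreal (exp (- (\<rho> / 2 * b))) * (ennreal ((\<Prod>i\<in>S. c i) * gauss_density e) * null_ratio f n S \<tau> e)"
  proof (intro mult_left_mono prod_le_null_ratio)
    fix i assume "i < n" "i \<in> S"
    then show "(\<integral>\<^sup>+x. g i x * ennreal (\<phi> (t i + e i - x) * scaled f \<tau> x) \<partial>lborel) \<le> ennreal (\<phi> (e i) * c i)"
      using signal_upper[OF \<tau>, of "t i" "e i"] by (simp add: g_def c_def mult.assoc)
  next
    fix i assume "i < n" "i \<notin> S"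
    then show "(\<integral>\<^sup>+x. g i x * ennreal (\<phi> (t i + e i - x) * scaled f \<tau> x) \<partial>lborel) \<le> evidence f \<tau> (e i)"
      by (simp add: g_def t_null evidence_def)
  qed (auto simp: c_def)
  also have "\<dots> = ennreal (exp (- (\<rho> / 2 * b)) * ((\<Prod>i\<in>S. c i) * gauss_density e)) * null_ratio f n S \<tau> e"
    by (simp only: ennreal_mult'[OF exp_ge_zero] mult.assoc)
  also have "\<dots> \<le> ennreal (exp (2 * A\<^sub>2 * m - \<rho> / 2 * b) * signal_penalty * gauss_density e) * null_ratio f n S \<tau> e"
  proof (intro mult_right_mono ennreal_leI)
    have "(\<Prod>i\<in>S. c i) = exp (A\<^sub>2 * (real (card S) + (\<Sum>i\<in>S. (e i)\<^sup>2))) * signal_penalty"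
      unfolding c_def prod.distrib signal_penalty_def
      by (simp add: exp_sum[symmetric] sum_distrib_left[symmetric] sum.distrib)
    moreover have "exp (A\<^sub>2 * (real (card S) + (\<Sum>i\<in>S. (e i)\<^sup>2))) \<le> exp (2 * A\<^sub>2 * m)"
    proof -
      have "A\<^sub>2 * (real (card S) + (\<Sum>i\<in>S. (e i)\<^sup>2)) \<le> A\<^sub>2 * (m + m)"
        using constants_pos card_le_m noise_size_bounds(2)[OF e] by (intro mult_left_mono add_mono) auto
      then show ?thesis by simp
    qed
    ultimately have c: "(\<Prod>i\<in>S. c i) \<le> exp (2 * A\<^sub>2 * m) * signal_penalty"
      using signal_penalty_pos by (simp add: mult_right_mono)
    have "exp (- (\<rho> / 2 * b)) * ((\<Prod>i\<in>S. c i) * gauss_density e)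
       \<le> exp (- (\<rho> / 2 * b)) * ((exp (2 * A\<^sub>2 * m) * signal_penalty) * gauss_density e)"
      using gauss_density_pos[of e] by (intro mult_left_mono mult_right_mono c) auto
    also have "\<dots> = exp (2 * A\<^sub>2 * m + - (\<rho> / 2 * b)) * signal_penalty * gauss_density e"
      unfolding exp_add by (simp only: mult_ac)
    finally show "exp (- (\<rho> / 2 * b)) * ((\<Prod>i\<in>S. c i) * gauss_density e)
       \<le> exp (2 * A\<^sub>2 * m - \<rho> / 2 * b) * signal_penalty * gauss_density e" by simp
  qed auto
  finally show ?thesis .
qed

text \<open>
  A bound for the total conditional mean of \<open>x\<^sup>2 + |x|\<close> over the null coordinates, valid for all scales
  up to \<open>top_scale\<close> at once.
\<close>

definition null_cost :: "(nat \<Rightarrow> real) \<Rightarrow> real" where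
  "null_cost e = C * top_scale powr q * (\<Sum>i\<in>{..<n} - S. exp (D * \<bar>e i\<bar> + p * (e i)\<^sup>2 / 2))"

text \<open>
  Markov's inequality for the posterior given \<open>\<tau>\<close>. The bound is relative to the evidence at the same
  \<open>\<tau>\<close> and its constant does not depend on \<open>\<tau>\<close>, so it survives mixing over \<open>\<tau>\<close> with any weights.
\<close>

lemma null_error_upper:
  assumes \<tau>: "0 < \<tau>" "\<tau> \<le> top_scale" and b: "0 < b"
  shows "weighted_evidence f n \<tau> (\<lambda>i. t i + e i)
      (indicator {x \<in> space (leb n). b \<le> (\<Sum>i\<in>{..<n} - S. (x i)\<^sup>2 + \<bar>x i\<bar>)})
    \<le> ennreal (null_cost e / b) * (\<Prod>i<n. evidence f \<tau> (t i + e i))"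
proof -
  have \<tau>1: "\<tau> \<le> 1" using \<tau> top_scale by linarith
  define h where "h i = exp (D * \<bar>e i\<bar> + p * (e i)\<^sup>2 / 2)" for i
  define E where "E = (\<Prod>i<n. evidence f \<tau> (t i + e i))"
  have "weighted_evidence f n \<tau> (\<lambda>i. t i + e i)
      (indicator {x \<in> space (leb n). b \<le> (\<Sum>i\<in>{..<n} - S. (x i)\<^sup>2 + \<bar>x i\<bar>)})
    \<le> weighted_evidence f n \<tau> (\<lambda>i. t i + e i) (\<lambda>x. ennreal (1 / b) * (\<Sum>i\<in>{..<n} - S. ennreal ((x i)\<^sup>2 + \<bar>x i\<bar>)))"
  proof (intro weighted_evidence_mono)
    fix x :: "nat \<Rightarrow> real"
    define u where "u = (\<Sum>i\<in>{..<n} - S. (x i)\<^sup>2 + \<bar>x i\<bar>)"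
    have u: "(\<Sum>i\<in>{..<n} - S. ennreal ((x i)\<^sup>2 + \<bar>x i\<bar>)) = ennreal u"
      unfolding u_def by (rule sum_ennreal) simp
    show "indicator {x \<in> space (leb n). b \<le> (\<Sum>i\<in>{..<n} - S. (x i)\<^sup>2 + \<bar>x i\<bar>)} x
      \<le> ennreal (1 / b) * (\<Sum>i\<in>{..<n} - S. ennreal ((x i)\<^sup>2 + \<bar>x i\<bar>))"
    proof (cases "b \<le> u")
      case True
      then have "1 \<le> 1 / b * u" using b by (simp add: field_simps)
      from ennreal_leI[OF this] have "1 \<le> ennreal (1 / b * u)" by simp
      also have "\<dots> = ennreal (1 / b) * ennreal u" using b by (intro ennreal_mult') simp
      finally show ?thesis unfolding u by (auto simp: indicator_def)
    qed (simp add: u_def)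
  qed
  also have "\<dots> = ennreal (1 / b) * (\<Sum>i\<in>{..<n} - S. weighted_evidence f n \<tau> (\<lambda>i. t i + e i) (\<lambda>x. ennreal ((x i)\<^sup>2 + \<bar>x i\<bar>)))"
    by (subst weighted_evidence_cmult, measurable) (subst weighted_evidence_sum, auto)
  also have "\<dots> \<le> ennreal (1 / b) * (\<Sum>i\<in>{..<n} - S. ennreal (C * top_scale powr q * h i) * E)"
  proof (intro mult_left_mono sum_mono)
    fix i assume i: "i \<in> {..<n} - S"
    have le: "C * \<tau> powr q * h i \<le> C * top_scale powr q * h i"
      using \<tau> constants_pos by (intro mult_right_mono mult_left_mono powr_mono2) (auto simp: h_def)
    have "weighted_evidence f n \<tau> (\<lambda>i. t i + e i) (\<lambda>x. ennreal ((x i)\<^sup>2 + \<bar>x i\<bar>))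
       = null_moment f \<tau> (e i)
          * (\<Prod>j\<in>{..<n} - {i}. evidence f \<tau> (t j + e j))"
      using i weighted_evidence_single[OF measurable_f, of "\<lambda>x. ennreal (x\<^sup>2 + \<bar>x\<bar>)" i n \<tau> "\<lambda>i. t i + e i"]
      by (simp add: t_null)
    also have "\<dots> \<le> (ennreal (C * top_scale powr q * h i) * evidence f \<tau> (t i + e i))
          * (\<Prod>j\<in>{..<n} - {i}. evidence f \<tau> (t j + e j))"
    proof (intro mult_right_mono)
      have "null_moment f \<tau> (e i)
         \<le> ennreal (C * \<tau> powr q * h i) * evidence f \<tau> (e i)"
        unfolding h_def by (rule null_upper[OF \<tau>(1) \<tau>1])
      also have "\<dots> \<le> ennreal (C * top_scale powr q * h i) * evidence f \<tau> (e i)"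
        by (intro mult_right_mono ennreal_leI le) simp
      finally show "null_moment f \<tau> (e i)
         \<le> ennreal (C * top_scale powr q * h i) * evidence f \<tau> (t i + e i)"
        using i by (simp add: t_null)
    qed simp
    also have "\<dots> = ennreal (C * top_scale powr q * h i) * E"
      unfolding E_def using i by (subst prod.remove[of _ i]) (auto simp: mult.assoc)
    finally show "weighted_evidence f n \<tau> (\<lambda>i. t i + e i) (\<lambda>x. ennreal ((x i)\<^sup>2 + \<bar>x i\<bar>))
       \<le> ennreal (C * top_scale powr q * h i) * E" .
  qed simp
  also have "(\<Sum>i\<in>{..<n} - S. ennreal (C * top_scale powr q * h i) * E) = ennreal (null_cost e) * E"
  proof -
    have "(\<Sum>i\<in>{..<n} - S. ennreal (C * top_scale powr q * h i)) = ennreal (\<Sum>i\<in>{..<n} - S. C * top_scale powr q * h i)"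
      using constants_pos by (intro sum_ennreal) (simp add: h_def)
    then show ?thesis by (simp only: sum_distrib_right[symmetric] sum_distrib_left[symmetric] null_cost_def h_def)
  qed
  also have "ennreal (1 / b) * (ennreal (null_cost e) * E) = ennreal (null_cost e / b) * E"
  proof -
    have "ennreal (1 / b * null_cost e) = ennreal (1 / b) * ennreal (null_cost e)"
      using b by (intro ennreal_mult') simp
    then show ?thesis by (simp add: mult.assoc)
  qed
  finally show ?thesis by (simp add: E_def)
qed

text \<open>
  The lower bound for the normalising constant of the posterior, relative to \<open>gauss_density\<close>.
\<close>

definition evidence_floor :: "real measure \<Rightarrow> real \<Rightarrow> real" where
  "evidence_floor P \<beta> = measure P {r powr (\<beta> / (\<alpha> - 1)) .. top_scale}
     * (exp (- (2 * A\<^sub>1 + 2 + 2 * K) * m) * r powr (\<beta> * real (card S)) * signal_penalty)"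

definition bad_set :: "real \<Rightarrow> real \<Rightarrow> (nat \<Rightarrow> real) set" where
  "bad_set b b' = {x \<in> space (leb n). b \<le> (\<Sum>i\<in>S. (x i - t i)\<^sup>2)} \<union>
     {x \<in> space (leb n). b' \<le> (\<Sum>i\<in>{..<n} - S. (x i)\<^sup>2 + \<bar>x i\<bar>)}"

lemma measurable_signal_error [measurable]:
  "(\<lambda>x. \<Sum>i\<in>S. (x i - t i)\<^sup>2) \<in> borel_measurable (leb n)"
  using S_subset by (rule measurable_coordinate_sum) measurable

lemma measurable_null_error [measurable]:
  "(\<lambda>x. \<Sum>i\<in>{..<n} - S. (x i)\<^sup>2 + \<bar>x i\<bar>) \<in> borel_measurable (leb n)"
  by (rule measurable_coordinate_sum) (auto, measurable)

lemma sets_bad_set [measurable]: "bad_set b b' \<in> sets (leb n)"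
  unfolding bad_set_def by measurable

declare measurable_noise_size[OF S_subset, measurable]

lemma measurable_null_cost [measurable]: "null_cost \<in> borel_measurable (leb n)"
proof -
  have [measurable]: "(\<lambda>e. \<Sum>i\<in>{..<n} - S. exp (D * \<bar>e i\<bar> + p * (e i)\<^sup>2 / 2)) \<in> borel_measurable (leb n)"
    by (rule measurable_coordinate_sum) (auto, measurable)
  show ?thesis unfolding null_cost_def by measurable
qed

lemma evidence_floor_pos:
  assumes "0 < measure P {r powr (\<beta> / (\<alpha> - 1)) .. top_scale}"
  shows "0 < evidence_floor P \<beta>"
  using assms signal_penalty_pos r_pos by (simp add: evidence_floor_def)

lemma total_evidence_lower:
  assumes P: "is_scale_prior P" and e: "noise_size n S e \<le> m"
  shows "ennreal (evidence_floor P \<beta> * gauss_density e)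
    \<le> (\<integral>\<^sup>+\<tau>. (\<Prod>i<n. evidence f \<tau> (t i + e i)) \<partial>P)"
proof -
  interpret prob_space P using P by (simp add: is_scale_prior_def)
  have [measurable_cong]: "sets P = sets borel" using P by (simp add: is_scale_prior_def)
  define I where "I = {r powr (\<beta> / (\<alpha> - 1)) .. top_scale}"
  have I: "I \<in> sets P" by (simp add: I_def)
  define v where "v = exp (- (2 * A\<^sub>1 + 2 + 2 * K) * m) * r powr (\<beta> * real (card S)) * signal_penalty * gauss_density e"
  have v: "0 \<le> v" using signal_penalty_pos gauss_density_pos[of e] by (simp add: v_def)
  have "ennreal (evidence_floor P \<beta> * gauss_density e) = ennreal (v * measure P I)"
    unfolding evidence_floor_def I_def[symmetric] v_def by (simp only: mult_ac)
  also have "\<dots> = ennreal v * emeasure P I" by (simp only: ennreal_mult'[OF v] emeasure_eq_measure)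
  also have "\<dots> = (\<integral>\<^sup>+\<tau>. ennreal v * indicator I \<tau> \<partial>P)" using I by (simp add: nn_integral_cmult)
  also have "\<dots> \<le> (\<integral>\<^sup>+\<tau>. (\<Prod>i<n. evidence f \<tau> (t i + e i)) \<partial>P)"
    using joint_evidence_lower[of \<beta> _ e, OF _ _ e]
    by (intro nn_integral_mono) (auto simp: indicator_def v_def I_def)
  finally show ?thesis .
qed

lemma bad_weighted_evidence_upper:
  assumes \<tau>: "0 < \<tau>" and e: "noise_size n S e \<le> m" and b': "0 < b'"
  shows "weighted_evidence f n \<tau> (\<lambda>i. t i + e i) (indicator (bad_set b b'))
    \<le> ennreal (exp (3 * m) * gauss_density e) * (indicator {top_scale<..} \<tau> * null_ratio f n S \<tau> e)
      + ennreal (exp (2 * A\<^sub>2 * m - \<rho> / 2 * b) * signal_penalty * gauss_density e) * null_ratio f n S \<tau> e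
      + ennreal (null_cost e / b') * (\<Prod>i<n. evidence f \<tau> (t i + e i))"
proof (cases "top_scale < \<tau>")
  case True
  have "weighted_evidence f n \<tau> (\<lambda>i. t i + e i) (indicator (bad_set b b'))
     \<le> weighted_evidence f n \<tau> (\<lambda>i. t i + e i) (\<lambda>_. 1)"
    by (intro weighted_evidence_mono) (simp add: indicator_def)
  also have "\<dots> = (\<Prod>i<n. evidence f \<tau> (t i + e i))" by (rule weighted_evidence_1[OF measurable_f])
  also have "\<dots> \<le> ennreal (exp (3 * m) * gauss_density e) * null_ratio f n S \<tau> e"
    by (rule total_evidence_upper[OF \<tau> e])
  finally show ?thesis using True by (simp add: add.assoc add_increasing2)
next
  case False
  define BS where "BS = {x \<in> space (leb n). b \<le> (\<Sum>i\<in>S. (x i - t i)\<^sup>2)}"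
  define BN where "BN = {x \<in> space (leb n). b' \<le> (\<Sum>i\<in>{..<n} - S. (x i)\<^sup>2 + \<bar>x i\<bar>)}"
  have [measurable]: "BS \<in> sets (leb n)" "BN \<in> sets (leb n)" unfolding BS_def BN_def by measurable
  have le: "\<tau> \<le> top_scale" "\<tau> \<le> 1" using False top_scale(2) by linarith+
  have "weighted_evidence f n \<tau> (\<lambda>i. t i + e i) (indicator (bad_set b b'))
     \<le> weighted_evidence f n \<tau> (\<lambda>i. t i + e i) (\<lambda>x. indicator BS x + indicator BN x)"
    by (intro weighted_evidence_mono) (auto simp: indicator_def bad_set_def BS_def BN_def)
  also have "\<dots> = weighted_evidence f n \<tau> (\<lambda>i. t i + e i) (indicator BS) + weighted_evidence f n \<tau> (\<lambda>i. t i + e i) (indicator BN)"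
    by (rule weighted_evidence_add) measurable
  also have "\<dots> \<le> ennreal (exp (2 * A\<^sub>2 * m - \<rho> / 2 * b) * signal_penalty * gauss_density e) * null_ratio f n S \<tau> e
      + ennreal (null_cost e / b') * (\<Prod>i<n. evidence f \<tau> (t i + e i))"
    unfolding BS_def BN_def
    by (intro add_mono signal_error_upper[OF \<tau> le(2) e] null_error_upper[OF \<tau> le(1) b'])
  finally show ?thesis using False by simp
qed

text \<open>
  The noise density cancels between numerator and denominator. The scales above \<open>top_scale\<close>
  and the signal error leave multiples of mixtures of \<open>null_ratio\<close>, whose means are known; the null
  error is already relative to the normalising constant.
\<close>

lemma posterior_bad_upper:
  assumes P: "is_scale_prior P" and e: "noise_size n S e \<le> m" and b': "0 < b'"
    and I: "0 < measure P {r powr (\<beta> / (\<alpha> - 1)) .. top_scale}"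
  shows "(\<integral>\<^sup>+\<tau>. weighted_evidence f n \<tau> (\<lambda>i. t i + e i) (indicator (bad_set b b')) \<partial>P)
      / (\<integral>\<^sup>+\<tau>. weighted_evidence f n \<tau> (\<lambda>i. t i + e i) (\<lambda>_. 1) \<partial>P)
    \<le> ennreal (exp (3 * m) / evidence_floor P \<beta>) * (\<integral>\<^sup>+\<tau>. indicator {top_scale<..} \<tau> * null_ratio f n S \<tau> e \<partial>P)
      + ennreal (exp (2 * A\<^sub>2 * m - \<rho> / 2 * b) * signal_penalty / evidence_floor P \<beta>) * (\<integral>\<^sup>+\<tau>. null_ratio f n S \<tau> e \<partial>P)
      + ennreal (null_cost e / b')"
proof -
  interpret prob_space P using P by (simp add: is_scale_prior_def)
  have [measurable_cong]: "sets P = sets borel" using P by (simp add: is_scale_prior_def)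
  have pos: "AE \<tau> in P. 0 < \<tau>" using P by (simp add: is_scale_prior_def)
  define E where "E \<tau> = (\<Prod>i<n. evidence f \<tau> (t i + e i))" for \<tau>
  define W where "W \<tau> = null_ratio f n S \<tau> e" for \<tau>
  define F where "F = evidence_floor P \<beta>"
  define g where "g = gauss_density e"
  have F: "0 < F" unfolding F_def by (rule evidence_floor_pos[OF I])
  have g: "0 < g" unfolding g_def by (rule gauss_density_pos)
  have [measurable]: "(\<lambda>\<tau>. evidence f \<tau> y) \<in> borel_measurable borel" for y
    using measurable_compose[OF _ measurable_evidence(1)[OF measurable_f], of "\<lambda>\<tau>. (\<tau>, y)" borel] by simp
  have [measurable]: "E \<in> borel_measurable borel" unfolding E_def by measurable
  have [measurable]: "W \<in> borel_measurable borel"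
    unfolding W_def null_ratio_def by measurable
  define Z where "Z = (\<integral>\<^sup>+\<tau>. E \<tau> \<partial>P)"
  have Z: "(\<integral>\<^sup>+\<tau>. weighted_evidence f n \<tau> (\<lambda>i. t i + e i) (\<lambda>_. 1) \<partial>P) = Z"
    by (simp add: Z_def E_def weighted_evidence_1[OF measurable_f])
  have ZF: "ennreal (F * g) \<le> Z"
    unfolding Z_def E_def F_def g_def by (rule total_evidence_lower[OF P e])
  have "0 < ennreal (F * g)" using F g by simp
  then have Zpos: "0 < Z" using ZF by (rule less_le_trans)
  have absorb: "ennreal (c * g) * X \<le> Z * (ennreal (c / F) * X)" if "0 \<le> c" for c X
  proof -
    have "ennreal (c * g) * X = ennreal (F * g) * (ennreal (c / F) * X)"
    proof -
      have "F * g * (c / F) = c * g" using F by simp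
      moreover have "ennreal (F * g * (c / F)) = ennreal (F * g) * ennreal (c / F)"
        using F g by (intro ennreal_mult') simp
      ultimately show ?thesis by (simp add: mult.assoc)
    qed
    also have "\<dots> \<le> Z * (ennreal (c / F) * X)" by (rule mult_right_mono[OF ZF]) simp
    finally show ?thesis .
  qed
  define c2 where "c2 = exp (3 * m)"
  define c1 where "c1 = exp (2 * A\<^sub>2 * m - \<rho> / 2 * b) * signal_penalty"
  have c: "0 \<le> c1" "0 \<le> c2" using signal_penalty_pos by (auto simp: c1_def c2_def)
  have "(\<integral>\<^sup>+\<tau>. weighted_evidence f n \<tau> (\<lambda>i. t i + e i) (indicator (bad_set b b')) \<partial>P)
    \<le> (\<integral>\<^sup>+\<tau>. ennreal (c2 * g) * (indicator {top_scale<..} \<tau> * W \<tau>) + ennreal (c1 * g) * W \<tau>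
        + ennreal (null_cost e / b') * E \<tau> \<partial>P)"
  proof (rule nn_integral_mono_AE)
    show "AE \<tau> in P. weighted_evidence f n \<tau> (\<lambda>i. t i + e i) (indicator (bad_set b b'))
      \<le> ennreal (c2 * g) * (indicator {top_scale<..} \<tau> * W \<tau>) + ennreal (c1 * g) * W \<tau>
        + ennreal (null_cost e / b') * E \<tau>"
      using pos
    proof eventually_elim
      case (elim \<tau>)
      then show ?case
        unfolding c1_def c2_def g_def W_def E_def by (rule bad_weighted_evidence_upper[OF _ e b'])
    qed
  qed
  also have "\<dots> = ennreal (c2 * g) * (\<integral>\<^sup>+\<tau>. indicator {top_scale<..} \<tau> * W \<tau> \<partial>P)
      + ennreal (c1 * g) * (\<integral>\<^sup>+\<tau>. W \<tau> \<partial>P) + ennreal (null_cost e / b') * Z"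
    by (simp add: nn_integral_add nn_integral_cmult Z_def)
  also have "\<dots> \<le> Z * (ennreal (c2 / F) * (\<integral>\<^sup>+\<tau>. indicator {top_scale<..} \<tau> * W \<tau> \<partial>P))
      + Z * (ennreal (c1 / F) * (\<integral>\<^sup>+\<tau>. W \<tau> \<partial>P)) + Z * ennreal (null_cost e / b')"
    by (intro add_mono absorb c) (simp add: mult.commute)
  also have "\<dots> = Z * (ennreal (c2 / F) * (\<integral>\<^sup>+\<tau>. indicator {top_scale<..} \<tau> * W \<tau> \<partial>P)
      + ennreal (c1 / F) * (\<integral>\<^sup>+\<tau>. W \<tau> \<partial>P) + ennreal (null_cost e / b'))"
    by (simp only: distrib_left)
  finally show ?thesis
    unfolding Z W_def[symmetric] F_def[symmetric] c1_def[symmetric] c2_def[symmetric]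
    by (rule divide_le_posI_ennreal[OF Zpos])
qed

lemma nn_integral_null_cost:
  "(\<integral>\<^sup>+e. ennreal (null_cost e) \<partial>noise_law n) \<le> ennreal (real n * (C * top_scale powr q * B))"
proof -
  define h where "h x = exp (D * \<bar>x\<bar> + p * x\<^sup>2 / 2)" for x :: real
  have [measurable]: "h \<in> borel_measurable borel" unfolding h_def by measurable
  define c where "c = C * top_scale powr q"
  have c: "0 \<le> c" using constants_pos by (simp add: c_def)
  have "null_cost e = (\<Sum>i\<in>{..<n} - S. c * h (e i))" for e
    by (simp only: null_cost_def c_def h_def sum_distrib_left)
  then have "(\<integral>\<^sup>+e. ennreal (null_cost e) \<partial>noise_law n)
      = of_nat (card ({..<n} - S)) * (\<integral>\<^sup>+x. ennreal (c * h x * \<phi> x) \<partial>lborel)"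
    using c nn_integral_noise_sum[of "{..<n} - S" n "\<lambda>x. c * h x"] by (simp add: h_def)
  also have "(\<integral>\<^sup>+x. ennreal (c * h x * \<phi> x) \<partial>lborel) = (\<integral>\<^sup>+x. ennreal c * ennreal (h x * \<phi> x) \<partial>lborel)"
    by (simp only: ennreal_mult'[OF c] mult.assoc)
  also have "\<dots> = ennreal c * (\<integral>\<^sup>+x. ennreal (h x * \<phi> x) \<partial>lborel)"
    by (rule nn_integral_cmult) measurable
  also have "of_nat (card ({..<n} - S)) * \<dots> \<le> of_nat n * (ennreal c * ennreal B)"
    unfolding h_def using card_mono[of "{..<n}" "{..<n} - S"] gaussian_moment
    by (intro mult_mono mult_left_mono) auto
  also have "\<dots> = ennreal (real n * (c * B))"
    using c constants_pos by (simp add: ennreal_of_nat_eq_real_of_nat ennreal_mult)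
  finally show ?thesis by (simp add: c_def)
qed

text \<open>
  Off the noise budget the posterior probability is bounded by one and Markov's inequality is used; on it
  \<open>posterior_bad_upper\<close> is integrated, the order of \<open>e\<close> and \<open>\<tau>\<close> is exchanged and \<open>null_ratio\<close> has mean one
  for every \<open>\<tau>\<close>.
\<close>

lemma expected_posterior_bad_upper:
  assumes P: "is_scale_prior P" and b': "0 < b'"
    and I: "0 < measure P {r powr (\<beta> / (\<alpha> - 1)) .. top_scale}"
    and A: "{x \<in> space (leb n). A x} \<in> sets (leb n)" "\<And>x. x \<in> space (leb n) \<Longrightarrow> A x \<Longrightarrow> x \<in> bad_set b b'"
  shows "expected_posterior_prob f P n t A
    \<le> ennreal (3 * real (card S) / m
       + exp (3 * m) / evidence_floor P \<beta> * measure P {top_scale<..}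
       + exp (2 * A\<^sub>2 * m - \<rho> / 2 * b) * signal_penalty / evidence_floor P \<beta>
       + real n * (C * top_scale powr q * B) / b')"
proof -
  interpret prob_space P using P by (simp add: is_scale_prior_def)
  have [measurable_cong]: "sets P = sets borel" using P by (simp add: is_scale_prior_def)
  interpret N: prob_space "noise_law n" by (rule prob_space_noise)
  interpret pair_sigma_finite "noise_law n" P ..
  define F where "F = evidence_floor P \<beta>"
  have F: "0 < F" unfolding F_def by (rule evidence_floor_pos[OF I])
  define c2 where "c2 = exp (3 * m) / F"
  define c1 where "c1 = exp (2 * A\<^sub>2 * m - \<rho> / 2 * b) * signal_penalty / F"
  have c: "0 \<le> c1" "0 \<le> c2" using F signal_penalty_pos by (auto simp: c1_def c2_def)
  define R where "R A e = (\<integral>\<^sup>+\<tau>. indicator A \<tau> * null_ratio f n S \<tau> e \<partial>P)" for A :: "real set" and e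
  have [measurable]: "(\<lambda>(e, \<tau>). null_ratio f n S \<tau> e) \<in> borel_measurable (noise_law n \<Otimes>\<^sub>M P)"
    by measurable
  have R_meas [measurable]: "R A \<in> borel_measurable (noise_law n)" if [measurable]: "A \<in> sets borel" for A
    unfolding R_def by measurable
  have pos: "AE \<tau> in P. 0 < \<tau>" using P by (simp add: is_scale_prior_def)
  have intR: "(\<integral>\<^sup>+e. R A e \<partial>noise_law n) = ennreal (measure P A)" if [measurable]: "A \<in> sets borel" for A
  proof -
    have "(\<integral>\<^sup>+e. R A e \<partial>noise_law n) = (\<integral>\<^sup>+\<tau>. \<integral>\<^sup>+e. indicator A \<tau> * null_ratio f n S \<tau> e \<partial>noise_law n \<partial>P)"
      unfolding R_def by (rule Fubini'[symmetric]) measurable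
    also have "\<dots> = (\<integral>\<^sup>+\<tau>. indicator A \<tau> \<partial>P)"
    proof (rule nn_integral_cong_AE, use pos in eventually_elim)
      fix \<tau> :: real assume \<tau>: "0 < \<tau>"
      have "(\<lambda>e. null_ratio f n S \<tau> e) \<in> borel_measurable (noise_law n)"
        unfolding null_ratio_def by measurable
      then show "(\<integral>\<^sup>+e. indicator A \<tau> * null_ratio f n S \<tau> e \<partial>noise_law n) = indicator A \<tau>"
        by (simp add: nn_integral_cmult nn_integral_null_ratio[OF \<tau>])
    qed
    also have "\<dots> = ennreal (measure P A)" by (simp add: emeasure_eq_measure)
    finally show ?thesis .
  qed
  have B: "bad_set b b' \<in> sets (leb n)" by measurable
  define Q where "Q e = (\<integral>\<^sup>+\<tau>. weighted_evidence f n \<tau> (\<lambda>i. t i + e i) (indicator (bad_set b b')) \<partial>P)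
      / (\<integral>\<^sup>+\<tau>. weighted_evidence f n \<tau> (\<lambda>i. t i + e i) (\<lambda>_. 1) \<partial>P)" for e
  have "expected_posterior_prob f P n t A
     \<le> (\<integral>\<^sup>+e. Q e \<partial>noise_law n)"
    unfolding Q_def expected_posterior_prob_eq[OF P measurable_f A(1) f_nonneg]
    using A(2) by (intro nn_integral_mono divide_right_mono_ennreal weighted_evidence_mono)
      (auto simp: indicator_def)
  also have "\<dots> \<le> (\<integral>\<^sup>+e. indicator {e. m < noise_size n S e} e
      + (ennreal c2 * R {top_scale<..} e + ennreal c1 * R UNIV e + ennreal (1 / b') * ennreal (null_cost e)) \<partial>noise_law n)"
  proof (intro nn_integral_mono)
    fix e :: "nat \<Rightarrow> real"
    show "Q e \<le> indicator {e. m < noise_size n S e} e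
      + (ennreal c2 * R {top_scale<..} e + ennreal c1 * R UNIV e + ennreal (1 / b') * ennreal (null_cost e))"
    proof (cases "m < noise_size n S e")
      case True
      define X where "X = (\<integral>\<^sup>+\<tau>. weighted_evidence f n \<tau> (\<lambda>i. t i + e i) (indicator (bad_set b b')) \<partial>P)"
      define Y where "Y = (\<integral>\<^sup>+\<tau>. weighted_evidence f n \<tau> (\<lambda>i. t i + e i) (\<lambda>_. 1) \<partial>P)"
      have "X \<le> Y" unfolding X_def Y_def
        by (intro nn_integral_mono weighted_evidence_mono) (simp add: indicator_def)
      then have "X / Y \<le> 1"
        by (cases "Y = 0") (simp_all add: divide_le_posI_ennreal zero_less_iff_neq_zero)
      then have "Q e \<le> 1" by (simp add: Q_def X_def Y_def)
      then show ?thesis using True by (simp add: add_increasing2)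
    next
      case False
      have "ennreal (null_cost e / b') = ennreal (1 / b') * ennreal (null_cost e)"
        using b' ennreal_mult'[of "1 / b'" "null_cost e"] by simp
      then show ?thesis
        using posterior_bad_upper[OF P _ b' I, of e b] False
        by (simp add: Q_def R_def c1_def c2_def F_def)
    qed
  qed
  also have "\<dots> = (\<integral>\<^sup>+e. indicator {e. m < noise_size n S e} e \<partial>noise_law n)
      + (ennreal c2 * (\<integral>\<^sup>+e. R {top_scale<..} e \<partial>noise_law n) + ennreal c1 * (\<integral>\<^sup>+e. R UNIV e \<partial>noise_law n)
        + ennreal (1 / b') * (\<integral>\<^sup>+e. ennreal (null_cost e) \<partial>noise_law n))"
    by (simp add: nn_integral_add nn_integral_cmult R_meas del: ennreal_plus)
  also have "\<dots> \<le> ennreal (3 * real (card S) / m)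
      + (ennreal c2 * ennreal (measure P {top_scale<..}) + ennreal c1 * ennreal 1
        + ennreal (1 / b') * ennreal (real n * (C * top_scale powr q * B)))"
    using intR[of "{top_scale<..}"] intR[of UNIV] prob_space
    by (intro add_mono mult_left_mono noise_size_tail[OF S_subset n_pos m_pos] nn_integral_null_cost)
      (auto simp: space_def[symmetric] sets_eq_imp_space_eq[OF \<open>sets P = sets borel\<close>])
  also have "\<dots> = ennreal (3 * real (card S) / m + c2 * measure P {top_scale<..} + c1
      + real n * (C * top_scale powr q * B) / b')"
  proof -
    have "0 \<le> 3 * real (card S) / m" using m_pos by simp
    moreover have "0 \<le> c2 * measure P {top_scale<..}" using c by simp
    moreover have "0 \<le> 1 / b' * (real n * (C * top_scale powr q * B))" using b' constants_pos by simp
    ultimately show ?thesis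
      using c b' by (simp add: ennreal_mult'[symmetric] ennreal_plus[symmetric] del: ennreal_plus)
  qed
  finally show ?thesis by (simp add: c1_def c2_def F_def)
qed

end

context power_law_estimates
begin

text \<open>
  The bookkeeping of exponents, with \<open>r = exp (- L)\<close> and \<open>m = s * sqrt L\<close>. Each of the four terms of the
  previous lemma becomes one summand. The hypothesis on \<open>\<beta>'\<close> leaves \<open>3 c s L\<close> in the exponent of the
  signal term: one third for the window probability, one third for the noise budget, one third to spare.
  In the term of the large scales the exponent \<open>3 + \<beta> + \<alpha> + \<omega>'\<close> pays for the noise budget, the window
  probability, \<open>\<beta>\<close> for the prior tail and \<open>\<alpha> + \<omega>'\<close> for the size of the signals, and one unit remains.
\<close>

lemma expected_posterior_risk_upper:
  fixes n :: nat and t :: "nat \<Rightarrow> real" and P :: "real measure" and A :: "(nat \<Rightarrow> real) \<Rightarrow> bool"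
    and c \<beta> \<beta>' \<omega>' \<eta> :: real
  defines "S \<equiv> {j. j < n \<and> t j \<noteq> 0}"
  defines "s \<equiv> real (card S)"
  defines "r \<equiv> s / real n" and "L \<equiv> ln (real n / s)"
  assumes P: "is_scale_prior P" and s: "1 \<le> card S" and L: "1 \<le> L" "K * exp (- L) \<le> 1 / 2"
    and c: "0 < c" "\<beta> + 3 * c \<le> \<rho> / 2 * \<beta>'" and \<eta>: "0 < \<eta>"
    and L_large: "(2 * A\<^sub>2 + (2 * A\<^sub>1 + 2 + 2 * K)) * sqrt L \<le> c * L" "(3 + (2 * A\<^sub>1 + 2 + 2 * K)) * sqrt L \<le> L"
    and window: "exp (- c * (s * L)) \<le> measure P {r powr (\<beta> / (\<alpha> - 1)) .. r powr (\<alpha> / (\<alpha> - 1))}"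
      "exp (- (s * L)) \<le> measure P {r powr (\<beta> / (\<alpha> - 1)) .. r powr (\<alpha> / (\<alpha> - 1))}"
    and top: "measure P {r powr (\<alpha> / (\<alpha> - 1)) ..} \<le> exp (- (3 + \<beta> + \<alpha> + \<omega>') * (s * L))"
    and \<omega>': "0 \<le> \<omega>'" "\<And>j. j < n \<Longrightarrow> \<bar>t j\<bar> \<le> exp (\<omega>' / \<alpha> * L)"
    and A: "{x \<in> space (leb n). A x} \<in> sets (leb n)"
      "\<And>x. A x \<Longrightarrow> \<beta>' * (s * L) \<le> (\<Sum>i\<in>S. (x i - t i)\<^sup>2) \<or> \<eta> * (s * sqrt L) \<le> (\<Sum>i\<in>{..<n} - S. (x i)\<^sup>2 + \<bar>x i\<bar>)"
  shows "expected_posterior_prob f P n t A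
    \<le> ennreal (3 / sqrt L + exp (- L) + exp (- c * L) + C * B / \<eta> * exp (- (q * (\<alpha> / (\<alpha> - 1)) - 1) * L))"
proof -
  interpret prob_space P using P by (simp add: is_scale_prior_def)
  have setsP: "sets P = sets borel" using P by (simp add: is_scale_prior_def)
  define m where "m = s * sqrt L"
  have Sne: "S \<noteq> {}" using s by auto
  then have n: "0 < n" by (auto simp: S_def)
  have s1: "1 \<le> s" using s by (simp add: s_def)
  have r: "r = exp (- L)" "0 < r" using s1 n by (simp_all add: r_def L_def exp_minus)
  have sqL: "1 \<le> sqrt L" using L by simp
  have sL: "L \<le> s * L" using s1 L mult_right_mono[of 1 s L] by simp
  interpret sparse_experiment f \<alpha> M K\<^sub>1 K\<^sub>2 K A\<^sub>1 A\<^sub>2 \<rho> C D p q B n t S r m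
  proof
    show "S = {j. j < n \<and> t j \<noteq> 0}" by (simp add: S_def)
    show "S \<noteq> {}" by (rule Sne)
    show "r = real (card S) / real n" by (simp add: r_def s_def)
    show "K * r \<le> 1 / 2" using L r by simp
    show "real (card S) \<le> m" using sqL s1 mult_left_mono[of 1 "sqrt L" s] by (simp add: m_def s_def)
  qed
  define w where "w = measure P {r powr (\<beta> / (\<alpha> - 1)) .. top_scale}"
  have w: "exp (- c * (s * L)) \<le> w" "exp (- (s * L)) \<le> w" using window by (simp_all add: w_def top_scale_def)
  have w_pos: "0 < w" using w(2) exp_gt_zero[of "- (s * L)"] by linarith
  define Q where "Q = 2 * A\<^sub>1 + 2 + 2 * K"
  have floor: "evidence_floor P \<beta> = w * (exp (- Q * m) * exp (- \<beta> * (s * L)) * signal_penalty)"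
  proof -
    have "r powr (\<beta> * real (card S)) = exp (- \<beta> * (s * L))"
      unfolding s_def[symmetric] r(1) by (simp add: exp_powr_real mult_ac)
    then show ?thesis by (simp only: evidence_floor_def w_def Q_def)
  qed
  have penalty: "exp (- (\<alpha> + \<omega>' * L) * s) \<le> signal_penalty"
  proof -
    have "exp (- (\<alpha> + \<omega>' * L)) \<le> (1 + \<bar>t i\<bar>) powr - \<alpha>" if "i \<in> S" for i
    proof -
      have i: "i < n" using that by (simp add: S_def)
      have "1 + \<bar>t i\<bar> \<le> 2 * exp (\<omega>' / \<alpha> * L)"
      proof -
        have "0 \<le> \<omega>' / \<alpha> * L"
          using \<omega>'(1) \<alpha> L by (intro mult_nonneg_nonneg divide_nonneg_nonneg) auto
        then have "1 \<le> exp (\<omega>' / \<alpha> * L)" by simp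
        then show ?thesis using \<omega>'(2)[OF i] by linarith
      qed
      also have "\<dots> \<le> exp 1 * exp (\<omega>' / \<alpha> * L)"
        using exp_ge_add_one_self[of 1] by (intro mult_right_mono) auto
      also have "\<dots> = exp (1 + \<omega>' / \<alpha> * L)" by (rule exp_add[symmetric])
      finally have "exp (1 + \<omega>' / \<alpha> * L) powr - \<alpha> \<le> (1 + \<bar>t i\<bar>) powr - \<alpha>"
        using \<alpha> by (intro powr_mono2') auto
      moreover have "exp (1 + \<omega>' / \<alpha> * L) powr - \<alpha> = exp (- (\<alpha> + \<omega>' * L))"
      proof -
        have "(1 + \<omega>' / \<alpha> * L) * \<alpha> = \<alpha> + \<omega>' * L" using \<alpha> by (simp add: distrib_right)
        then show ?thesis by (simp add: exp_powr_real)
      qed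
      ultimately show ?thesis by simp
    qed
    then have "(\<Prod>i\<in>S. exp (- (\<alpha> + \<omega>' * L))) \<le> signal_penalty"
      unfolding signal_penalty_def by (intro prod_mono) auto
    then show ?thesis by (simp add: s_def exp_of_nat2_mult[symmetric])
  qed
  have "A x \<Longrightarrow> x \<in> space (leb n) \<Longrightarrow> x \<in> bad_set (\<beta>' * (s * L)) (\<eta> * m)" for x
    using A(2)[of x] by (auto simp: bad_set_def m_def)
  moreover have \<eta>m: "0 < \<eta> * m" using \<eta> m_pos by simp
  ultimately have "expected_posterior_prob f P n t A
    \<le> ennreal (3 * real (card S) / m
       + exp (3 * m) / evidence_floor P \<beta> * measure P {top_scale<..}
       + exp (2 * A\<^sub>2 * m - \<rho> / 2 * (\<beta>' * (s * L))) * signal_penalty / evidence_floor P \<beta>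
       + real n * (C * top_scale powr q * B) / (\<eta> * m))"
    using w_pos by (intro expected_posterior_bad_upper P A(1)) (auto simp: w_def)
  also have "\<dots> \<le> ennreal (3 / sqrt L + exp (- L) + exp (- c * L) + C * B / \<eta> * exp (- (q * (\<alpha> / (\<alpha> - 1)) - 1) * L))"
  proof (intro ennreal_leI add_mono)
    show "3 * real (card S) / m \<le> 3 / sqrt L" using s1 unfolding s_def[symmetric] by (simp add: m_def)
  next
    define v where "v = w * (exp (- Q * m) * exp (- \<beta> * (s * L)) * exp (- (\<alpha> + \<omega>' * L) * s))"
    have v: "0 < v" using w_pos by (simp add: v_def)
    have "v \<le> evidence_floor P \<beta>"
      unfolding floor v_def using w_pos by (intro mult_left_mono penalty) auto
    moreover have "exp (- (s * L) - Q * m - \<beta> * (s * L) - (\<alpha> + \<omega>' * L) * s) \<le> v"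
    proof -
      have "exp (- (s * L) - Q * m - \<beta> * (s * L) - (\<alpha> + \<omega>' * L) * s)
        = exp (- (s * L)) * (exp (- Q * m) * exp (- \<beta> * (s * L)) * exp (- (\<alpha> + \<omega>' * L) * s))"
        by (simp only: exp_add[symmetric] mult_minus_left diff_conv_add_uminus add.assoc)
      also have "\<dots> \<le> v" unfolding v_def by (intro mult_right_mono w) auto
      finally show ?thesis .
    qed
    ultimately have fl: "exp (- (s * L) - Q * m - \<beta> * (s * L) - (\<alpha> + \<omega>' * L) * s) \<le> evidence_floor P \<beta>"
      by linarith
    have "measure P {top_scale<..} \<le> measure P {top_scale..}"
      by (rule finite_measure_mono) (auto simp: setsP)
    also have "\<dots> \<le> exp (- (3 + \<beta> + \<alpha> + \<omega>') * (s * L))" using top by (simp add: top_scale_def)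
    finally have tp: "measure P {top_scale<..} \<le> exp (- (3 + \<beta> + \<alpha> + \<omega>') * (s * L))" .
    have "exp (3 * m) / evidence_floor P \<beta> * measure P {top_scale<..}
       \<le> exp (3 * m) / exp (- (s * L) - Q * m - \<beta> * (s * L) - (\<alpha> + \<omega>' * L) * s) * exp (- (3 + \<beta> + \<alpha> + \<omega>') * (s * L))"
      by (intro mult_mono divide_left_mono fl tp mult_pos_pos) (use fl in \<open>auto intro: less_le_trans[OF exp_gt_zero fl] less_imp_le\<close>)
    also have "\<dots> = exp (3 * m - (- (s * L) - Q * m - \<beta> * (s * L) - (\<alpha> + \<omega>' * L) * s) + - (3 + \<beta> + \<alpha> + \<omega>') * (s * L))"
      by (simp only: exp_add exp_diff)
    also have "\<dots> \<le> exp (- L)"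
    proof (subst exp_le_cancel_iff)
      have "(3 + Q) * sqrt L * s \<le> L * s"
        using L_large(2) s1 by (intro mult_right_mono) (auto simp: Q_def)
      moreover have "\<alpha> * s \<le> \<alpha> * (s * L)"
        using s1 L \<alpha> mult_left_mono[of 1 L s] by (intro mult_left_mono) auto
      moreover have "3 * m - (- (s * L) - Q * m - \<beta> * (s * L) - (\<alpha> + \<omega>' * L) * s) + - (3 + \<beta> + \<alpha> + \<omega>') * (s * L)
         = (3 + Q) * sqrt L * s + \<alpha> * s - \<alpha> * (s * L) - 2 * (s * L)"
        by (simp add: m_def algebra_simps)
      ultimately show "3 * m - (- (s * L) - Q * m - \<beta> * (s * L) - (\<alpha> + \<omega>' * L) * s) + - (3 + \<beta> + \<alpha> + \<omega>') * (s * L) \<le> - L"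
        using sL by (simp add: mult.commute)
    qed
    finally show "exp (3 * m) / evidence_floor P \<beta> * measure P {top_scale<..} \<le> exp (- L)" .
  next
    have "exp (2 * A\<^sub>2 * m - \<rho> / 2 * (\<beta>' * (s * L))) * signal_penalty / evidence_floor P \<beta>
       = exp (2 * A\<^sub>2 * m - \<rho> / 2 * (\<beta>' * (s * L))) / (w * (exp (- Q * m) * exp (- \<beta> * (s * L))))"
      using signal_penalty_pos by (simp add: floor)
    also have "\<dots> \<le> exp (2 * A\<^sub>2 * m - \<rho> / 2 * (\<beta>' * (s * L))) / (exp (- c * (s * L)) * (exp (- Q * m) * exp (- \<beta> * (s * L))))"
      using w_pos by (intro divide_left_mono mult_right_mono w mult_pos_pos) auto
    also have "\<dots> = exp (2 * A\<^sub>2 * m - \<rho> / 2 * (\<beta>' * (s * L)) - (- c * (s * L) + (- Q * m + - \<beta> * (s * L))))"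
      by (simp only: exp_add exp_diff)
    also have "\<dots> \<le> exp (- c * L)"
    proof (subst exp_le_cancel_iff)
      have "(2 * A\<^sub>2 + Q) * sqrt L * s \<le> c * L * s"
        using L_large(1) s1 by (intro mult_right_mono) (auto simp: Q_def)
      moreover have "(\<beta> + 3 * c) * (s * L) \<le> \<rho> / 2 * \<beta>' * (s * L)"
        using s1 L by (intro mult_right_mono c) auto
      moreover have "c * L \<le> c * (s * L)" using sL c by simp
      moreover have "2 * A\<^sub>2 * m - \<rho> / 2 * (\<beta>' * (s * L)) - (- c * (s * L) + (- Q * m + - \<beta> * (s * L)))
         = (2 * A\<^sub>2 + Q) * sqrt L * s - \<rho> / 2 * \<beta>' * (s * L) + (\<beta> + 3 * c) * (s * L) - 2 * (c * (s * L))"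
        by (simp add: m_def algebra_simps)
      moreover have "c * L * s = c * (s * L)" by simp
      ultimately show "2 * A\<^sub>2 * m - \<rho> / 2 * (\<beta>' * (s * L)) - (- c * (s * L) + (- Q * m + - \<beta> * (s * L))) \<le> - c * L"
        by linarith
    qed
    finally show "exp (2 * A\<^sub>2 * m - \<rho> / 2 * (\<beta>' * (s * L))) * signal_penalty / evidence_floor P \<beta> \<le> exp (- c * L)" .
  next
    define d where "d = q * (\<alpha> / (\<alpha> - 1)) - 1"
    have "top_scale powr q = r powr (1 + d)" by (simp add: top_scale_def powr_powr d_def mult.commute)
    also have "\<dots> = r * exp (- d * L)" using r by (simp add: powr_add exp_powr_real mult.commute)
    finally have "real n * (C * top_scale powr q * B) / (\<eta> * m) = (r * real n) * (C * B * exp (- d * L)) / (\<eta> * m)"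
      by (simp only: mult_ac)
    also have "\<dots> = s * (C * B * exp (- d * L)) / (s * (\<eta> * sqrt L))"
      unfolding r_n s_def[symmetric] m_def by (simp only: mult_ac)
    also have "\<dots> = C * B * exp (- d * L) / (\<eta> * sqrt L)" using s1 by simp
    also have "\<dots> \<le> C * B * exp (- d * L) / (\<eta> * 1)"
      using sqL \<eta> constants_pos by (intro divide_left_mono mult_left_mono) auto
    finally show "real n * (C * top_scale powr q * B) / (\<eta> * m) \<le> C * B / \<eta> * exp (- (q * (\<alpha> / (\<alpha> - 1)) - 1) * L)"
      by (simp add: d_def)
  qed
  finally show ?thesis .
qed

end

section \<open>Asymptotics\<close>

lemma neg_log_dominated_imp_lower:
  assumes dom: "(\<lambda>n. neg_log (w n)) \<prec>\<prec> (\<lambda>n. ereal (v n))" and c: "0 < c"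
    and v: "eventually (\<lambda>n. 0 < v n) sequentially" and w: "\<And>n. 0 \<le> w n"
  shows "eventually (\<lambda>n. exp (- c * v n) \<le> w n) sequentially"
proof -
  have "eventually (\<lambda>n. ereal (1 / c) < ereal (v n) / neg_log (w n)) sequentially"
    using dom by (simp add: dominates_def tendsto_PInfty)
  then show ?thesis using v
  proof eventually_elim
    case (elim n)
    have "w n \<noteq> 0"
    proof
      assume "w n = 0"
      then have "ereal (1 / c) < 0" using elim by (simp add: neg_log_def)
      then show False using c by simp
    qed
    then have wp: "0 < w n" using w[of n] by simp
    show ?case
    proof (cases "w n < 1")
      case True
      then have ln: "0 < - ln (w n)" using wp by simp
      then have "1 / c < v n / - ln (w n)" using elim wp by (simp add: neg_log_def)
      then have "- ln (w n) < c * v n" using c ln by (simp add: divide_simps mult.commute split: if_splits)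
      then have "exp (- c * v n) \<le> exp (ln (w n))" by simp
      then show ?thesis using wp by simp
    next
      case False
      have "exp (- c * v n) \<le> 1" using c elim by simp
      then show ?thesis using False by linarith
    qed
  qed
qed

lemma neg_log_dominates_imp_upper:
  assumes dom: "(\<lambda>n. neg_log (w n)) \<succ>\<succ> (\<lambda>n. ereal (v n))"
    and v: "eventually (\<lambda>n. 0 < v n) sequentially" and w: "\<And>n. 0 \<le> w n"
  shows "eventually (\<lambda>n. w n \<le> exp (- k * v n)) sequentially"
proof -
  have "eventually (\<lambda>n. ereal k < neg_log (w n) / ereal (v n)) sequentially"
    using dom by (simp add: dominates_def tendsto_PInfty)
  then show ?thesis using v
  proof eventually_elim
    case (elim n)
    show ?case
    proof (cases "w n = 0")
      case False
      then have wp: "0 < w n" using w[of n] by simp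
      have "k < - ln (w n) / v n" using elim wp by (simp add: neg_log_def)
      then have "k * v n < - ln (w n)" using elim(2) by (simp only: pos_less_divide_eq)
      then have "exp (ln (w n)) \<le> exp (- k * v n)" unfolding exp_le_cancel_iff by simp
      then show ?thesis using wp by simp
    qed simp
  qed
qed

lemma risk_rate_tendsto_0:
  assumes "0 < c" "0 < d"
  shows "((\<lambda>L. 3 / sqrt L + exp (- L) + exp (- c * L) + k * exp (- d * L)) \<longlongrightarrow> (0::real)) at_top"
proof -
  have e: "((\<lambda>L. exp (- a * L)) \<longlongrightarrow> (0::real)) at_top" if "0 < a" for a
  proof (rule filterlim_compose[OF exp_at_bot])
    have "filterlim (\<lambda>L::real. a * L) at_top at_top"
      using that by (intro filterlim_tendsto_pos_mult_at_top[OF tendsto_const]) (auto simp: filterlim_ident)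
    then show "filterlim (\<lambda>L::real. - a * L) at_bot at_top"
      by (simp add: filterlim_uminus_at_top)
  qed
  have "((\<lambda>L. 3 / sqrt L) \<longlongrightarrow> (0::real)) at_top"
    by (rule tendsto_divide_0[OF tendsto_const filterlim_at_top_imp_at_infinity[OF sqrt_at_top]])
  then have "((\<lambda>L. 3 / sqrt L + exp (- 1 * L) + exp (- c * L) + k * exp (- d * L)) \<longlongrightarrow> 0 + 0 + 0 + k * (0::real)) at_top"
    using assms by (intro tendsto_add tendsto_mult tendsto_const e) auto
  then show ?thesis by simp
qed

lemma eventually_sqrt_le_linear:
  assumes "0 < c"
  shows "eventually (\<lambda>L. a * sqrt L \<le> c * L) at_top"
proof -
  have "eventually (\<lambda>L. \<bar>a\<bar> / c \<le> sqrt L) at_top"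
    using sqrt_at_top by (simp add: filterlim_at_top)
  then show ?thesis using eventually_ge_at_top[of 0]
  proof eventually_elim
    case (elim L)
    have "a \<le> c * sqrt L" using elim(1) assms by (simp add: divide_le_eq mult.commute)
    then have "a * sqrt L \<le> c * sqrt L * sqrt L" using elim by (intro mult_right_mono) auto
    then show ?case using elim by (simp add: mult.assoc)
  qed
qed

lemma power_law_prior_of_tail:
  assumes "is_prob_density f" "polynomial_tail \<alpha> f" "1 < \<alpha>"
  shows "\<exists>M K\<^sub>1 K\<^sub>2. power_law_prior f \<alpha> M K\<^sub>1 K\<^sub>2"
proof -
  obtain M K\<^sub>1 K\<^sub>2 where "0 < M" "0 < K\<^sub>1" "K\<^sub>1 < K\<^sub>2"
    "\<And>x. M < \<bar>x\<bar> \<Longrightarrow> K\<^sub>1 * \<bar>x\<bar> powr (-\<alpha>) \<le> f x \<and> f x \<le> K\<^sub>2 * \<bar>x\<bar> powr (-\<alpha>)"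
    using assms(2) unfolding polynomial_tail_def by blast
  then have "power_law_prior f \<alpha> M K\<^sub>1 K\<^sub>2"
    using assms(1,3) unfolding is_prob_density_def by unfold_locales auto
  then show ?thesis by blast
qed

lemma (in power_law_prior) power_law_estimates_exist:
  assumes \<rho>: "0 < \<rho>" "\<rho> < 1"
  shows "\<exists>K A\<^sub>1 A\<^sub>2 C D p q B. power_law_estimates f \<alpha> M K\<^sub>1 K\<^sub>2 K A\<^sub>1 A\<^sub>2 \<rho> C D p q B
     \<and> 1 < q * (\<alpha> / (\<alpha> - 1))"
proof -
  obtain K where "0 < K" "\<And>\<tau> \<delta> y. 0 < \<tau> \<Longrightarrow> 0 < \<delta> \<Longrightarrow>
      ennreal (\<phi> y * exp (- \<bar>y\<bar> * \<delta> - \<delta>\<^sup>2 / 2) * (1 - K * (\<tau> / \<delta>) powr (\<alpha> - 1))) \<le> evidence f \<tau> y"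
    using null_evidence_lower by blast
  moreover obtain A\<^sub>1 where "0 < A\<^sub>1" "\<And>\<tau> u e. 0 < \<tau> \<Longrightarrow> \<tau> \<le> 1 \<Longrightarrow>
      ennreal (\<phi> e * exp (- A\<^sub>1 * (1 + \<bar>e\<bar>)) * \<tau> powr (\<alpha> - 1) * (1 + \<bar>u\<bar>) powr - \<alpha>) \<le> evidence f \<tau> (u + e)"
    using signal_evidence_lower by blast
  moreover obtain A\<^sub>2 where "0 < A\<^sub>2" "\<And>\<tau> u e. 0 < \<tau> \<Longrightarrow> \<tau> \<le> 1 \<Longrightarrow>
      (\<integral>\<^sup>+x. ennreal (exp (\<rho> / 2 * (x - u)\<^sup>2)) * ennreal (\<phi> (u + e - x) * scaled f \<tau> x) \<partial>lborel)
        \<le> ennreal (\<phi> e * exp (A\<^sub>2 * (1 + e\<^sup>2)) * (1 + \<bar>u\<bar>) powr - \<alpha>)"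
    using signal_moment_upper[OF \<rho>] by blast
  moreover obtain D C p q where Cpq: "0 < C" "p < 1" "0 < q" "1 < q * (\<alpha> / (\<alpha> - 1))" "\<And>\<tau> y. 0 < \<tau> \<Longrightarrow> \<tau> \<le> 1 \<Longrightarrow>
      null_moment f \<tau> y
        \<le> ennreal (C * \<tau> powr q * exp (D * \<bar>y\<bar> + p * y\<^sup>2 / 2)) * evidence f \<tau> y"
    using null_moment_upper by blast
  moreover obtain B where "0 < B" "(\<integral>\<^sup>+y. ennreal (exp (D * \<bar>y\<bar> + p * y\<^sup>2 / 2) * \<phi> y) \<partial>lborel) \<le> ennreal B"
    using gaussian_exp_moment_finite[OF Cpq(2)] by blast
  ultimately have "power_law_estimates f \<alpha> M K\<^sub>1 K\<^sub>2 K A\<^sub>1 A\<^sub>2 \<rho> C D p q B"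
    using \<rho>(1) by unfold_locales auto
  then show ?thesis using Cpq(4) by blast
qed

text \<open>
  The common source of both conclusions: any event that forces a squared error above \<open>(2 + \<omega>) s L\<close>, by a
  fixed factor, on the support, or an error of order \<open>s * sqrt L\<close> off the support, has vanishing expected
  posterior probability. The null error is measured by \<open>x\<^sup>2 + |x|\<close> to cover both norms.
\<close>

lemma posterior_concentration:
  fixes \<omega> \<alpha> \<beta>' \<eta> :: real and f :: "real \<Rightarrow> real" and \<theta>s :: "nat \<Rightarrow> nat \<Rightarrow> real"
    and s :: "nat \<Rightarrow> nat" and P :: "nat \<Rightarrow> real measure" and A :: "nat \<Rightarrow> (nat \<Rightarrow> real) \<Rightarrow> bool"
  assumes \<omega>: "0 < \<omega>" and \<alpha>: "1 < \<alpha>" and f: "is_prob_density f" "polynomial_tail \<alpha> f"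
    and card: "\<And>n. n \<ge> 1 \<Longrightarrow> card {j. j < n \<and> \<theta>s n j \<noteq> 0} = s n"
    and s: "\<And>n. n \<ge> 1 \<Longrightarrow> s n \<ge> 1"
    and sparse: "(\<lambda>n. real (s n)) \<in> o(\<lambda>n. real n)"
    and P: "\<And>n. n \<ge> 1 \<Longrightarrow> is_scale_prior (P n)"
    and window: "(\<lambda>n. neg_log (measure (P n)
              {(real (s n) / real n) powr ((1 + \<omega> / 2) / (\<alpha> - 1)) ..
               (real (s n) / real n) powr (\<alpha> / (\<alpha> - 1))}))
         \<prec>\<prec> (\<lambda>n. ereal (real (s n) * ln (real n / real (s n))))"
    and top: "(\<lambda>n. neg_log (measure (P n) {(real (s n) / real n) powr (\<alpha> / (\<alpha> - 1)) ..}))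
         \<succ>\<succ> (\<lambda>n. ereal (real (s n) * ln (real n / real (s n))))"
    and bounded: "\<And>n. n \<ge> 1 \<Longrightarrow>
           Max ((\<lambda>j. \<bar>\<theta>s n j\<bar>) ` {..<n}) \<le> (real n / real (s n)) powr (\<omega> / (5 * \<alpha>))"
    and \<beta>': "2 + \<omega> < \<beta>'" and \<eta>: "0 < \<eta>"
    and A: "\<And>n. {x \<in> space (leb n). A n x} \<in> sets (leb n)"
      "\<And>n x. 1 \<le> n \<Longrightarrow> 1 \<le> ln (real n / real (s n)) \<Longrightarrow> A n x \<Longrightarrow>
         \<beta>' * (real (s n) * ln (real n / real (s n))) \<le> (\<Sum>i | i < n \<and> \<theta>s n i \<noteq> 0. (x i - \<theta>s n i)\<^sup>2) \<or>
         \<eta> * (real (s n) * sqrt (ln (real n / real (s n)))) \<le> (\<Sum>i\<in>{..<n} - {i. i < n \<and> \<theta>s n i \<noteq> 0}. (x i)\<^sup>2 + \<bar>x i\<bar>)"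
  shows "(\<lambda>n. expected_posterior_prob f (P n) n (\<theta>s n) (A n)) \<longlonglongrightarrow> 0"
proof -
  obtain M K\<^sub>1 K\<^sub>2 where "power_law_prior f \<alpha> M K\<^sub>1 K\<^sub>2" using power_law_prior_of_tail[OF f \<alpha>] by blast
  then interpret power_law_prior f \<alpha> M K\<^sub>1 K\<^sub>2 .
  define \<beta> where "\<beta> = 1 + \<omega> / 2"
  \<comment> \<open>A Chernoff exponent below one with \<open>\<rho> * \<beta>' / 2 > \<beta>\<close> exists because \<open>\<beta>' > 2 + \<omega> = 2 * \<beta>\<close>.\<close>
  obtain \<rho> where \<rho>: "2 * \<beta> / \<beta>' < \<rho>" "\<rho> < 1"
    using dense[of "2 * \<beta> / \<beta>'" 1] \<beta>' \<omega> by (auto simp: \<beta>_def)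
  have "0 < 2 * \<beta> / \<beta>'" using \<omega> \<beta>' by (simp add: \<beta>_def)
  then have \<rho>0: "0 < \<rho>" using \<rho>(1) by linarith
  obtain K A\<^sub>1 A\<^sub>2 C D p q B where "power_law_estimates f \<alpha> M K\<^sub>1 K\<^sub>2 K A\<^sub>1 A\<^sub>2 \<rho> C D p q B" and q: "1 < q * (\<alpha> / (\<alpha> - 1))"
    using power_law_estimates_exist[OF \<rho>0 \<rho>(2)] by blast
  then interpret power_law_estimates f \<alpha> M K\<^sub>1 K\<^sub>2 K A\<^sub>1 A\<^sub>2 \<rho> C D p q B by simp
  define c where "c = (\<rho> / 2 * \<beta>' - \<beta>) / 3"
  have "2 * \<beta> < \<rho> * \<beta>'" using \<rho>(1) \<beta>' \<omega> by (simp add: divide_less_eq)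
  moreover have c3: "3 * c = \<rho> / 2 * \<beta>' - \<beta>" by (simp add: c_def)
  ultimately have c: "0 < c" "\<beta> + 3 * c \<le> \<rho> / 2 * \<beta>'" by simp_all
  define L where "L n = ln (real n / real (s n))" for n
  define d where "d = q * (\<alpha> / (\<alpha> - 1)) - 1"
  define G where "G L = 3 / sqrt L + exp (- L) + exp (- c * L) + C * B / \<eta> * exp (- d * L)" for L
  have L_at_top: "filterlim L at_top sequentially"
  proof -
    have "((\<lambda>n. real (s n) / real n) \<longlongrightarrow> 0) sequentially"
      by (rule smalloD_tendsto[OF sparse])
    moreover have "eventually (\<lambda>n. 0 < real (s n) / real n) sequentially"
      using eventually_ge_at_top[of 1]
    proof eventually_elim
      case (elim n)
      then show ?case using s[of n] by simp
    qed
    ultimately have "filterlim (\<lambda>n. real (s n) / real n) (at_right 0) sequentially"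
      by (rule tendsto_imp_filterlim_at_right)
    then have "filterlim (\<lambda>n. inverse (real (s n) / real n)) at_top sequentially"
      by (rule filterlim_compose[OF filterlim_inverse_at_top_right])
    then have "filterlim (\<lambda>n. ln (inverse (real (s n) / real n))) at_top sequentially"
      by (rule filterlim_compose[OF ln_at_top])
    then show ?thesis by (simp add: L_def[abs_def] inverse_eq_divide)
  qed
  have ev_L: "eventually (\<lambda>n. R (L n)) sequentially" if "eventually R at_top" for R
    using that L_at_top by (rule eventually_compose_filterlim)
  have ev1: "eventually (\<lambda>n. 1 \<le> L n) sequentially" by (intro ev_L eventually_ge_at_top)
  have ev_pos: "eventually (\<lambda>n. 0 < real (s n) * L n) sequentially"
    using ev1 eventually_ge_at_top[of 1]
  proof eventually_elim
    case (elim n)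
    then show ?case using s[of n] by simp
  qed
  have ev_K: "eventually (\<lambda>n. K * exp (- L n) \<le> 1 / 2) sequentially"
  proof (rule ev_L)
    have "((\<lambda>L. K * exp (- L)) \<longlongrightarrow> K * 0) at_top"
      by (intro tendsto_mult tendsto_const filterlim_compose[OF exp_at_bot] filterlim_uminus_at_bot_at_top)
    then have "eventually (\<lambda>L. K * exp (- L) < 1 / 2) at_top" by (rule order_tendstoD) simp
    then show "eventually (\<lambda>L. K * exp (- L) \<le> 1 / 2) at_top" by eventually_elim simp
  qed
  have ev_sqrt1: "eventually (\<lambda>n. (2 * A\<^sub>2 + (2 * A\<^sub>1 + 2 + 2 * K)) * sqrt (L n) \<le> c * L n) sequentially"
    by (intro ev_L eventually_sqrt_le_linear c)
  have ev_sqrt2: "eventually (\<lambda>n. (3 + (2 * A\<^sub>1 + 2 + 2 * K)) * sqrt (L n) \<le> 1 * L n) sequentially"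
    by (rule ev_L, rule eventually_sqrt_le_linear) simp
  have ev_window: "eventually (\<lambda>n. exp (- k * (real (s n) * L n)) \<le> measure (P n)
      {(real (s n) / real n) powr (\<beta> / (\<alpha> - 1)) .. (real (s n) / real n) powr (\<alpha> / (\<alpha> - 1))}) sequentially"
    if "0 < k" for k
    using ev_pos window that unfolding L_def \<beta>_def by (intro neg_log_dominated_imp_lower) auto
  have ev_top: "eventually (\<lambda>n. measure (P n) {(real (s n) / real n) powr (\<alpha> / (\<alpha> - 1)) ..}
      \<le> exp (- (3 + \<beta> + \<alpha> + \<omega> / 5) * (real (s n) * L n))) sequentially"
    using ev_pos top unfolding L_def by (intro neg_log_dominates_imp_upper) auto
  have upper: "eventually (\<lambda>n. expected_posterior_prob f (P n) n (\<theta>s n) (A n) \<le> ennreal (G (L n))) sequentially"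
    using eventually_ge_at_top[of 1] ev1 ev_K ev_sqrt1 ev_sqrt2 ev_window[OF c(1)] ev_window[OF zero_less_one] ev_top
  proof eventually_elim
    case (elim n)
    define S where "S = {j. j < n \<and> \<theta>s n j \<noteq> 0}"
    have cS: "card S = s n" using card[OF elim(1)] by (simp add: S_def)
    have t: "\<bar>\<theta>s n j\<bar> \<le> exp (\<omega> / 5 / \<alpha> * L n)" if "j < n" for j
    proof -
      have "\<bar>\<theta>s n j\<bar> \<le> Max ((\<lambda>j. \<bar>\<theta>s n j\<bar>) ` {..<n})" using that by (intro Max_ge) auto
      also have "\<dots> \<le> (real n / real (s n)) powr (\<omega> / (5 * \<alpha>))" by (rule bounded[OF elim(1)])
      also have "\<dots> = exp (\<omega> / 5 / \<alpha> * L n)"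
        using elim(1) s[OF elim(1)] by (simp add: powr_def L_def)
      finally show ?thesis .
    qed
    show ?case
      unfolding G_def d_def L_def cS[symmetric] unfolding S_def
    proof (rule expected_posterior_risk_upper[where \<beta>=\<beta> and \<beta>'=\<beta>' and \<omega>'="\<omega> / 5"];
        (unfold S_def[symmetric] cS L_def[symmetric])?)
      show "is_scale_prior (P n)" by (rule P[OF elim(1)])
      show "1 \<le> s n" by (rule s[OF elim(1)])
      show "1 \<le> L n" "K * exp (- L n) \<le> 1 / 2" using elim by auto
      show "0 < c" "\<beta> + 3 * c \<le> \<rho> / 2 * \<beta>'" "0 < \<eta>" using c \<eta> by auto
      show "(2 * A\<^sub>2 + (2 * A\<^sub>1 + 2 + 2 * K)) * sqrt (L n) \<le> c * L n"
        "(3 + (2 * A\<^sub>1 + 2 + 2 * K)) * sqrt (L n) \<le> L n" using elim by auto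
      show "exp (- c * (real (s n) * L n)) \<le> measure (P n)
          {(real (s n) / real n) powr (\<beta> / (\<alpha> - 1)) .. (real (s n) / real n) powr (\<alpha> / (\<alpha> - 1))}"
        using elim by auto
      show "exp (- (real (s n) * L n)) \<le> measure (P n)
          {(real (s n) / real n) powr (\<beta> / (\<alpha> - 1)) .. (real (s n) / real n) powr (\<alpha> / (\<alpha> - 1))}"
        using elim by auto
      show "measure (P n) {(real (s n) / real n) powr (\<alpha> / (\<alpha> - 1)) ..}
          \<le> exp (- (3 + \<beta> + \<alpha> + \<omega> / 5) * (real (s n) * L n))" using elim by auto
      show "0 \<le> \<omega> / 5" using \<omega> by simp
      show "\<bar>\<theta>s n j\<bar> \<le> exp (\<omega> / 5 / \<alpha> * L n)" if "j < n" for j by (rule t[OF that])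
      show "{x \<in> space (leb n). A n x} \<in> sets (leb n)" by (rule A(1))
      show "\<beta>' * (real (s n) * L n) \<le> (\<Sum>i\<in>S. (x i - \<theta>s n i)\<^sup>2) \<or>
         \<eta> * (real (s n) * sqrt (L n)) \<le> (\<Sum>i\<in>{..<n} - S. (x i)\<^sup>2 + \<bar>x i\<bar>)" if "A n x" for x
        using A(2)[OF elim(1) _ that] elim(2) by (simp add: S_def L_def)
    qed
  qed
  have vanishes: "((\<lambda>n. ennreal (G (L n))) \<longlongrightarrow> 0) sequentially"
  proof -
    have "(G \<longlongrightarrow> 0) at_top"
      unfolding G_def[abs_def] using q c by (intro risk_rate_tendsto_0) (auto simp: d_def)
    then have "((\<lambda>n. G (L n)) \<longlongrightarrow> 0) sequentially" by (rule filterlim_compose[OF _ L_at_top])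
    then show ?thesis using tendsto_ennrealI[of "\<lambda>n. G (L n)" 0] by simp
  qed
  have nonneg: "eventually (\<lambda>n. 0 \<le> expected_posterior_prob f (P n) n (\<theta>s n) (A n)) sequentially"
    by simp
  show ?thesis by (rule tendsto_sandwich[OF nonneg upper tendsto_const vanishes])
qed

theorem theorem3p1:
  fixes \<omega> \<alpha> :: real
    and \<pi>\<^sub>0 :: "real \<Rightarrow> real"
    and \<theta>s :: "nat \<Rightarrow> nat \<Rightarrow> real"
    and s :: "nat \<Rightarrow> nat"
    and P :: "nat \<Rightarrow> real measure"
  assumes "\<omega> > 0" and "\<alpha> > 1"
    and "is_prob_density \<pi>\<^sub>0" and "unimodal_density \<pi>\<^sub>0" and "polynomial_tail \<alpha> \<pi>\<^sub>0"
    and "\<And>n. n \<ge> 1 \<Longrightarrow> card {j. j < n \<and> \<theta>s n j \<noteq> 0} = s n"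
    and "\<And>n. n \<ge> 1 \<Longrightarrow> s n \<ge> 1"
    and "(\<lambda>n. real (s n)) \<in> o(\<lambda>n. real n)"
    and "\<And>n. n \<ge> 1 \<Longrightarrow> is_scale_prior (P n)"
    and "\<alpha> \<le> 1 + \<omega> / 2"
    and "(\<lambda>n. neg_log (measure (P n)
              {(real (s n) / real n) powr ((1 + \<omega> / 2) / (\<alpha> - 1)) ..
               (real (s n) / real n) powr (\<alpha> / (\<alpha> - 1))}))
         \<prec>\<prec> (\<lambda>n. ereal (real (s n) * ln (real n / real (s n))))"
    and "(\<lambda>n. neg_log (measure (P n) {(real (s n) / real n) powr (\<alpha> / (\<alpha> - 1)) ..}))
         \<succ>\<succ> (\<lambda>n. ereal (real (s n) * ln (real n / real (s n))))"
    and "\<And>n. n \<ge> 1 \<Longrightarrow>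
           Max ((\<lambda>j. \<bar>\<theta>s n j\<bar>) ` {..<n}) \<le> (real n / real (s n)) powr (\<omega> / (5 * \<alpha>))"
  shows "(\<lambda>n. expected_posterior_prob \<pi>\<^sub>0 (P n) n (\<theta>s n)
            (\<lambda>\<theta>. l2_dist n \<theta> (\<theta>s n) \<ge> C1 \<omega> * sqrt (real (s n) * ln (real n / real (s n)))))
         \<longlonglongrightarrow> 0
       \<and> (\<lambda>n. expected_posterior_prob \<pi>\<^sub>0 (P n) n (\<theta>s n)
            (\<lambda>\<theta>. l1_dist n \<theta> (\<theta>s n) \<ge> real (s n) * C2 \<omega> * sqrt (ln (real n / real (s n)))))
         \<longlonglongrightarrow> 0"
proof -
  have "sqrt (2 + \<omega>) < min (C1 \<omega>) (C2 \<omega>)"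
    using assms(1) by (simp add: C1_def C2_def add_pos_pos)
  \<comment> \<open>The signal part of the error may be as large as \<open>b\<close> times the rate; the gap up to \<open>C1 \<omega>\<close> and \<open>C2 \<omega>\<close> is left to the null coordinates.\<close>
  then obtain b where b: "sqrt (2 + \<omega>) < b" "b < C1 \<omega>" "b < C2 \<omega>"
    using dense[of "sqrt (2 + \<omega>)" "min (C1 \<omega>) (C2 \<omega>)"] by auto
  have b0: "0 < b" using b(1) assms(1) real_sqrt_ge_zero[of "2 + \<omega>"] by linarith
  have b2: "2 + \<omega> < b\<^sup>2"
    using power_strict_mono[OF b(1), of 2] assms(1) by simp
  define \<eta> where "\<eta> = min ((C1 \<omega>)\<^sup>2 - b\<^sup>2) (C2 \<omega> - b)"
  have \<eta>: "0 < \<eta>" using b b0 by (simp add: \<eta>_def power_strict_mono)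
  have split: "(\<Sum>i<n. g i) = (\<Sum>i | i < n \<and> \<theta>s n i \<noteq> 0. g i) + (\<Sum>i\<in>{..<n} - {i. i < n \<and> \<theta>s n i \<noteq> 0}. g i)"
    for n and g :: "nat \<Rightarrow> real"
    by (subst sum.subset_diff[of "{i. i < n \<and> \<theta>s n i \<noteq> 0}" "{..<n}"]) (auto simp: add.commute)
  have null: "(\<Sum>i\<in>{..<n} - {i. i < n \<and> \<theta>s n i \<noteq> 0}. g (x i - \<theta>s n i))
      = (\<Sum>i\<in>{..<n} - {i. i < n \<and> \<theta>s n i \<noteq> 0}. g (x i))" for n x and g :: "real \<Rightarrow> real"
    by (intro sum.cong) auto
  let ?bad = "\<lambda>n x. b\<^sup>2 * (real (s n) * ln (real n / real (s n))) \<le> (\<Sum>i | i < n \<and> \<theta>s n i \<noteq> 0. (x i - \<theta>s n i)\<^sup>2) \<or>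
         \<eta> * (real (s n) * sqrt (ln (real n / real (s n)))) \<le> (\<Sum>i\<in>{..<n} - {i. i < n \<and> \<theta>s n i \<noteq> 0}. (x i)\<^sup>2 + \<bar>x i\<bar>)"
  have concentration: "(\<lambda>n. expected_posterior_prob \<pi>\<^sub>0 (P n) n (\<theta>s n) (A n)) \<longlonglongrightarrow> 0"
    if "\<And>n. {x \<in> space (leb n). A n x} \<in> sets (leb n)"
      "\<And>n x. 1 \<le> n \<Longrightarrow> 1 \<le> ln (real n / real (s n)) \<Longrightarrow> A n x \<Longrightarrow>
         ?bad n x"
    for A
    by (rule posterior_concentration[OF assms(1,2,3,5,6,7,8,9,11,12,13) b2 \<eta> that])
  show ?thesis
  proof (intro conjI concentration)
    fix n
    show "{x \<in> space (leb n). C1 \<omega> * sqrt (real (s n) * ln (real n / real (s n))) \<le> l2_dist n x (\<theta>s n)} \<in> sets (leb n)"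
      unfolding l2_dist_def L2_set_def by measurable
    show "{x \<in> space (leb n). real (s n) * C2 \<omega> * sqrt (ln (real n / real (s n))) \<le> l1_dist n x (\<theta>s n)} \<in> sets (leb n)"
      unfolding l1_dist_def by measurable
    fix x assume n: "1 \<le> n" and L: "1 \<le> ln (real n / real (s n))"
    define L where "L = ln (real n / real (s n))"
    define S where "S = {i. i < n \<and> \<theta>s n i \<noteq> 0}"
    define N where "N = {..<n} - S"
    have L1: "1 \<le> L" "1 \<le> sqrt L" "sqrt L * sqrt L = L" using L by (auto simp: L_def)
    have s1: "1 \<le> real (s n)" using assms(7)[OF n] by simp
    have L_ge: "sqrt L \<le> L" using L1 mult_left_mono[of 1 "sqrt L" "sqrt L"] by simp
    define u where "u = (\<Sum>i\<in>S. (x i - \<theta>s n i)\<^sup>2)"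
    have null_nonneg: "0 \<le> (\<Sum>i\<in>N. (x i)\<^sup>2)" "0 \<le> (\<Sum>i\<in>N. \<bar>x i\<bar>)" by (auto intro: sum_nonneg)
    have goal: "b\<^sup>2 * (real (s n) * L) \<le> u \<or> \<eta> * (real (s n) * sqrt L) \<le> (\<Sum>i\<in>N. (x i)\<^sup>2) + (\<Sum>i\<in>N. \<bar>x i\<bar>) \<Longrightarrow>
       ?bad n x"
      unfolding S_def[symmetric] N_def[symmetric] L_def[symmetric] u_def sum.distrib .
    {
      assume "C1 \<omega> * sqrt (real (s n) * ln (real n / real (s n))) \<le> l2_dist n x (\<theta>s n)"
      then have A: "C1 \<omega> * sqrt (real (s n) * L) \<le> sqrt (\<Sum>i<n. (x i - \<theta>s n i)\<^sup>2)"
        by (simp add: L_def l2_dist_def L2_set_def)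
      have "(C1 \<omega> * sqrt (real (s n) * L))\<^sup>2 \<le> (sqrt (\<Sum>i<n. (x i - \<theta>s n i)\<^sup>2))\<^sup>2"
        using A b b0 s1 L1 by (intro power_mono) auto
      then have "(C1 \<omega>)\<^sup>2 * (real (s n) * L) \<le> (\<Sum>i<n. (x i - \<theta>s n i)\<^sup>2)"
        using s1 L1 by (simp add: power_mult_distrib sum_nonneg)
      also have "\<dots> = u + (\<Sum>i\<in>N. (x i)\<^sup>2)"
        using split[of "\<lambda>i. (x i - \<theta>s n i)\<^sup>2" n] null[of "\<lambda>v. v\<^sup>2" x n] by (simp add: u_def S_def N_def)
      finally have le: "(C1 \<omega>)\<^sup>2 * (real (s n) * L) \<le> u + (\<Sum>i\<in>N. (x i)\<^sup>2)" .
      have "\<eta> * (real (s n) * sqrt L) \<le> ((C1 \<omega>)\<^sup>2 - b\<^sup>2) * (real (s n) * L)"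
        using \<eta> s1 L_ge L1 by (intro mult_mono) (auto simp: \<eta>_def)
      then have "b\<^sup>2 * (real (s n) * L) \<le> u \<or> \<eta> * (real (s n) * sqrt L) \<le> (\<Sum>i\<in>N. (x i)\<^sup>2) + (\<Sum>i\<in>N. \<bar>x i\<bar>)"
        using le null_nonneg unfolding left_diff_distrib by linarith
      then show "?bad n x"
        by (rule goal)
    next
      assume A: "real (s n) * C2 \<omega> * sqrt (ln (real n / real (s n))) \<le> l1_dist n x (\<theta>s n)"
      define a where "a = (\<Sum>i\<in>S. \<bar>x i - \<theta>s n i\<bar>)"
      have le: "C2 \<omega> * (real (s n) * sqrt L) \<le> a + (\<Sum>i\<in>N. \<bar>x i\<bar>)"
        using A split[of "\<lambda>i. \<bar>x i - \<theta>s n i\<bar>" n] null[of abs x n]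
        by (simp add: L_def l1_dist_def a_def S_def N_def mult_ac)
      have "\<eta> * (real (s n) * sqrt L) \<le> (C2 \<omega> - b) * (real (s n) * sqrt L)"
        using s1 L1 by (intro mult_right_mono) (auto simp: \<eta>_def)
      \<comment> \<open>Cauchy's inequality on the support turns the bound on the squared error into one on the absolute error.\<close>
      moreover have "a < b * (real (s n) * sqrt L)" if "u < b\<^sup>2 * (real (s n) * L)"
      proof (rule power2_less_imp_less)
        have "a\<^sup>2 \<le> (\<Sum>i\<in>S. \<bar>x i - \<theta>s n i\<bar>\<^sup>2) * real (card S)"
          unfolding a_def by (rule sum_squared_le_sum_of_squares)
        also have "\<dots> = real (s n) * u"
          using assms(6)[OF n] by (simp add: u_def S_def)
        also have "\<dots> < real (s n) * (b\<^sup>2 * (real (s n) * L))"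
          using that s1 by (intro mult_strict_left_mono) auto
        also have "\<dots> = (b * (real (s n) * sqrt L))\<^sup>2"
          using L1 by (simp add: power_mult_distrib power2_eq_square)
        finally show "a\<^sup>2 < (b * (real (s n) * sqrt L))\<^sup>2" .
      qed (use b0 s1 L1 in auto)
      ultimately have "b\<^sup>2 * (real (s n) * L) \<le> u \<or> \<eta> * (real (s n) * sqrt L) \<le> (\<Sum>i\<in>N. (x i)\<^sup>2) + (\<Sum>i\<in>N. \<bar>x i\<bar>)"
        using le null_nonneg unfolding left_diff_distrib by linarith
      then show "?bad n x"
        by (rule goal)
    }
  qed
qed

end
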